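(* If $\mathcal{A}$ is a Banach algebra with $C_w$-group $\Psi$, then the Bessel potential space $\mathcal{P}_r(\mathcal{A})$ is a Banach subalgebra of $\mathcal{A}$ for every $r>0$. Moreover, $\mathcal{P}_r(\mathcal{A})$ is inverse-closed in $\mathcal{A}$.
   Context: Banach algebras are complex and unital; a Banach space with a multiplication satisfying $\|ab\|\le C\|a\|\|b\|$ for some constant $C$ is regarded as a Banach algebra (it is one for an equivalent norm). A subalgebra $\mathcal{B}\subseteq\mathcal{A}$ with the same multiplication and identity is inverse-closed in $\mathcal{A}$ if $b\in\mathcal{B}$ and $b^{-1}\in\mathcal{A}$ imply $b^{-1}\in\mathcal{B}$. A $d$-parameter automorphism group acting on $\mathcal{A}$ is a family $\Psi=\{\psi_t\}_{t\in\mathbb{R}^d}$ of Banach algebra automorphisms of $\mathcal{A}$ with $\psi_s\psi_t=\psi_{s+t}$ (consisting of $*$-automorphisms if $\mathcal{A}$ is a $*$-algebra), always assumed uniformly bounded: $M_\Psi=\sup_t\|\psi_t\|_{\mathcal{A}\to\mathcal{A}}<\infty$. $C_w$-groups: for $a\in\mathcal{A}$, $a'\in\mathcal{A}'$ (dual space) put $G_{a',a}(t)=\langle a',\psi_t(a)\rangle$, and let $\mathcal{A}'_\Psi=\{a'\in\mathcal{A}': G_{a',a}\text{ is continuous for all }a\in\mathcal{A}\}$. $\Psi$ is a $C_w$-group if (i) $\mathcal{A}'_\Psi$ is norm fundamental, i.e. $\|a\|_{\mathcal{A}}=\sup\{|\langle a',a\rangle|:a'\in\mathcal{A}'_\Psi,\|a'\|_{\mathcal{A}'}\le1\}$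 for all $a\in\mathcal{A}$, and (ii) the convex hull of every $\sigma(\mathcal{A},\mathcal{A}'_\Psi)$-compact set has $\sigma(\mathcal{A},\mathcal{A}'_\Psi)$-compact closure. Then for every finite Borel measure $\mu$ on $\mathbb{R}^d$ and $a\in\mathcal{A}$ there is an element $\mu*a\in\mathcal{A}$ determined by $\langle a',\mu*a\rangle=\int\langle a',\psi_{-t}(a)\rangle\,d\mu(t)$ for all $a'\in\mathcal{A}'_\Psi$; for $f\in L^1(\mathbb{R}^d)$, $f*a$ means $(f\,dt)*a$. Bessel potential spaces: the Bessel kernel $\mathcal{G}_r\in L^1(\mathbb{R}^d)$, $r>0$, has Fourier transform $\int\mathcal{G}_r(x)e^{-2\pi i\omega\cdot x}dx=(1+|2\pi\omega|_2^2)^{-r/2}$, where $|\cdot|_2$ is the Euclidean norm. The Bessel potential space is $\mathcal{P}_r(\mathcal{A})=\{\mathcal{G}_r*y:y\in\mathcal{A}\}$ with norm $\|\mathcal{G}_r*y\|_{\mathcal{P}_r(\mathcal{A})}=\|y\|_{\mathcal{A}}$ (well defined, since $y\mapsto\mathcal{G}_r*y$ is injective on $\mathcal{A}$). *)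

theory Defs
  imports "HOL-Analysis.Analysis"
begin

text \<open>
  A complex unital Banach algebra. Multiplication is only required to be bounded up to a constant,
  and the norm of the identity is not normalised, so the class is stable under passing to an
  equivalent norm; the trivial algebra (\<open>1 = 0\<close>) is not excluded.
\<close>

class complex_banach_algebra = banach + ring + monoid_mult +
  fixes scaleC :: "complex \<Rightarrow> 'a \<Rightarrow> 'a"  (infixr \<open>*\<^sub>C\<close> 75)
  assumes scaleC_add_right: "c *\<^sub>C (x + y) = c *\<^sub>C x + c *\<^sub>C y"
    and scaleC_add_left: "(c + c') *\<^sub>C x = c *\<^sub>C x + c' *\<^sub>C x"
    and scaleC_scaleC: "c *\<^sub>C c' *\<^sub>C x = (c * c') *\<^sub>C x"
    and scaleR_scaleC: "s *\<^sub>R x = complex_of_real s *\<^sub>C x"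
    and norm_scaleC: "norm (c *\<^sub>C x) = cmod c * norm x"
    and mult_scaleC_left: "(c *\<^sub>C x) * y = c *\<^sub>C (x * y)"
    and mult_scaleC_right: "x * (c *\<^sub>C y) = c *\<^sub>C (x * y)"
    and norm_mult_bounded: "\<exists>K. \<forall>x y. norm (x * y) \<le> K * norm x * norm y"

definition banach_dual :: "('a::complex_banach_algebra \<Rightarrow> complex) set" where
  "banach_dual = {f. bounded_linear f \<and> (\<forall>c x. f (c *\<^sub>C x) = c * f x)}"

definition banach_algebra_automorphism :: "('a::complex_banach_algebra \<Rightarrow> 'a) \<Rightarrow> bool" where
  "banach_algebra_automorphism \<phi> \<longleftrightarrow>
     bij \<phi> \<and> bounded_linear \<phi> \<and> (\<forall>c x. \<phi> (c *\<^sub>C x) = c *\<^sub>C \<phi> x) \<and>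
     (\<forall>x y. \<phi> (x * y) = \<phi> x * \<phi> y) \<and> \<phi> 1 = 1"

definition automorphism_group :: "(real^'d \<Rightarrow> 'a::complex_banach_algebra \<Rightarrow> 'a) \<Rightarrow> bool" where
  "automorphism_group \<psi> \<longleftrightarrow>
     (\<forall>t. banach_algebra_automorphism (\<psi> t)) \<and>
     (\<forall>s t. \<psi> s \<circ> \<psi> t = \<psi> (s + t)) \<and>
     bdd_above (range (\<lambda>t. onorm (\<psi> t)))"

definition group_dual ::
    "(real^'d \<Rightarrow> 'a::complex_banach_algebra \<Rightarrow> 'a) \<Rightarrow> ('a \<Rightarrow> complex) set" where
  "group_dual \<psi> = {f \<in> banach_dual. \<forall>a. continuous_on UNIV (\<lambda>t. f (\<psi> t a))}"

definition norm_fundamental :: "('a::complex_banach_algebra \<Rightarrow> complex) set \<Rightarrow> bool" where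
  "norm_fundamental F \<longleftrightarrow> (\<forall>a. norm a = (SUP f\<in>{f \<in> F. onorm f \<le> 1}. cmod (f a)))"

text \<open>The topology \<open>\<sigma>(\<A>, F)\<close>, the coarsest one making every functional in \<open>F\<close> continuous.\<close>

definition weak_topology_of :: "('a::complex_banach_algebra \<Rightarrow> complex) set \<Rightarrow> 'a topology" where
  "weak_topology_of F = topology_generated_by {f -` U | f U. f \<in> F \<and> open U}"

definition cw_group :: "(real^'d \<Rightarrow> 'a::complex_banach_algebra \<Rightarrow> 'a) \<Rightarrow> bool" where
  "cw_group \<psi> \<longleftrightarrow>
     automorphism_group \<psi> \<and>
     norm_fundamental (group_dual \<psi>) \<and>
     (let \<sigma> = weak_topology_of (group_dual \<psi>)
      in \<forall>K. compactin \<sigma> K \<longrightarrow> compactin \<sigma> (\<sigma> closure_of (convex hull K)))"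

text \<open>The element \<open>f * a\<close> for an integrable \<open>f\<close>; for a \<open>C\<^sub>w\<close>-group it exists and is unique.\<close>

definition group_conv ::
    "(real^'d \<Rightarrow> 'a::complex_banach_algebra \<Rightarrow> 'a) \<Rightarrow> (real^'d \<Rightarrow> complex) \<Rightarrow> 'a \<Rightarrow> 'a" where
  "group_conv \<psi> f a =
     (THE b. \<forall>a'\<in>group_dual \<psi>. a' b = (LINT t|lborel. a' (\<psi> (- t) a) * f t))"

text \<open>
  The Bessel kernel is determined by its Fourier transform up to a null set; the choice of a
  representative does not affect \<^const>\<open>group_conv\<close>.
\<close>

definition bessel_kernel :: "real \<Rightarrow> real^'d \<Rightarrow> complex" where
  "bessel_kernel r = (SOME G. integrable lborel G \<and>
     (\<forall>\<omega>. (LINT x|lborel. G x * exp (- 2 * of_real pi * \<i> * of_real (\<omega> \<bullet> x))) =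
           of_real ((1 + (norm ((2 * pi) *\<^sub>R \<omega>))\<^sup>2) powr (- r / 2))))"

definition bessel_space ::
    "(real^'d \<Rightarrow> 'a::complex_banach_algebra \<Rightarrow> 'a) \<Rightarrow> real \<Rightarrow> 'a set" where
  "bessel_space \<psi> r = {group_conv \<psi> (bessel_kernel r) y | y. y \<in> UNIV}"

definition bessel_norm ::
    "(real^'d \<Rightarrow> 'a::complex_banach_algebra \<Rightarrow> 'a) \<Rightarrow> real \<Rightarrow> 'a \<Rightarrow> real" where
  "bessel_norm \<psi> r x = norm (THE y. x = group_conv \<psi> (bessel_kernel r) y)"

definition subalgebra :: "'a::complex_banach_algebra set \<Rightarrow> bool" where
  "subalgebra B \<longleftrightarrow>
     0 \<in> B \<and> 1 \<in> B \<and> (\<forall>x\<in>B. \<forall>y\<in>B. x + y \<in> B \<and> x * y \<in> B) \<and> (\<forall>c. \<forall>x\<in>B. c *\<^sub>C x \<in> B)"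

text \<open>
  A subalgebra that is a Banach algebra for a norm \<open>N\<close> of its own (only the values of \<open>N\<close> on \<open>B\<close>
  matter) and is continuously embedded in the ambient algebra.
\<close>

definition banach_subalgebra :: "'a::complex_banach_algebra set \<Rightarrow> ('a \<Rightarrow> real) \<Rightarrow> bool" where
  "banach_subalgebra B N \<longleftrightarrow>
     subalgebra B \<and>
     (\<forall>x\<in>B. 0 \<le> N x \<and> (N x = 0 \<longleftrightarrow> x = 0)) \<and>
     (\<forall>c. \<forall>x\<in>B. N (c *\<^sub>C x) = cmod c * N x) \<and>
     (\<forall>x\<in>B. \<forall>y\<in>B. N (x + y) \<le> N x + N y) \<and>
     (\<forall>X. (\<forall>n. X n \<in> B) \<and> (\<forall>e>0. \<exists>n0. \<forall>m\<ge>n0. \<forall>n\<ge>n0. N (X m - X n) < e) \<longrightarrow>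
          (\<exists>x\<in>B. (\<lambda>n. N (X n - x)) \<longlonglongrightarrow> 0)) \<and>
     (\<exists>K. \<forall>x\<in>B. \<forall>y\<in>B. N (x * y) \<le> K * N x * N y) \<and>
     (\<exists>K. \<forall>x\<in>B. norm x \<le> K * N x)"

definition inverse_closed :: "'a::complex_banach_algebra set \<Rightarrow> bool" where
  "inverse_closed B \<longleftrightarrow> (\<forall>b\<in>B. \<forall>c. b * c = 1 \<and> c * b = 1 \<longrightarrow> c \<in> B)"

end

theory Submission
  imports Defs "HOL-Probability.Characteristic_Functions" "HOL-Probability.Convolution"
    "HOL-Real_Asymp.Real_Asymp"
begin

text \<open>
  Let \<open>J\<^sub>\<alpha> = G\<^sub>2\<^sub>\<alpha> *\<close>, which acts as \<open>(1 - \<Delta>) powr (- \<alpha>)\<close>. The Bessel kernel is the Gamma mixture of heat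
  kernels, so \<open>J\<^sub>\<alpha>\<close> is inverted, up to an approximate identity, by the truncations \<open>L\<^sub>\<epsilon>\<close> at \<open>s \<ge> \<epsilon>\<close> of the
  Balakrishnan integral \<open>\<integral>s. s powr (- 1 - \<alpha>) (1 - exp (- s) g\<^sub>s *)\<close> with heat kernels \<open>g\<^sub>s\<close>. If \<open>\<alpha> < 1/2\<close>,
  elements of the form \<open>J\<^sub>\<alpha> u\<close> are Hoelder continuous along \<open>\<psi>\<close> with an exponent \<open>\<theta> > \<alpha>\<close>, and in
  \<open>L\<^sub>\<epsilon> (x y) = L\<^sub>\<epsilon> x \<sqdot> y + x \<sqdot> L\<^sub>\<epsilon> y - I\<^sub>\<epsilon> (x, y)\<close> the remainder, built from \<open>(\<psi> x - x) (\<psi> y - y)\<close>, converges in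
  norm. The other terms converge weakly, because multiplication by an element with norm-continuous orbit
  preserves the functionals of \<^const>\<open>group_dual\<close>. Hence \<open>J\<^sub>\<alpha> u \<sqdot> J\<^sub>\<alpha> v = J\<^sub>\<alpha> (u \<circ> v)\<close>, and the same rule applied
  to \<open>x\<close> and its inverse gives inverse-closedness. Now \<open>\<circ>\<close> is another Banach algebra multiplication
  on the same Banach space with unit \<open>1\<close>, for which \<open>\<psi>\<close> still acts by automorphisms; the
  \<open>C\<^sub>w\<close>-conditions do not involve the multiplication. So the argument can be iterated, and
  \<open>J\<^sub>r\<^sub>/\<^sub>2\<close> is a power of \<open>J\<^sub>\<alpha>\<close> with \<open>\<alpha> = r / (2 n)\<close> small.
\<close>

section \<open>The Gaussian measure and Fourier uniqueness\<close>

text \<open>Orbits are only weakly continuous, so the averages are not Bochner integrals: they are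
  characterised by the functionals in \<open>group_dual\<close>, and norms are recovered because
  these are norm fundamental. The obstacle is that multiplication need not be weakly continuous, so
  a term in which both factors move with the averaging variable has to converge in norm. That term
  carries the weight s^(-1-\<alpha>) and two increments of order s^(\<theta>/2), so its bound is
  integrable at s = 0 when \<theta> > \<alpha>, while J_\<alpha> supplies any \<theta> < 2\<alpha>
  with \<theta> \<le> 1; the choice made is \<theta> = 3\<alpha>/2. Operator identities are checked
  on Fourier transforms. For mixtures of heat kernels these are Laplace transforms of a measure of
  times on the half line, evaluated at |w|^2. The 1 in 1 - \<Delta> shows up as an exponential
  factor in each of these measures. No spectral theory enters inverse-closedness: the inverse of a
  Hoelder element is Hoelder with the same exponent, so the product rule can be applied to the pair
  and solved for the inverse.\<close>

lemma (in finite_measure) norm_integral_le_const: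
  fixes f :: "'a \<Rightarrow> 'b::{banach, second_countable_topology}"
  assumes "f \<in> borel_measurable M" and "\<And>x. x \<in> space M \<Longrightarrow> norm (f x) \<le> B"
  shows "norm (LINT x|M. f x) \<le> measure M (space M) * B"
proof -
  have "integrable M f"
    using assms by (intro integrable_const_bound[where B=B]) auto
  then have "(LINT x|M. norm (f x)) \<le> (LINT x|M. B)"
    using assms by (intro integral_mono) auto
  then show ?thesis
    using order_trans[OF integral_norm_bound] by auto
qed

definition gauss_density :: "'e::euclidean_space \<Rightarrow> real" where
  "gauss_density z = (\<Prod>b\<in>Basis. std_normal_density (z \<bullet> b))"

definition gauss :: "'e::euclidean_space measure" where
  "gauss = density lborel (\<lambda>z. ennreal (gauss_density z))"

lemma gauss_density_altdef:
  "gauss_density (z::'e::euclidean_space) = (1 / sqrt (2 * pi)) ^ DIM('e) * exp (- (norm z)\<^sup>2 / 2)"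
proof -
  have "(norm z)\<^sup>2 = (\<Sum>b\<in>Basis. (z \<bullet> b)\<^sup>2)"
    unfolding power2_norm_eq_inner by (subst euclidean_inner) (simp add: power2_eq_square)
  then show ?thesis
    by (simp add: gauss_density_def std_normal_density_def prod.distrib prod_constant
        exp_sum[symmetric] sum_negf sum_divide_distrib prod_dividef power_divide)
qed

lemma gauss_density_measurable [measurable]: "gauss_density \<in> borel_measurable borel"
  unfolding gauss_density_def[abs_def] by measurable

lemma gauss_density_pos: "gauss_density z > 0"
  unfolding gauss_density_altdef by simp

lemma gauss_density_nonneg [simp]: "gauss_density z \<ge> 0"
  using gauss_density_pos[of z] by simp

lemma sets_gauss [measurable_cong, simp]: "sets gauss = sets borel"
  and space_gauss [simp]: "space gauss = UNIV"
  by (simp_all add: gauss_def)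

lemma emeasure_gauss_UNIV: "emeasure (gauss :: 'e::euclidean_space measure) UNIV = 1"
proof -
  have 1: "(\<integral>\<^sup>+x. ennreal (std_normal_density x) \<partial>lborel) = 1"
    using prob_space.emeasure_space_1[OF prob_space_normal_density[of 1 0]]
    by (simp add: emeasure_density)
  have "emeasure (gauss :: 'e measure) UNIV = (\<integral>\<^sup>+z. ennreal (gauss_density (z::'e)) \<partial>lborel)"
    by (simp add: gauss_def emeasure_density)
  also have "\<dots> = (\<integral>\<^sup>+z. (\<Prod>b\<in>Basis. ennreal (std_normal_density ((z::'e) \<bullet> b))) \<partial>lborel)"
    by (simp add: gauss_density_def prod_ennreal)
  also have "\<dots> = 1"
    by (subst nn_integral_lborel_prod[where f="\<lambda>_ x. ennreal (std_normal_density x)"]) (simp_all add: 1)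
  finally show ?thesis .
qed

lemma measure_gauss_UNIV [simp]: "measure gauss UNIV = 1"
  by (simp add: measure_def emeasure_gauss_UNIV)

lemma prob_space_gauss: "prob_space gauss"
  by (rule prob_spaceI) (simp add: emeasure_gauss_UNIV)

global_interpretation gauss: prob_space gauss
  by (rule prob_space_gauss)

lemma integrable_gauss_density: "integrable lborel (gauss_density :: 'e::euclidean_space \<Rightarrow> real)"
proof -
  have "integrable gauss (\<lambda>_::'e. 1::real)"
    by simp
  then show ?thesis
    unfolding gauss_def by (subst (asm) integrable_density) auto
qed

lemma integral_gauss_density: "(LINT z|lborel. gauss_density (z::'e::euclidean_space)) = 1"
proof -
  have "(LINT z::'e|gauss. (1::real)) = (LINT z|lborel. gauss_density (z::'e))"
    unfolding gauss_def by (subst integral_density) auto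
  then show ?thesis
    by (simp add: measure_def emeasure_gauss_UNIV)
qed

lemma integral_gauss:
  fixes f :: "'e::euclidean_space \<Rightarrow> 'b::{banach, second_countable_topology}"
  assumes "f \<in> borel_measurable borel"
  shows "(LINT z|gauss. f z) = (LINT z|lborel. gauss_density z *\<^sub>R f z)"
  unfolding gauss_def using assms by (subst integral_density) auto

lemma integrable_gauss:
  fixes f :: "'e::euclidean_space \<Rightarrow> 'b::{banach, second_countable_topology}"
  assumes "f \<in> borel_measurable borel"
  shows "integrable gauss f \<longleftrightarrow> integrable lborel (\<lambda>z. gauss_density z *\<^sub>R f z)"
  unfolding gauss_def using assms by (subst integrable_density) auto

text \<open>\<open>lborel\<close> is the image of a product measure over the basis, so the integral
  factorises into characteristic functions of the one-dimensional standard normal law.\<close>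

lemma gauss_fourier:
  fixes w :: "'e::euclidean_space"
  shows "(LINT z|gauss. iexp (w \<bullet> z)) = of_real (exp (- (norm w)\<^sup>2 / 2))"
proof -
  interpret P: product_sigma_finite "\<lambda>_::'e. (lborel :: real measure)"
    by standard
  have int1: "integrable lborel (\<lambda>x. std_normal_density x *\<^sub>R iexp (t * x))" for t
  proof -
    interpret N: prob_space std_normal_distribution
      by (rule prob_space_normal_density) simp
    have "integrable std_normal_distribution (\<lambda>x. iexp (t * x))"
      by (rule N.integrable_const_bound[of _ 1]) auto
    then show ?thesis
      by (subst (asm) integrable_density) auto
  qed
  have ch: "(LINT x|lborel. std_normal_density x *\<^sub>R iexp (t * x)) = of_real (exp (- t\<^sup>2 / 2))" for t
  proof -
    have "char std_normal_distribution t = (LINT x|lborel. std_normal_density x *\<^sub>R iexp (t * x))"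
      unfolding char_def by (subst integral_density) auto
    then show ?thesis
      by (simp add: char_std_normal_distribution)
  qed
  have "(LINT z|gauss. iexp (w \<bullet> z)) = (LINT z|lborel. gauss_density z *\<^sub>R iexp (w \<bullet> z))"
    by (rule integral_gauss) measurable
  also have "\<dots> = (LINT z|lborel. (\<Prod>b\<in>Basis. std_normal_density (z \<bullet> b) *\<^sub>R iexp ((w \<bullet> b) * (z \<bullet> b))))"
  proof (rule Bochner_Integration.integral_cong)
    fix z :: 'e
    have "iexp (w \<bullet> z) = (\<Prod>b\<in>Basis. iexp ((w \<bullet> b) * (z \<bullet> b)))"
      by (subst euclidean_inner) (simp add: exp_sum sum_distrib_left)
    then show "gauss_density z *\<^sub>R iexp (w \<bullet> z)
        = (\<Prod>b\<in>Basis. std_normal_density (z \<bullet> b) *\<^sub>R iexp ((w \<bullet> b) * (z \<bullet> b)))"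
      by (simp add: gauss_density_def scaleR_conv_of_real prod.distrib)
  qed simp
  also have "\<dots> = (LINT f|(\<Pi>\<^sub>M b\<in>Basis. lborel). (\<Prod>b\<in>Basis. std_normal_density (f b) *\<^sub>R iexp ((w \<bullet> b) * f b)))"
    by (subst lborel_def, subst integral_distr) (simp_all add: lborel_eq_real[symmetric] cong: prod.cong)
  also have "\<dots> = (\<Prod>b\<in>Basis. LINT x|lborel. std_normal_density x *\<^sub>R iexp ((w \<bullet> b) * x))"
    by (rule P.product_integral_prod) (simp_all only: finite_Basis int1)
  also have "\<dots> = of_real (\<Prod>b\<in>Basis. exp (- (w \<bullet> b)\<^sup>2 / 2))"
    by (simp only: ch of_real_prod)
  also have "(\<Prod>b\<in>Basis. exp (- (w \<bullet> b)\<^sup>2 / 2)) = exp (- (norm w)\<^sup>2 / 2)"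
    unfolding power2_norm_eq_inner
    by (subst (2) euclidean_inner) (simp add: exp_sum[symmetric] sum_negf sum_divide_distrib power2_eq_square)
  finally show ?thesis .
qed

text \<open>The substitution y = x + c z moves the dependence on \<open>x\<close> out of
  \<open>h\<close> and into a Gaussian kernel, the form in which Fubini is applied in
  \<open>fourier_unique\<close>.\<close>

lemma integral_gauss_affine:
  fixes h :: "'e::euclidean_space \<Rightarrow> complex"
  assumes [measurable]: "h \<in> borel_measurable borel" and "c > 0"
  shows "(LINT z|gauss. h (x + c *\<^sub>R z)) =
    (LINT y|lborel. of_real (gauss_density ((1 / c) *\<^sub>R (y - x)) / c ^ DIM('e)) * h y)"
proof -
  have "(LINT y|lborel. of_real (gauss_density ((1 / c) *\<^sub>R (y - x)) / c ^ DIM('e)) * h y)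
     = (LINT z|lborel. gauss_density z *\<^sub>R h (x + c *\<^sub>R z))"
    using \<open>c > 0\<close>
    by (subst lborel_affine[of c x]) (simp_all add: integral_density integral_distr scaleR_conv_of_real)
  also have "\<dots> = (LINT z|gauss. h (x + c *\<^sub>R z))"
    by (rule integral_gauss[symmetric]) measurable
  finally show ?thesis by simp
qed

text \<open>\<open>gauss_fourier\<close> read backwards: a value of the Gaussian kernel becomes an
  integral of characters.\<close>

lemma gauss_density_integral:
  "of_real (gauss_density (v::'e::euclidean_space)) =
     (1 / sqrt (2 * pi)) ^ DIM('e) * (LINT z|gauss. iexp (v \<bullet> z))"
  by (simp add: gauss_fourier gauss_density_altdef)

text \<open>
  Smoothing by a Gaussian expresses the integrals through the Fourier transforms; the width of the
  Gaussian then tends to zero.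
\<close>

lemma fourier_unique:
  fixes \<mu> :: "'i \<Rightarrow> 'e::euclidean_space measure" and w :: "'i \<Rightarrow> 'e \<Rightarrow> complex"
    and h :: "'e \<Rightarrow> complex"
  assumes "finite I"
    and fin: "\<And>i. i \<in> I \<Longrightarrow> sigma_finite_measure (\<mu> i)"
    and sets: "\<And>i. i \<in> I \<Longrightarrow> sets (\<mu> i) = sets borel"
    and int: "\<And>i. i \<in> I \<Longrightarrow> integrable (\<mu> i) (w i)"
    and fourier: "\<And>v. (\<Sum>i\<in>I. LINT x|\<mu> i. w i x * iexp (v \<bullet> x)) = 0"
    and cont: "continuous_on UNIV h" and bdd: "\<And>x. norm (h x) \<le> B"
  shows "(\<Sum>i\<in>I. LINT x|\<mu> i. w i x * h x) = 0"
proof -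
  have [measurable]: "h \<in> borel_measurable borel"
    using cont by (rule borel_measurable_continuous_onI)
  have space: "space (\<mu> i) = UNIV" if "i \<in> I" for i
    using sets_eq_imp_space_eq[OF sets[OF that]] by simp
  have w_meas: "w i \<in> borel_measurable borel" if "i \<in> I" for i
    using int[OF that] sets[OF that] by (metis borel_measurable_integrable measurable_cong_sets)
  \<comment> \<open>With the Gaussian written as an integral of characters, \<open>x\<close> occurs
    only inside \<open>iexp\<close>; after Fubini the inner sum over \<open>I\<close> is an instance
    of \<open>fourier\<close>.\<close>
  have kernel: "(\<Sum>i\<in>I. LINT x|\<mu> i. w i x * of_real (gauss_density ((1 / c) *\<^sub>R (y - x)))) = 0"
    if "c > 0" for c y
  proof -
    have "(LINT x|\<mu> i. w i x * of_real (gauss_density ((1 / c) *\<^sub>R (y - x)))) =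
        (1 / sqrt (2 * pi)) ^ DIM('e) * (LINT z|gauss. iexp (z \<bullet> y / c) * (LINT x|\<mu> i. w i x * iexp ((- (1 / c) *\<^sub>R z) \<bullet> x)))"
      if i: "i \<in> I" for i
    proof -
      note [measurable_cong] = sets[OF i]
      note [measurable] = w_meas[OF i]
      interpret sigma_finite_measure "\<mu> i" using fin[OF i] .
      interpret P: pair_sigma_finite "\<mu> i" "gauss :: 'e measure" ..
      have P: "integrable (\<mu> i \<Otimes>\<^sub>M gauss) (\<lambda>(x, z). w i x * iexp (((1 / c) *\<^sub>R (y - x)) \<bullet> z))"
      proof (rule P.Fubini_integrable)
        show "AE x in \<mu> i. integrable gauss (\<lambda>z. case (x, z) of (x, z) \<Rightarrow> w i x * iexp (((1 / c) *\<^sub>R (y - x)) \<bullet> z))"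
          by (intro AE_I2 gauss.integrable_const_bound[where B="norm (w i _)"]) (auto simp: norm_mult)
        show "integrable (\<mu> i) (\<lambda>x. LINT z|gauss. norm (case (x, z) of (x, z) \<Rightarrow> w i x * iexp (((1 / c) *\<^sub>R (y - x)) \<bullet> z)))"
          using int[OF i] by (simp add: norm_mult measure_def emeasure_gauss_UNIV)
      qed measurable
      have "(LINT x|\<mu> i. w i x * of_real (gauss_density ((1 / c) *\<^sub>R (y - x)))) =
         (1 / sqrt (2 * pi)) ^ DIM('e) * (LINT x|\<mu> i. LINT z|gauss. w i x * iexp (((1 / c) *\<^sub>R (y - x)) \<bullet> z))"
        unfolding gauss_density_integral by (simp add: mult.left_commute[of "w i _"])
      also have "(LINT x|\<mu> i. LINT z|gauss. w i x * iexp (((1 / c) *\<^sub>R (y - x)) \<bullet> z)) =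
          (LINT z|gauss. LINT x|\<mu> i. w i x * iexp (((1 / c) *\<^sub>R (y - x)) \<bullet> z))"
        using P by (rule P.Fubini_integral[symmetric])
      also have "\<dots> = (LINT z|gauss. iexp (z \<bullet> y / c) * (LINT x|\<mu> i. w i x * iexp ((- (1 / c) *\<^sub>R z) \<bullet> x)))"
      proof (intro Bochner_Integration.integral_cong refl)
        fix z :: 'e
        have "w i x * iexp (((1 / c) *\<^sub>R (y - x)) \<bullet> z) = iexp (z \<bullet> y / c) * (w i x * iexp ((- (1 / c) *\<^sub>R z) \<bullet> x))" for x
          by (simp add: exp_add[symmetric] algebra_simps inner_diff_left inner_commute diff_divide_distrib flip: of_real_add)
        then show "(LINT x|\<mu> i. w i x * iexp (((1 / c) *\<^sub>R (y - x)) \<bullet> z)) =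
            iexp (z \<bullet> y / c) * (LINT x|\<mu> i. w i x * iexp ((- (1 / c) *\<^sub>R z) \<bullet> x))"
          by (simp only: integral_mult_right_zero)
      qed
      finally show ?thesis .
    qed
    then have "(\<Sum>i\<in>I. LINT x|\<mu> i. w i x * of_real (gauss_density ((1 / c) *\<^sub>R (y - x)))) =
        (1 / sqrt (2 * pi)) ^ DIM('e) * (\<Sum>i\<in>I. LINT z|gauss. iexp (z \<bullet> y / c) * (LINT x|\<mu> i. w i x * iexp ((- (1 / c) *\<^sub>R z) \<bullet> x)))"
      by (simp add: sum_distrib_left)
    also have "(\<Sum>i\<in>I. LINT z|gauss. iexp (z \<bullet> y / c) * (LINT x|\<mu> i. w i x * iexp ((- (1 / c) *\<^sub>R z) \<bullet> x))) =
        (LINT z|gauss. (\<Sum>i\<in>I. iexp (z \<bullet> y / c) * (LINT x|\<mu> i. w i x * iexp ((- (1 / c) *\<^sub>R z) \<bullet> x))))"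
    proof (rule Bochner_Integration.integral_sum[symmetric])
      fix i assume i: "i \<in> I"
      note [measurable_cong] = sets[OF i]
      note [measurable] = w_meas[OF i]
      interpret sigma_finite_measure "\<mu> i" using fin[OF i] .
      show "integrable gauss (\<lambda>z. iexp (z \<bullet> y / c) * (LINT x|\<mu> i. w i x * iexp ((- (1 / c) *\<^sub>R z) \<bullet> x)))"
      proof (rule gauss.integrable_const_bound[where B="LINT x|\<mu> i. norm (w i x)"])
        have "norm (LINT x|\<mu> i. w i x * iexp ((- (1 / c) *\<^sub>R z) \<bullet> x)) \<le> (LINT x|\<mu> i. norm (w i x))" for z
          by (rule order_trans[OF integral_norm_bound]) (simp add: norm_mult)
        then show "AE z in gauss. norm (iexp (z \<bullet> y / c) * (LINT x|\<mu> i. w i x * iexp ((- (1 / c) *\<^sub>R z) \<bullet> x))) \<le> (LINT x|\<mu> i. norm (w i x))"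
          by (simp add: norm_mult)
      qed measurable
    qed
    also have "\<dots> = 0"
      by (simp only: sum_distrib_left[symmetric] fourier mult_zero_right integral_zero)
    finally show ?thesis by simp
  qed
  \<comment> \<open>A Gaussian average of \<open>h\<close> is a superposition, with weight
    \<open>h y\<close>, of the kernels just treated.\<close>
  have smooth: "(\<Sum>i\<in>I. LINT x|\<mu> i. w i x * (LINT z|gauss. h (x + c *\<^sub>R z))) = 0" if c: "c > 0" for c
  proof -
    let ?k = "\<lambda>x y. of_real (gauss_density ((1 / c) *\<^sub>R (y - x)) / c ^ DIM('e)) * h y"
    have int_k: "integrable lborel (\<lambda>y. gauss_density ((1 / c) *\<^sub>R (y - x)) / c ^ DIM('e))" for x :: 'e
      using c integrable_gauss_density
      by (subst lborel_affine[of c x]) (simp_all add: integrable_density integrable_distr_eq)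
    have val_k: "(LINT y|lborel. gauss_density ((1 / c) *\<^sub>R (y - x)) / c ^ DIM('e)) = 1" for x :: 'e
      using c integral_gauss_density
      by (subst lborel_affine[of c x]) (simp_all add: integral_density integral_distr)
    have P: "integrable (\<mu> i \<Otimes>\<^sub>M lborel) (\<lambda>(x, y). w i x * ?k x y)" if i: "i \<in> I" for i
    proof -
      note [measurable_cong] = sets[OF i]
      note [measurable] = w_meas[OF i]
      interpret sigma_finite_measure "\<mu> i" using fin[OF i] .
      interpret P: pair_sigma_finite "\<mu> i" "lborel :: 'e measure" ..
      have nk: "norm (w i x * ?k x y) \<le> (norm (w i x) * B) * (gauss_density ((1 / c) *\<^sub>R (y - x)) / c ^ DIM('e))" for x y
        using mult_right_mono[OF bdd[of y], of "norm (w i x) * (gauss_density ((1 / c) *\<^sub>R (y - x)) / c ^ DIM('e))"] c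
        by (simp add: norm_mult norm_divide norm_power ac_simps)
      have ik: "integrable lborel (\<lambda>y. w i x * ?k x y)" for x
        by (rule Bochner_Integration.integrable_bound[OF integrable_mult_right[OF int_k[of x], of "norm (w i x) * B"]])
          (measurable, intro AE_I2, rule order_trans[OF nk], simp only: real_norm_def abs_ge_self)
      show ?thesis
      proof (rule P.Fubini_integrable)
        show "AE x in \<mu> i. integrable lborel (\<lambda>y. case (x, y) of (x, y) \<Rightarrow> w i x * ?k x y)"
          using ik by simp
        have "norm (LINT y|lborel. norm (w i x * ?k x y)) \<le> norm (norm (w i x) * B)" for x
        proof -
          have "(LINT y|lborel. norm (w i x * ?k x y)) \<le> (LINT y|lborel. (norm (w i x) * B) * (gauss_density ((1 / c) *\<^sub>R (y - x)) / c ^ DIM('e)))"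
            by (intro integral_mono integrable_norm ik integrable_mult_right int_k nk)
          also have "\<dots> = norm (w i x) * B"
            by (simp only: integral_mult_right_zero val_k mult_1_right)
          finally show ?thesis
            by (subst real_norm_def, subst abs_of_nonneg) (auto intro!: integral_nonneg_AE)
        qed
        moreover have "(\<lambda>x. LINT y|lborel. norm (w i x * ?k x y)) \<in> borel_measurable (\<mu> i)"
          by measurable
        ultimately show "integrable (\<mu> i) (\<lambda>x. LINT y|lborel. norm (case (x, y) of (x, y) \<Rightarrow> w i x * ?k x y))"
          unfolding prod.case
          by (intro Bochner_Integration.integrable_bound[OF integrable_mult_left[OF integrable_norm[OF int[OF i]], of B]] AE_I2)
      qed measurable
    qed
    have "(\<Sum>i\<in>I. LINT x|\<mu> i. w i x * (LINT z|gauss. h (x + c *\<^sub>R z))) =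
          (\<Sum>i\<in>I. LINT x|\<mu> i. LINT y|lborel. w i x * ?k x y)"
      by (subst integral_gauss_affine) (use c in simp_all)
    also have "\<dots> = (\<Sum>i\<in>I. LINT y|lborel. LINT x|\<mu> i. w i x * ?k x y)"
    proof (rule sum.cong[OF refl])
      fix i assume i: "i \<in> I"
      interpret sigma_finite_measure "\<mu> i" using fin[OF i] .
      interpret P: pair_sigma_finite "\<mu> i" "lborel :: 'e measure" ..
      show "(LINT x|\<mu> i. LINT y|lborel. w i x * ?k x y) = (LINT y|lborel. LINT x|\<mu> i. w i x * ?k x y)"
        using P[OF i] by (rule P.Fubini_integral[symmetric])
    qed
    also have "\<dots> = (LINT y|lborel. (\<Sum>i\<in>I. LINT x|\<mu> i. w i x * ?k x y))"
    proof (rule Bochner_Integration.integral_sum[symmetric])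
      fix i assume i: "i \<in> I"
      interpret sigma_finite_measure "\<mu> i" using fin[OF i] .
      interpret P: pair_sigma_finite "\<mu> i" "lborel :: 'e measure" ..
      show "integrable lborel (\<lambda>y. LINT x|\<mu> i. w i x * ?k x y)"
        using P.integrable_snd[OF P[OF i]] by simp
    qed
    also have "\<dots> = (LINT y|lborel. h y / of_real (c ^ DIM('e)) *
        (\<Sum>i\<in>I. LINT x|\<mu> i. w i x * of_real (gauss_density ((1 / c) *\<^sub>R (y - x)))))"
      unfolding sum_distrib_left
      by (intro Bochner_Integration.integral_cong refl sum.cong)
        (simp add: ac_simps flip: integral_mult_right_zero)
    also have "\<dots> = 0"
      by (simp only: kernel[OF c] mult_zero_right integral_zero)
    finally show ?thesis .
  qed
  have conv: "(\<lambda>n. LINT z|gauss. h (x + (1 / Suc n) *\<^sub>R z)) \<longlonglongrightarrow> h x" for x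
  proof -
    have "(\<lambda>n. LINT z|gauss. h (x + (1 / Suc n) *\<^sub>R z)) \<longlonglongrightarrow> (LINT z::'e|gauss. h x)"
    proof (rule integral_dominated_convergence[where w="\<lambda>_. B"])
      have "(\<lambda>n. x + (1 / Suc n) *\<^sub>R z) \<longlonglongrightarrow> x + 0 *\<^sub>R z" for z
        by (intro tendsto_intros LIMSEQ_Suc lim_1_over_n)
      then show "AE z in gauss. (\<lambda>n. h (x + (1 / Suc n) *\<^sub>R z)) \<longlonglongrightarrow> h x"
        using cont by (intro AE_I2 isCont_tendsto_compose[where g=h]) (auto simp: continuous_on_eq_continuous_at)
    qed (use bdd in auto)
    then show ?thesis by (simp add: measure_def emeasure_gauss_UNIV)
  qed
  have "(\<lambda>n. \<Sum>i\<in>I. LINT x|\<mu> i. w i x * (LINT z|gauss. h (x + (1 / Suc n) *\<^sub>R z))) \<longlonglongrightarrow> (\<Sum>i\<in>I. LINT x|\<mu> i. w i x * h x)"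
  proof (rule tendsto_sum)
    fix i assume i: "i \<in> I"
    note [measurable_cong] = sets[OF i]
    note [measurable] = w_meas[OF i]
    interpret sigma_finite_measure "\<mu> i" using fin[OF i] .
    have "norm (LINT z|gauss. h (x + (1 / Suc n) *\<^sub>R z)) \<le> B" for x n
      using gauss.norm_integral_le_const[of "\<lambda>z. h (x + (1 / Suc n) *\<^sub>R z)" B] bdd by simp
    then show "(\<lambda>n. LINT x|\<mu> i. w i x * (LINT z|gauss. h (x + (1 / Suc n) *\<^sub>R z))) \<longlonglongrightarrow> (LINT x|\<mu> i. w i x * h x)"
      by (intro integral_dominated_convergence[where w="\<lambda>x. norm (w i x) * B"])
        (auto simp: norm_mult intro!: mult_left_mono tendsto_mult_left conv[simplified] integrable_norm int[OF i])
  qed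
  then show ?thesis
    by (subst (asm) smooth) (simp_all add: LIMSEQ_const_iff)
qed

lemma integrable_gauss_density_shift:
  "integrable lborel (\<lambda>z. gauss_density ((z::'e::euclidean_space) + v))"
  and integral_gauss_density_shift:
  "(LINT z|lborel. gauss_density ((z::'e::euclidean_space) + v)) = 1"
  using integrable_gauss_density integral_gauss_density
  by (subst lborel_affine[of 1 "- v"]; simp add: density_1 integrable_distr_eq integral_distr)+

text \<open>
  Hellinger distance: the integral of \<open>sqrt (\<gamma> (z + v) * \<gamma> z)\<close> is explicit, and
  \<open>\<bar>a - b\<bar> = \<bar>sqrt a - sqrt b\<bar> (sqrt a + sqrt b)\<close> is estimated by the weighted AM-GM inequality.
\<close>

lemma gauss_density_shift_diff:
  fixes v :: "'e::euclidean_space"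
  shows "(LINT z|lborel. \<bar>gauss_density (z + v) - gauss_density z\<bar>) \<le> norm v"
proof (cases "v = 0")
  case False
  \<comment> \<open>With 1 - e \<le> |v|^2/8 and 1 + e \<le> 2 the estimate ends in |v|^2/(8k) + 2k,
    which is minimal at this \<open>k\<close> and then equals |v|. The number \<open>e\<close> is
    the Hellinger affinity of the two shifted Gaussians.\<close>
  define k where "k = norm v / 4"
  define e where "e = exp (- (norm v)\<^sup>2 / 8)"
  have k: "k > 0" using False by (simp add: k_def)
  \<comment> \<open>By the parallelogram identity the geometric mean of the two Gaussians is a
    Gaussian about the midpoint of their centres, damped by \<open>e\<close>.\<close>
  have sq: "sqrt (gauss_density (z + v)) * sqrt (gauss_density z) = e * gauss_density (z + (1/2) *\<^sub>R v)" for z :: 'e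
  proof -
    have "(norm (z + v))\<^sup>2 / 2 + (norm z)\<^sup>2 / 2 = 2 * ((norm v)\<^sup>2 / 8 + (norm (z + (1/2) *\<^sub>R v))\<^sup>2 / 2)"
      by (simp add: power2_norm_eq_inner inner_add_left inner_add_right inner_commute field_simps)
    then have "exp (- (norm (z + v))\<^sup>2 / 2) * exp (- (norm z)\<^sup>2 / 2) = (e * exp (- (norm (z + (1/2) *\<^sub>R v))\<^sup>2 / 2))\<^sup>2"
      unfolding e_def by (simp add: exp_add[symmetric] power2_eq_square)
    then have "gauss_density (z + v) * gauss_density z = (e * gauss_density (z + (1/2) *\<^sub>R v))\<^sup>2"
      unfolding gauss_density_altdef by (simp add: power_mult_distrib power2_eq_square algebra_simps)
    then show ?thesis
      by (simp add: real_sqrt_mult[symmetric] e_def)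
  qed
  have pw: "\<bar>gauss_density (z + v) - gauss_density z\<bar> \<le>
      (1 / (2 * k) + k / 2) * (gauss_density (z + v) + gauss_density z) + (k - 1 / k) * (e * gauss_density (z + (1/2) *\<^sub>R v))"
    for z :: 'e
  proof -
    define a b where "a = sqrt (gauss_density (z + v))" and "b = sqrt (gauss_density z)"
    have ab: "a \<ge> 0" "b \<ge> 0" "gauss_density (z + v) = a\<^sup>2" "gauss_density z = b\<^sup>2"
      by (simp_all add: a_def b_def)
    have "\<bar>a\<^sup>2 - b\<^sup>2\<bar> = \<bar>a - b\<bar> * (a + b)"
      using ab by (simp add: power2_eq_square square_diff_square_factored abs_mult)
    also have "\<dots> \<le> (a - b)\<^sup>2 / (2 * k) + k / 2 * (a + b)\<^sup>2"
    proof -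
      have "0 \<le> (\<bar>a - b\<bar> - k * (a + b))\<^sup>2 / (2 * k)"
        using k by simp
      also have "\<dots> = (a - b)\<^sup>2 / (2 * k) + k / 2 * (a + b)\<^sup>2 - \<bar>a - b\<bar> * (a + b)"
        using k by (simp add: power2_diff power_mult_distrib field_simps) (simp add: power2_eq_square algebra_simps)
      finally show ?thesis by simp
    qed
    also have "\<dots> = (1 / (2 * k) + k / 2) * (a\<^sup>2 + b\<^sup>2) + (k - 1 / k) * (a * b)"
      using k by (simp add: field_simps power2_eq_square)
    also have "a * b = e * gauss_density (z + (1/2) *\<^sub>R v)"
      by (simp add: a_def b_def sq)
    finally show ?thesis by (simp add: ab)
  qed
  note ints = integrable_gauss_density integrable_gauss_density_shift
  have "(LINT z|lborel. \<bar>gauss_density (z + v) - gauss_density z\<bar>) \<le>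
     (LINT z|lborel. (1 / (2 * k) + k / 2) * (gauss_density (z + v) + gauss_density z) + (k - 1 / k) * (e * gauss_density (z + (1/2) *\<^sub>R v)))"
    by (intro integral_mono pw integrable_abs Bochner_Integration.integrable_diff Bochner_Integration.integrable_add
        integrable_mult_right ints)
  also have "\<dots> = (1 / (2 * k) + k / 2) * 2 + (k - 1 / k) * e"
    by (simp add: ints integral_gauss_density integral_gauss_density_shift)
  also have "\<dots> = (1 - e) / k + k * (1 + e)"
    using k by (simp add: field_simps)
  also have "\<dots> \<le> ((norm v)\<^sup>2 / 8) / k + k * 2"
  proof (intro add_mono divide_right_mono mult_left_mono)
    show "1 - e \<le> (norm v)\<^sup>2 / 8"
      using exp_ge_add_one_self[of "- (norm v)\<^sup>2 / 8"] by (simp add: e_def)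
    show "1 + e \<le> 2" by (simp add: e_def)
  qed (use k in auto)
  also have "\<dots> = norm v"
    using False by (simp add: k_def field_simps power2_eq_square)
  finally show ?thesis .
qed simp

text \<open>Interpolates between the linear bound for short shifts and the trivial bound 2 for long
  ones. The exponent has to be adjustable because \<open>holder_bessel\<close> needs \<theta> <
  2\<alpha>.\<close>

lemma gauss_density_shift_diff_powr:
  fixes v :: "'e::euclidean_space"
  assumes "0 < \<theta>" "\<theta> \<le> 1"
  shows "(LINT z|lborel. \<bar>gauss_density (z + v) - gauss_density z\<bar>) \<le> 2 * norm v powr \<theta>"
proof (cases "norm v \<le> 1")
  case True
  have "norm v \<le> norm v powr \<theta>"
    using powr_mono'[of \<theta> 1 "norm v"] True assms by (cases "v = 0") auto
  then show ?thesis
    using gauss_density_shift_diff[of v] powr_ge_zero[of "norm v" \<theta>] by linarith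
next
  case False
  have "(LINT z|lborel. \<bar>gauss_density (z + v) - gauss_density z\<bar>) \<le> (LINT z|lborel. gauss_density (z + v) + gauss_density z)"
    by (intro integral_mono integrable_abs Bochner_Integration.integrable_diff Bochner_Integration.integrable_add
        integrable_gauss_density integrable_gauss_density_shift)
      (auto simp: abs_le_iff intro: order_trans[OF _ add_increasing] order_trans[OF _ add_increasing2])
  also have "\<dots> = 2"
    by (simp add: integrable_gauss_density integral_gauss_density integral_gauss_density_shift integrable_gauss_density_shift)
  also have "\<dots> \<le> 2 * norm v powr \<theta>"
    using False assms by (simp add: ge_one_powr_ge_zero)
  finally show ?thesis .
qed

text \<open>Half of the Gaussian decay absorbs the power, by 1 + |z|^2 \<le> 4 exp(|z|^2/4). The
  moment of order p = 2\<theta> appears in \<open>remainder_converges\<close>, from a product of two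
  \<theta>-Hoelder increments.\<close>

lemma integrable_gauss_norm_powr:
  assumes "0 \<le> p" "p \<le> 2"
  shows "integrable gauss (\<lambda>z::'e::euclidean_space. norm z powr p)"
proof -
  have bound: "norm z powr p * exp (- (norm z)\<^sup>2 / 2) \<le> 4 * exp (- (norm ((1 / sqrt 2) *\<^sub>R z))\<^sup>2 / 2)" for z :: 'e
  proof -
    have "norm z powr p \<le> 1 + (norm z)\<^sup>2"
    proof (cases "norm z \<le> 1")
      case True
      then have "norm z powr p \<le> 1" using assms by (simp add: powr_le1)
      then show ?thesis by (simp add: add_increasing2)
    next
      case False
      then have "norm z powr p \<le> norm z powr 2" using assms by (intro powr_mono) auto
      then show ?thesis using False by (simp add: add_increasing)
    qed
    also have "\<dots> \<le> 4 * exp ((norm z)\<^sup>2 / 4)"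
      using exp_ge_add_one_self[of "(norm z)\<^sup>2 / 4"] by linarith
    finally have "norm z powr p * exp (- (norm z)\<^sup>2 / 2) \<le> 4 * exp ((norm z)\<^sup>2 / 4) * exp (- (norm z)\<^sup>2 / 2)"
      by (rule mult_right_mono) simp
    also have "\<dots> = 4 * exp (- (norm z)\<^sup>2 / 4)"
      by (simp add: exp_add[symmetric])
    also have "\<dots> = 4 * exp (- (norm ((1 / sqrt 2) *\<^sub>R z))\<^sup>2 / 2)"
      by (simp add: power_divide)
    finally show ?thesis .
  qed
  have "integrable lborel (\<lambda>z::'e. gauss_density ((1 / sqrt 2) *\<^sub>R z))"
    using integrable_gauss_density
    by (subst lborel_affine[of "sqrt 2" 0]) (simp_all add: integrable_density integrable_distr_eq)
  then have "integrable lborel (\<lambda>z::'e. 4 * gauss_density ((1 / sqrt 2) *\<^sub>R z))"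
    by simp
  then have "integrable lborel (\<lambda>z::'e. gauss_density z * norm z powr p)"
  proof (rule Bochner_Integration.integrable_bound)
    show "AE z::'e in lborel. norm (gauss_density z * norm z powr p) \<le> norm (4 * gauss_density ((1 / sqrt 2) *\<^sub>R z))"
    proof (intro AE_I2)
      fix z :: 'e
      have "(1 / sqrt (2 * pi)) ^ DIM('e) * (norm z powr p * exp (- (norm z)\<^sup>2 / 2)) \<le>
         (1 / sqrt (2 * pi)) ^ DIM('e) * (4 * exp (- (norm ((1 / sqrt 2) *\<^sub>R z))\<^sup>2 / 2))"
        by (intro mult_left_mono bound) simp
      then show "norm (gauss_density z * norm z powr p) \<le> norm (4 * gauss_density ((1 / sqrt 2) *\<^sub>R z))"
        unfolding gauss_density_altdef by (simp add: abs_mult algebra_simps)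
    qed
  qed measurable
  then show ?thesis
    by (subst integrable_gauss) auto
qed

section \<open>Subordination: mixtures of heat kernels over a measure of times\<close>

definition subord :: "real measure \<Rightarrow> 'e::euclidean_space measure" where
  "subord N = distr (N \<Otimes>\<^sub>M gauss) borel (\<lambda>(s, z). sqrt (2 * s) *\<^sub>R z)"

lemma sets_subord [measurable_cong, simp]: "sets (subord N) = sets borel"
  and space_subord [simp]: "space (subord N) = UNIV"
  by (simp_all add: subord_def)

context
  fixes N :: "real measure"
  assumes fin: "finite_measure N" and sets_N [measurable_cong]: "sets N = sets borel"
begin

interpretation finite_measure N by (rule fin)

lemma finite_measure_pair_gauss: "finite_measure (N \<Otimes>\<^sub>M (gauss :: 'e::euclidean_space measure))"
  by (rule finite_measure_pair_measure) (rule fin gauss.finite_measure_axioms)+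

lemma finite_measure_subord: "finite_measure (subord N :: 'e::euclidean_space measure)"
  unfolding subord_def by (rule finite_measure.finite_measure_distr[OF finite_measure_pair_gauss]) measurable

lemma integral_subord:
  fixes f :: "'e::euclidean_space \<Rightarrow> complex"
  assumes [measurable]: "f \<in> borel_measurable borel" and bdd: "\<And>x. norm (f x) \<le> B"
  shows "(LINT x|subord N. f x) = (LINT s|N. LINT z|gauss. f (sqrt (2 * s) *\<^sub>R z))"
    and "integrable N (\<lambda>s. LINT z|gauss. f (sqrt (2 * s) *\<^sub>R z))"
proof -
  interpret P: pair_sigma_finite N "gauss :: 'e measure" ..
  have i: "integrable (N \<Otimes>\<^sub>M gauss) (\<lambda>(s, z). f (sqrt (2 * s) *\<^sub>R z))"
    by (rule finite_measure.integrable_const_bound[OF finite_measure_pair_gauss, where B=B])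
      (auto simp: bdd)
  have "(LINT x|subord N. f x) = (LINT p|(N \<Otimes>\<^sub>M gauss). (case p of (s, z) \<Rightarrow> f (sqrt (2 * s) *\<^sub>R z)))"
    unfolding subord_def by (subst integral_distr) (auto simp: case_prod_unfold)
  also have "\<dots> = (LINT s|N. LINT z|gauss. f (sqrt (2 * s) *\<^sub>R z))"
    using P.integral_fst[OF i] by simp
  finally show "(LINT x|subord N. f x) = (LINT s|N. LINT z|gauss. f (sqrt (2 * s) *\<^sub>R z))" .
  show "integrable N (\<lambda>s. LINT z|gauss. f (sqrt (2 * s) *\<^sub>R z))"
    using P.integrable_fst[OF i] by simp
qed

text \<open>The scale \<open>sqrt (2 * s)\<close> gives a Gaussian whose transform is exp(-s |w|^2),
  so identities between subordinated measures reduce to Laplace transforms of \<open>N\<close>. For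
  negative \<open>s\<close> the total function \<open>sqrt\<close> would give the exponent -|s|
  |w|^2 instead, hence the assumption on \<open>N\<close>.\<close>

lemma fourier_subord:
  fixes w :: "'e::euclidean_space"
  assumes "AE s in N. s \<ge> 0"
  shows "(LINT x|subord N. iexp (w \<bullet> x)) = of_real (LINT s|N. exp (- s * (norm w)\<^sup>2))"
proof -
  have "(LINT x|subord N. iexp (w \<bullet> x)) = (LINT s|N. LINT z|gauss. iexp (w \<bullet> (sqrt (2 * s) *\<^sub>R z)))"
    by (rule integral_subord[where B=1]) auto
  also have "\<dots> = (LINT s|N. of_real (exp (- s * (norm w)\<^sup>2)))"
  proof (rule integral_cong_AE)
    show "AE s in N. (LINT z|gauss. iexp (w \<bullet> (sqrt (2 * s) *\<^sub>R z))) = of_real (exp (- s * (norm w)\<^sup>2))"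
      using assms
    proof eventually_elim
      case (elim s)
      have "(LINT z|gauss. iexp (w \<bullet> (sqrt (2 * s) *\<^sub>R z))) = (LINT z|gauss. iexp ((sqrt (2 * s) *\<^sub>R w) \<bullet> z))"
        by simp
      also have "\<dots> = of_real (exp (- (norm (sqrt (2 * s) *\<^sub>R w))\<^sup>2 / 2))"
        by (rule gauss_fourier)
      also have "- (norm (sqrt (2 * s) *\<^sub>R w))\<^sup>2 / 2 = - s * (norm w)\<^sup>2"
        using elim by (simp add: power_mult_distrib)
      finally show ?case .
    qed
  qed measurable
  finally show ?thesis by simp
qed

end

section \<open>Kernels of fractional powers on the half line\<close>

lemma has_bochner_integral_real_scale_shift:
  fixes f :: "real \<Rightarrow> real"
  assumes "has_bochner_integral lborel f x" "c > 0"
  shows "has_bochner_integral lborel (\<lambda>s. f (t + c * s)) (x / c)"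
  using lborel_has_bochner_integral_real_affine_iff[of c f x t] assms by (simp add: divideR_right divide_inverse_commute)

lemma has_bochner_integral_Gamma:
  fixes a c :: real
  assumes "a > 0" "c > 0"
  shows "has_bochner_integral lborel (\<lambda>s. indicator {0..} s * s powr (a - 1) * exp (- (c * s))) (Gamma a * c powr (- a))"
proof -
  have "has_bochner_integral lborel (\<lambda>s. indicator {0..} s * s powr (a - 1) * exp (- s)) (Gamma a)"
  proof (rule has_bochner_integral_nn_integral)
    show "(\<integral>\<^sup>+s. ennreal (indicator {0..} s * s powr (a - 1) * exp (- s)) \<partial>lborel) = ennreal (Gamma a)"
      using assms by (subst Gamma_conv_nn_integral_real) (auto simp: exp_minus divide_inverse)
  qed (use assms in \<open>auto simp: less_imp_le\<close>)
  from has_bochner_integral_real_scale_shift[OF this assms(2), of 0]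
  have "has_bochner_integral lborel (\<lambda>s. indicator {0..} (c * s) * (c * s) powr (a - 1) * exp (- (c * s))) (Gamma a / c)"
    by simp
  then have "has_bochner_integral lborel (\<lambda>s. c powr (1 - a) * (indicator {0..} (c * s) * (c * s) powr (a - 1) * exp (- (c * s)))) (c powr (1 - a) * (Gamma a / c))"
    by (rule has_bochner_integral_mult_right)
  moreover have "c powr (1 - a) * (indicator {0..} (c * s) * (c * s) powr (a - 1) * exp (- (c * s))) =
      indicator {0..} s * s powr (a - 1) * exp (- (c * s))" for s
  proof (cases "s \<ge> 0")
    case True
    then have "c powr (1 - a) * (c * s) powr (a - 1) = s powr (a - 1)"
      using assms by (simp add: powr_mult powr_diff)
    then show ?thesis using True assms by (simp add: mult.assoc[symmetric])
  next
    case False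
    then show ?thesis using assms by (simp add: zero_le_mult_iff indicator_def)
  qed
  moreover have "c powr (1 - a) * (Gamma a / c) = Gamma a * c powr (- a)"
    using assms by (simp add: powr_diff powr_minus divide_inverse)
  ultimately show ?thesis by simp
qed

text \<open>This value is the coefficient of the identity in the operator \<open>L\<close>: the
  total weight of the truncated Balakrishnan integral.\<close>

lemma has_bochner_integral_powr_tail:
  fixes a \<epsilon> :: real
  assumes "a > 0" "\<epsilon> > 0"
  shows "has_bochner_integral lborel (\<lambda>s. indicator {\<epsilon>..} s * s powr (- 1 - a)) (\<epsilon> powr (- a) / a)"
proof (rule has_bochner_integral_nn_integral)
  have "((\<lambda>x. x powr (- 1 - a)) has_integral - (\<epsilon> powr (- 1 - a + 1)) / (- 1 - a + 1)) {\<epsilon>..}"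
    using assms by (intro has_integral_powr_to_inf) auto
  then show "(\<integral>\<^sup>+s. ennreal (indicator {\<epsilon>..} s * s powr (- 1 - a)) \<partial>lborel) = ennreal (\<epsilon> powr (- a) / a)"
    by (subst nn_integral_has_integral_lebesgue) auto
qed (use assms in auto)

text \<open>Up to a constant, the averaging kernel that arises when a truncated Marchaud derivative
  is applied to a fractional integral of order \<open>a\<close>; \<open>q\<close> is time measured
  in units of the truncation. Since \<open>0 powr a = 0\<close>, the \<open>max\<close> stands for
  the positive part of q - 1.\<close>

definition frac_kernel :: "real \<Rightarrow> real \<Rightarrow> real" where
  "frac_kernel a q = indicator {0..} q * ((q powr a - (max 0 (q - 1)) powr a) / q)"

lemma frac_kernel_measurable [measurable]: "frac_kernel a \<in> borel_measurable borel"
  unfolding frac_kernel_def[abs_def] by measurable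

lemma frac_kernel_nonneg: "a > 0 \<Longrightarrow> frac_kernel a q \<ge> 0"
  unfolding frac_kernel_def by (auto simp: indicator_def intro!: divide_nonneg_nonneg powr_mono2)

text \<open>The subtracted function is the first one delayed by one unit of time, and the delay
  multiplies the Laplace transform by exp(-p).\<close>

lemma has_bochner_integral_power_diff:
  fixes a p :: real
  assumes "a > 0" "p > 0"
  shows "has_bochner_integral lborel (\<lambda>q. indicator {0..} q * (q powr a - (max 0 (q - 1)) powr a) * exp (- (p * q)))
    (Gamma (1 + a) * p powr (- 1 - a) * (1 - exp (- p)))"
proof -
  let ?f = "\<lambda>q. indicator {0..} q * q powr a * exp (- (p * q))"
  have 1: "has_bochner_integral lborel ?f (Gamma (1 + a) * p powr (- 1 - a))"
    using has_bochner_integral_Gamma[of "1 + a" p] assms by simp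
  have "has_bochner_integral lborel (\<lambda>q. exp (- p) * ?f (- 1 + 1 * q)) (exp (- p) * (Gamma (1 + a) * p powr (- 1 - a) / 1))"
    by (intro has_bochner_integral_mult_right has_bochner_integral_real_scale_shift 1) simp
  from has_bochner_integral_diff[OF 1 this]
  have "has_bochner_integral lborel (\<lambda>q. ?f q - exp (- p) * ?f (- 1 + 1 * q)) (Gamma (1 + a) * p powr (- 1 - a) * (1 - exp (- p)))"
    by (simp add: algebra_simps)
  moreover have "?f q - exp (- p) * ?f (- 1 + 1 * q) = indicator {0..} q * (q powr a - (max 0 (q - 1)) powr a) * exp (- (p * q))" for q
  proof -
    have "exp (- p) * exp (- (p * (- 1 + 1 * q))) = exp (- (p * q))"
      by (simp add: exp_add[symmetric] algebra_simps)
    then have "exp (- p) * ?f (- 1 + 1 * q) = indicator {0..} (- 1 + 1 * q) * (- 1 + 1 * q) powr a * exp (- (p * q))"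
      by (metis mult.assoc mult.left_commute)
    then show ?thesis
      by (auto simp: indicator_def max_def algebra_simps)
  qed
  ultimately show ?thesis by simp
qed

text \<open>\<open>exp (- (\<epsilon> * c * q)) / q = c * \<integral>s\<ge>\<epsilon>. exp (- (c * s * q))\<close>, and the integrals are exchanged.\<close>

lemma nn_integral_frac_kernel:
  assumes "a > 0" "\<epsilon> \<ge> 0" "c > 0"
  shows "(\<integral>\<^sup>+q. ennreal (frac_kernel a q * exp (- (\<epsilon> * c * q))) \<partial>lborel) =
    (\<integral>\<^sup>+s. ennreal (Gamma (1 + a) * c powr (- a) * (indicator {\<epsilon>..} s * s powr (- 1 - a) * (1 - exp (- (c * s))))) \<partial>lborel)"
proof -
  let ?D = "\<lambda>q. indicator {0..} q * (q powr a - (max 0 (q - 1)) powr a)"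
  have D: "?D q \<ge> 0" for q
    using \<open>a > 0\<close> by (auto simp: indicator_def intro!: powr_mono2)
  have inner: "ennreal (frac_kernel a q * exp (- (\<epsilon> * c * q))) =
      (\<integral>\<^sup>+s. ennreal (c * (?D q * exp (- (c * s * q)))) * indicator {\<epsilon>..} s \<partial>lborel)" if "q \<noteq> 0" for q
  proof (cases "q > 0")
    case True
    have "(\<integral>\<^sup>+s. ennreal (c * ?D q * exp (- (c * s * q))) * indicator {\<epsilon>..} s \<partial>lborel) =
      ennreal (0 - (- (?D q / q * exp (- (c * \<epsilon> * q)))))"
    proof (rule nn_integral_FTC_atLeast)
      show "((\<lambda>s. - (?D q / q * exp (- (c * s * q)))) has_real_derivative c * ?D q * exp (- (c * s * q))) (at s)" for s
        using True by (auto intro!: derivative_eq_intros)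
      have "((\<lambda>s. exp (- (c * s * q))) \<longlongrightarrow> 0) at_top"
        using True \<open>c > 0\<close> by real_asymp
      from tendsto_minus[OF tendsto_mult_left[OF this, of "?D q / q"]]
      show "((\<lambda>s. - (?D q / q * exp (- (c * s * q)))) \<longlongrightarrow> 0) at_top"
        by simp
      show "0 \<le> c * ?D q * exp (- (c * s * q))" for s
        using D[of q] \<open>c > 0\<close> by simp
    qed measurable
    then show ?thesis using True by (simp add: frac_kernel_def ac_simps)
  next
    case False
    then show ?thesis using that by (simp add: frac_kernel_def)
  qed
  have "(\<integral>\<^sup>+q. ennreal (frac_kernel a q * exp (- (\<epsilon> * c * q))) \<partial>lborel) =
     (\<integral>\<^sup>+q. \<integral>\<^sup>+s. ennreal (c * (?D q * exp (- (c * s * q)))) * indicator {\<epsilon>..} s \<partial>lborel \<partial>lborel)"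
    using AE_lborel_singleton[of "0::real"] by (intro nn_integral_cong_AE) (auto simp: inner)
  also have "\<dots> = (\<integral>\<^sup>+s. \<integral>\<^sup>+q. ennreal (c * (?D q * exp (- (c * s * q)))) * indicator {\<epsilon>..} s \<partial>lborel \<partial>lborel)"
    by (rule lborel_pair.Fubini') measurable
  also have "\<dots> = (\<integral>\<^sup>+s. ennreal (Gamma (1 + a) * c powr (- a) * (indicator {\<epsilon>..} s * s powr (- 1 - a) * (1 - exp (- (c * s))))) \<partial>lborel)"
  proof (rule nn_integral_cong_AE)
    show "AE s in lborel. (\<integral>\<^sup>+q. ennreal (c * (?D q * exp (- (c * s * q)))) * indicator {\<epsilon>..} s \<partial>lborel) =
      ennreal (Gamma (1 + a) * c powr (- a) * (indicator {\<epsilon>..} s * s powr (- 1 - a) * (1 - exp (- (c * s)))))"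
      using AE_lborel_singleton[of "0::real"]
    proof eventually_elim
      case (elim s)
      show ?case
      proof (cases "s \<ge> \<epsilon>")
        case True
        then have s: "s > 0" using elim \<open>\<epsilon> \<ge> 0\<close> by simp
        have h: "has_bochner_integral lborel (\<lambda>q. c * (?D q * exp (- (c * s * q)))) (c * (Gamma (1 + a) * (c * s) powr (- 1 - a) * (1 - exp (- (c * s)))))"
          using s \<open>c > 0\<close> \<open>a > 0\<close> by (intro has_bochner_integral_mult_right has_bochner_integral_power_diff) auto
        have nn: "AE q in lborel. 0 \<le> c * (?D q * exp (- (c * s * q)))"
          using \<open>c > 0\<close> by (intro AE_I2 mult_nonneg_nonneg[OF _ mult_nonneg_nonneg[OF D]]) auto
        have "(\<integral>\<^sup>+q. ennreal (c * (?D q * exp (- (c * s * q)))) \<partial>lborel) =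
           ennreal (c * (Gamma (1 + a) * (c * s) powr (- 1 - a) * (1 - exp (- (c * s)))))"
          by (simp only: nn_integral_eq_integral[OF integrable.intros[OF h] nn] has_bochner_integral_integral_eq[OF h])
        also have "c * (Gamma (1 + a) * (c * s) powr (- 1 - a) * (1 - exp (- (c * s)))) =
           Gamma (1 + a) * c powr (- a) * (s powr (- 1 - a) * (1 - exp (- (c * s))))"
          using s \<open>c > 0\<close> by (simp add: powr_mult powr_diff powr_minus field_simps)
        finally show ?thesis using True by simp
      qed simp
    qed
  qed
  finally show ?thesis .
qed

text \<open>Near 0 the factor 1 - exp(-s) \<le> s leaves s^(-a), integrable as a < 1; at infinity
  s^(-1-a) suffices. Near 0 the majorant is a Gamma integrand times \<open>exp 1\<close>, because
  exp(1 - s) \<ge> 1 for s < 1.\<close>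

lemma integrable_powr_one_minus_exp:
  fixes a :: real
  assumes "0 < a" "a < 1"
  shows "integrable lborel (\<lambda>s. indicator {0..} s * s powr (- 1 - a) * (1 - exp (- s)))"
proof -
  have i1: "integrable lborel (\<lambda>s. indicator {1..} s * s powr (- 1 - a))"
    using has_bochner_integral_powr_tail[of a 1] assms by (auto simp: has_bochner_integral_iff)
  have i2: "integrable lborel (\<lambda>s. exp 1 * (indicator {0..} s * s powr ((1 - a) - 1) * exp (- (1 * s))))"
    using has_bochner_integral_Gamma[of "1 - a" 1] assms by (auto simp: has_bochner_integral_iff)
  show ?thesis
  proof (rule Bochner_Integration.integrable_bound[OF Bochner_Integration.integrable_add[OF i1 i2]])
    show "AE s in lborel. norm (indicator {0..} s * s powr (- 1 - a) * (1 - exp (- s))) \<le>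
       norm (indicator {1..} s * s powr (- 1 - a) + exp 1 * (indicator {0..} s * s powr ((1 - a) - 1) * exp (- (1 * s))))"
    proof (intro AE_I2)
      fix s :: real
      consider "s < 0" | "s = 0" | "s \<ge> 1" | "0 < s" "s < 1" by linarith
      then show "norm (indicator {0..} s * s powr (- 1 - a) * (1 - exp (- s))) \<le>
       norm (indicator {1..} s * s powr (- 1 - a) + exp 1 * (indicator {0..} s * s powr ((1 - a) - 1) * exp (- (1 * s))))"
      proof cases
        case 3
        have "s powr (- 1 - a) * (1 - exp (- s)) \<le> s powr (- 1 - a) * 1"
          by (intro mult_left_mono) auto
        moreover have "0 \<le> s powr (- 1 - a) * (1 - exp (- s))" "0 \<le> s powr - a * exp (- s)"
          using 3 by auto
        ultimately show ?thesis using 3 by (simp add: abs_mult add_increasing2)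
      next
        case 4
        have "s powr (- 1 - a) * (1 - exp (- s)) \<le> s powr (- 1 - a) * s"
          using exp_ge_add_one_self[of "- s"] by (intro mult_left_mono) auto
        also have "\<dots> = s powr (- a)"
          using 4 by (simp add: powr_diff powr_minus field_simps)
        also have "\<dots> \<le> exp (1 - s) * s powr (- a)"
          using 4 mult_right_mono[of 1 "exp (1 - s)" "s powr (- a)"] by simp
        finally show ?thesis using 4 by (simp add: abs_mult exp_diff exp_minus field_simps)
      qed auto
    qed
  qed measurable
qed

text \<open>The case \<epsilon> = 0, c = 1 of \<open>nn_integral_frac_kernel\<close>, which holds in
  the extended reals and so transfers finiteness from the preceding integrand.\<close>

lemma integrable_frac_kernel:
  assumes "0 < a" "a < 1"
  shows "integrable lborel (frac_kernel a)"
proof -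
  have "integrable lborel (\<lambda>s. Gamma (1 + a) * 1 powr (- a) * (indicator {0..} s * s powr (- 1 - a) * (1 - exp (- (1 * s)))))"
    using integrable_powr_one_minus_exp[OF assms] by simp
  then have "(\<integral>\<^sup>+s. ennreal (Gamma (1 + a) * 1 powr (- a) * (indicator {0..} s * s powr (- 1 - a) * (1 - exp (- (1 * s))))) \<partial>lborel) < \<infinity>"
    using assms by (subst nn_integral_eq_integral) (auto simp: indicator_def)
  then have "(\<integral>\<^sup>+q. ennreal (frac_kernel a q) \<partial>lborel) < \<infinity>"
    using nn_integral_frac_kernel[of a 0 1] assms by simp
  then show ?thesis
    using frac_kernel_nonneg[OF \<open>0 < a\<close>] by (intro integrableI_nonneg) auto
qed

text \<open>The kernel is strictly positive for q > 0. Positivity of the mass is all that is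
  required, since it only serves as a divisor.\<close>

lemma integral_frac_kernel_pos:
  assumes "0 < a" "a < 1"
  shows "(LINT q|lborel. frac_kernel a q) > 0"
proof -
  have nz: "frac_kernel a q \<noteq> 0" if "q > 0" for q
  proof -
    have "max 0 (q - 1) powr a < q powr a"
      using that assms by (intro powr_less_mono2) auto
    then show ?thesis using that by (simp add: frac_kernel_def)
  qed
  have "(LINT q|lborel. frac_kernel a q) \<noteq> 0"
  proof
    assume "(LINT q|lborel. frac_kernel a q) = 0"
    then have "AE q in lborel. frac_kernel a q = 0"
      using integral_nonneg_eq_0_iff_AE[OF integrable_frac_kernel[OF assms]] frac_kernel_nonneg[OF assms(1)] by simp
    then have "AE q in lborel. q \<notin> {0<..<1::real}"
      by eventually_elim (use nz in auto)
    then have "{0<..<1::real} \<in> null_sets lborel"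
      by (subst AE_iff_null_sets) auto
    then show False by (simp add: null_sets_def)
  qed
  then show ?thesis
    using frac_kernel_nonneg[OF assms(1)] by (simp add: order_less_le)
qed

text \<open>For \<epsilon> > 0 the integral of s^(-1-a) (1 - exp(-c s)) may be split into two finite
  pieces. With c = 1 + |w|^2 they become the two terms in the symbol of \<open>L\<close>.\<close>

lemma integral_frac_kernel_exp:
  assumes "0 < a" "a < 1" "\<epsilon> > 0" "c > 0"
  shows "(LINT q|lborel. frac_kernel a q * exp (- (\<epsilon> * c * q))) =
    Gamma (1 + a) * c powr (- a) * (\<epsilon> powr (- a) / a - (LINT s|lborel. indicator {\<epsilon>..} s * s powr (- 1 - a) * exp (- (c * s))))"
proof -
  note tail = has_bochner_integral_powr_tail[OF assms(1,3)]
  have i2: "integrable lborel (\<lambda>s. indicator {\<epsilon>..} s * s powr (- 1 - a) * exp (- (c * s)))"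
    by (rule Bochner_Integration.integrable_bound[OF integrable.intros[OF tail]])
      (use assms in \<open>auto intro!: AE_I2 mult_left_le simp: indicator_def\<close>)
  have "(LINT q|lborel. frac_kernel a q * exp (- (\<epsilon> * c * q))) =
     enn2real (\<integral>\<^sup>+q. ennreal (frac_kernel a q * exp (- (\<epsilon> * c * q))) \<partial>lborel)"
    using frac_kernel_nonneg[OF assms(1)] by (intro integral_eq_nn_integral) auto
  also have "\<dots> = (LINT s|lborel. Gamma (1 + a) * c powr (- a) * (indicator {\<epsilon>..} s * s powr (- 1 - a) * (1 - exp (- (c * s)))))"
    using assms by (subst nn_integral_frac_kernel, simp, simp, simp)
      (rule integral_eq_nn_integral[symmetric], auto simp: indicator_def)
  also have "\<dots> = Gamma (1 + a) * c powr (- a) * (LINT s|lborel. indicator {\<epsilon>..} s * s powr (- 1 - a) - indicator {\<epsilon>..} s * s powr (- 1 - a) * exp (- (c * s)))"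
    by (simp only: integral_mult_right_zero) (simp only: right_diff_distrib mult_1_right)
  also have "(LINT s|lborel. indicator {\<epsilon>..} s * s powr (- 1 - a) - indicator {\<epsilon>..} s * s powr (- 1 - a) * exp (- (c * s))) =
    (\<epsilon> powr (- a) / a - (LINT s|lborel. indicator {\<epsilon>..} s * s powr (- 1 - a) * exp (- (c * s))))"
    using tail i2 by (simp add: has_bochner_integral_iff)
  finally show ?thesis .
qed

section \<open>Measures of times on the half line and their Laplace transforms\<close>

definition borel_finite :: "'e::topological_space measure \<Rightarrow> bool" where
  "borel_finite \<mu> \<longleftrightarrow> finite_measure \<mu> \<and> sets \<mu> = sets borel"

lemma borel_finiteD:
  assumes "borel_finite \<mu>"
  shows "finite_measure \<mu>" "sets \<mu> = sets borel" "space \<mu> = UNIV"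
  using assms sets_eq_imp_space_eq[of \<mu> borel] by (auto simp: borel_finite_def)

lemma borel_finite_density:
  fixes f :: "real \<Rightarrow> real"
  assumes "integrable lborel f" "\<And>x. f x \<ge> 0"
  shows "borel_finite (density lborel (\<lambda>x. ennreal (f x)))"
proof -
  have "emeasure (density lborel (\<lambda>x. ennreal (f x))) UNIV = (\<integral>\<^sup>+x. ennreal (f x) \<partial>lborel)"
    using assms(1) by (subst emeasure_density) auto
  also have "\<dots> < \<infinity>"
    using assms by (subst nn_integral_eq_integral) auto
  finally show ?thesis
    by (auto simp: borel_finite_def intro!: finite_measureI)
qed

lemma integral_density_real:
  fixes f :: "real \<Rightarrow> real" and g :: "real \<Rightarrow> 'b::{banach, second_countable_topology}"
  assumes "integrable lborel f" "\<And>x. f x \<ge> 0" "g \<in> borel_measurable borel"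
  shows "(LINT x|density lborel (\<lambda>x. ennreal (f x)). g x) = (LINT x|lborel. f x *\<^sub>R g x)"
  using assms by (subst integral_density) auto

lemma borel_finite_subord:
  assumes "borel_finite N"
  shows "borel_finite (subord N)"
  using finite_measure_subord[of N] borel_finiteD[OF assms] by (simp add: borel_finite_def)

definition gamma_measure :: "real \<Rightarrow> real measure" where
  "gamma_measure a = density lborel (\<lambda>s. ennreal (indicator {0..} s * s powr (a - 1) * exp (- s) / Gamma a))"

text \<open>The Balakrishnan weight s^(-1-a) cut off below \<epsilon>; the factor exp(-s) replaces
  the heat semigroup of \<Delta> by that of \<Delta> - 1.\<close>

definition tail_measure :: "real \<Rightarrow> real \<Rightarrow> real measure" where
  "tail_measure a \<epsilon> = density lborel (\<lambda>s. ennreal (indicator {\<epsilon>..} s * s powr (- 1 - a) * exp (- s)))"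

text \<open>The law of \<open>J\<^sub>a L\<^sub>\<epsilon>\<close>, up to subordination; it is positive because \<^term>\<open>frac_kernel a\<close> is.\<close>

definition approx_measure :: "real \<Rightarrow> real \<Rightarrow> real measure" where
  "approx_measure a \<epsilon> = distr (density lborel (\<lambda>q. ennreal (frac_kernel a q * exp (- (\<epsilon> * q)) / Gamma (1 + a)))) borel (\<lambda>q. \<epsilon> * q)"

context
  fixes a :: real
  assumes a: "a > 0"
begin

lemma gamma_density_integrable:
  "integrable lborel (\<lambda>s. indicator {0..} s * s powr (a - 1) * exp (- s) / Gamma a)"
  using has_bochner_integral_Gamma[of a 1] a by (auto simp: has_bochner_integral_iff)

lemma gamma_density_nonneg: "indicator {0..} s * s powr (a - 1) * exp (- s) / Gamma a \<ge> 0" for s :: real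
  using a Gamma_real_pos[of a] by simp

lemma borel_finite_gamma: "borel_finite (gamma_measure a)"
  unfolding gamma_measure_def using gamma_density_integrable gamma_density_nonneg by (rule borel_finite_density)

lemma AE_gamma: "AE s in gamma_measure a. s > 0"
proof -
  have "AE s in lborel. 0 < ennreal (indicator {0..} s * s powr (a - 1) * exp (- s) / Gamma a) \<longrightarrow> s > 0"
    by (intro AE_I2) (auto simp: indicator_def less_le split: if_splits)
  then show ?thesis
    unfolding gamma_measure_def by (subst AE_density) auto
qed

lemma laplace_gamma:
  assumes "x \<ge> 0"
  shows "(LINT s|gamma_measure a. exp (- s * x)) = (1 + x) powr (- a)"
proof -
  have "(LINT s|gamma_measure a. exp (- s * x)) =
     (LINT s|lborel. (1 / Gamma a) * (indicator {0..} s * s powr (a - 1) * exp (- ((1 + x) * s))))"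
    unfolding gamma_measure_def
    by (subst integral_density_real[OF gamma_density_integrable gamma_density_nonneg])
      (auto intro!: Bochner_Integration.integral_cong simp: algebra_simps exp_add[symmetric])
  also have "\<dots> = (1 + x) powr (- a)"
    using has_bochner_integral_integral_eq[OF has_bochner_integral_Gamma[of a "1 + x"]] a assms
      Gamma_real_pos[OF a, THEN less_imp_neq, THEN not_sym]
    by (simp only: integral_mult_right_zero) simp
  finally show ?thesis .
qed

lemma tail_density_integrable:
  assumes "\<epsilon> > 0"
  shows "integrable lborel (\<lambda>s. indicator {\<epsilon>..} s * s powr (- 1 - a) * exp (- s))"
  by (rule Bochner_Integration.integrable_bound[OF integrable.intros[OF has_bochner_integral_powr_tail[OF a assms]]])
    (use assms in \<open>auto intro!: AE_I2 mult_left_le simp: indicator_def\<close>)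

lemma borel_finite_tail: "\<epsilon> > 0 \<Longrightarrow> borel_finite (tail_measure a \<epsilon>)"
  unfolding tail_measure_def by (rule borel_finite_density[OF tail_density_integrable]) auto

lemma AE_tail:
  assumes "\<epsilon> > 0"
  shows "AE s in tail_measure a \<epsilon>. s \<ge> 0"
proof -
  have "AE s in lborel. 0 < ennreal (indicator {\<epsilon>..} s * s powr (- 1 - a) * exp (- s)) \<longrightarrow> s \<ge> 0"
    using assms by (intro AE_I2) (auto simp: indicator_def split: if_splits)
  then show ?thesis
    unfolding tail_measure_def by (subst AE_density) auto
qed

lemma laplace_tail:
  assumes "\<epsilon> > 0"
  shows "(LINT s|tail_measure a \<epsilon>. exp (- s * x)) = (LINT s|lborel. indicator {\<epsilon>..} s * s powr (- 1 - a) * exp (- ((1 + x) * s)))"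
  unfolding tail_measure_def
  by (subst integral_density_real[OF tail_density_integrable[OF assms]])
    (auto intro!: Bochner_Integration.integral_cong simp: algebra_simps exp_add[symmetric])

context
  assumes a1: "a < 1"
begin

lemma approx_density_integrable:
  assumes "\<epsilon> > 0"
  shows "integrable lborel (\<lambda>q. frac_kernel a q * exp (- (\<epsilon> * q)) / Gamma (1 + a))"
  using a Gamma_real_pos[of "1 + a"]
  by (intro Bochner_Integration.integrable_bound[OF integrable_divide[OF integrable_frac_kernel[OF a a1], of "Gamma (1 + a)"]])
    (use assms frac_kernel_nonneg[OF a] in \<open>auto intro!: AE_I2 divide_right_mono mult_left_le simp: abs_mult frac_kernel_def indicator_def\<close>)

lemma approx_density_nonneg: "frac_kernel a q * exp (- (\<epsilon> * q)) / Gamma (1 + a) \<ge> 0"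
  using frac_kernel_nonneg[OF a] Gamma_real_pos[of "1 + a"] a by simp

lemma borel_finite_approx:
  assumes "\<epsilon> > 0"
  shows "borel_finite (approx_measure a \<epsilon>)"
  using borel_finite_density[OF approx_density_integrable[OF assms] approx_density_nonneg]
  unfolding approx_measure_def borel_finite_def by (auto intro!: finite_measure.finite_measure_distr)

lemma integral_approx:
  fixes g :: "real \<Rightarrow> 'b::{banach, second_countable_topology}"
  assumes "\<epsilon> > 0" and [measurable]: "g \<in> borel_measurable borel"
  shows "(LINT s|approx_measure a \<epsilon>. g s) = (LINT q|lborel. (frac_kernel a q * exp (- (\<epsilon> * q)) / Gamma (1 + a)) *\<^sub>R g (\<epsilon> * q))"
  unfolding approx_measure_def
  by (subst integral_distr; simp?; subst integral_density_real[OF approx_density_integrable[OF assms(1)] approx_density_nonneg]; simp)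

lemma AE_approx:
  assumes "\<epsilon> > 0"
  shows "AE s in approx_measure a \<epsilon>. s \<ge> 0"
proof -
  have "AE q in lborel. 0 < ennreal (frac_kernel a q * exp (- (\<epsilon> * q)) / Gamma (1 + a)) \<longrightarrow> \<epsilon> * q \<ge> 0"
    using assms by (intro AE_I2) (auto simp: frac_kernel_def indicator_def split: if_splits)
  then show ?thesis
    unfolding approx_measure_def by (subst AE_distr_iff; (subst AE_density)?; simp)
qed

text \<open>With x = |w|^2 the right-hand side is the product of (1 + x)^(-a), the symbol of
  \<open>J\<close>, and \<epsilon>^(-a)/a minus the tail transform, the symbol of \<open>L\<close>.
  It is the source of \<open>L_J\<close> and \<open>J_L\<close>.\<close>

lemma laplace_approx:
  assumes "\<epsilon> > 0" "x \<ge> 0"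
  shows "(LINT s|approx_measure a \<epsilon>. exp (- s * x)) =
    (1 + x) powr (- a) * (\<epsilon> powr (- a) / a) - (1 + x) powr (- a) * (LINT s|tail_measure a \<epsilon>. exp (- s * x))"
proof -
  have G: "Gamma (1 + a) > 0" using a Gamma_real_pos[of "1 + a"] by simp
  have "(LINT s|approx_measure a \<epsilon>. exp (- s * x)) = (LINT q|lborel. (1 / Gamma (1 + a)) * (frac_kernel a q * exp (- (\<epsilon> * (1 + x) * q))))"
    by (subst integral_approx[OF assms(1)])
      (auto intro!: Bochner_Integration.integral_cong simp: algebra_simps exp_add[symmetric])
  also have "\<dots> = (1 + x) powr (- a) * (\<epsilon> powr (- a) / a - (LINT s|lborel. indicator {\<epsilon>..} s * s powr (- 1 - a) * exp (- ((1 + x) * s))))"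
    using integral_frac_kernel_exp[OF a a1 assms(1), of "1 + x"] G assms(2) by (simp only: integral_mult_right_zero) simp
  finally show ?thesis
    unfolding laplace_tail[OF assms(1)] by (simp add: right_diff_distrib)
qed

text \<open>The mass that survives as \<epsilon> tends to 0. The truncated inverse is left
  unnormalised, so \<open>R\<close> tends weakly to this multiple of the identity, and later limits
  are divided by it under the name \<open>k\<close>.\<close>

definition approx_const :: real where
  "approx_const = (LINT q|lborel. frac_kernel a q) / Gamma (1 + a)"

lemma approx_const_pos: "approx_const > 0"
  unfolding approx_const_def using integral_frac_kernel_pos[OF a a1] Gamma_real_pos[of "1 + a"] a by simp

text \<open>In the variable q the densities have the common integrable majorant given by
  \<open>frac_kernel\<close>, while the times \<epsilon> q shrink to 0; dominated convergence is
  applied first to the Gaussian average, then to the integral over q.\<close>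

lemma approx_measure_limit:
  fixes h :: "'e::euclidean_space \<Rightarrow> complex"
  assumes cont: "continuous_on UNIV h" and bdd: "\<And>x. norm (h x) \<le> B"
    and \<epsilon>: "\<And>n. \<epsilon> n > 0" "\<epsilon> \<longlonglongrightarrow> 0"
  shows "(\<lambda>n. LINT x|subord (approx_measure a (\<epsilon> n)). h x) \<longlonglongrightarrow> of_real approx_const * h 0"
proof -
  have [measurable]: "h \<in> borel_measurable borel"
    using cont by (rule borel_measurable_continuous_onI)
  have G: "Gamma (1 + a) > 0"
    using a by (intro Gamma_real_pos) simp
  have B: "B \<ge> 0" using order_trans[OF norm_ge_zero bdd[of 0]] .
  define H where "H s = (LINT z|gauss. h (sqrt (2 * s) *\<^sub>R z))" for s
  have H_meas [measurable]: "H \<in> borel_measurable borel"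
    unfolding H_def by measurable
  have H_bound: "norm (H s) \<le> B" for s
    unfolding H_def using gauss.norm_integral_le_const[of "\<lambda>z. h (sqrt (2 * s) *\<^sub>R z)" B] bdd by simp
  have H_lim: "(\<lambda>n. H (\<epsilon> n * q)) \<longlonglongrightarrow> h 0" for q
  proof -
    have "(\<lambda>n. LINT z|gauss. h (sqrt (2 * (\<epsilon> n * q)) *\<^sub>R z)) \<longlonglongrightarrow> (LINT z::'e|gauss. h 0)"
    proof (rule integral_dominated_convergence[where w="\<lambda>_. B"])
      have "(\<lambda>n. sqrt (2 * (\<epsilon> n * q)) *\<^sub>R z) \<longlonglongrightarrow> sqrt (2 * (0 * q)) *\<^sub>R z" for z :: 'e
        by (intro tendsto_intros \<epsilon>)
      then show "AE z in gauss. (\<lambda>n. h (sqrt (2 * (\<epsilon> n * q)) *\<^sub>R z)) \<longlonglongrightarrow> h 0"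
        using cont by (intro AE_I2 isCont_tendsto_compose[where g=h]) (auto simp: continuous_on_eq_continuous_at)
    qed (use bdd in auto)
    then show ?thesis by (simp add: H_def)
  qed
  have "(LINT x|subord (approx_measure a (\<epsilon> n)). h x) =
      (LINT q|lborel. (frac_kernel a q * exp (- (\<epsilon> n * q)) / Gamma (1 + a)) *\<^sub>R H (\<epsilon> n * q))" for n
    using borel_finiteD[OF borel_finite_approx[OF \<epsilon>(1)]]
    by (subst integral_subord[where B=B]) (auto simp: bdd integral_approx[OF \<epsilon>(1)] H_def[symmetric])
  moreover have "(\<lambda>n. LINT q|lborel. (frac_kernel a q * exp (- (\<epsilon> n * q)) / Gamma (1 + a)) *\<^sub>R H (\<epsilon> n * q))
     \<longlonglongrightarrow> (LINT q|lborel. (frac_kernel a q * exp (- (0 * q)) / Gamma (1 + a)) *\<^sub>R h 0)"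
  proof (rule integral_dominated_convergence[where w="\<lambda>q. frac_kernel a q / Gamma (1 + a) * B"])
    show "integrable lborel (\<lambda>q. frac_kernel a q / Gamma (1 + a) * B)"
      using integrable_frac_kernel[OF a a1] by simp
    show "AE q in lborel. (\<lambda>n. (frac_kernel a q * exp (- (\<epsilon> n * q)) / Gamma (1 + a)) *\<^sub>R H (\<epsilon> n * q)) \<longlonglongrightarrow>
        (frac_kernel a q * exp (- (0 * q)) / Gamma (1 + a)) *\<^sub>R h 0"
      using G by (intro AE_I2 tendsto_intros \<epsilon> H_lim) auto
    show "AE q in lborel. norm ((frac_kernel a q * exp (- (\<epsilon> n * q)) / Gamma (1 + a)) *\<^sub>R H (\<epsilon> n * q)) \<le> frac_kernel a q / Gamma (1 + a) * B" for n
    proof (rule AE_I2)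
      fix q :: real
      have "frac_kernel a q * exp (- (\<epsilon> n * q)) \<le> frac_kernel a q * 1"
      proof (cases "q \<ge> 0")
        case True
        then show ?thesis
          using frac_kernel_nonneg[OF a, of q] \<epsilon>(1)[of n] by (intro mult_left_mono) auto
      qed (simp add: frac_kernel_def)
      then have "frac_kernel a q * exp (- (\<epsilon> n * q)) / Gamma (1 + a) \<le> frac_kernel a q / Gamma (1 + a)"
        using Gamma_real_pos[of "1 + a"] a by (intro divide_right_mono) auto
      then show "norm ((frac_kernel a q * exp (- (\<epsilon> n * q)) / Gamma (1 + a)) *\<^sub>R H (\<epsilon> n * q)) \<le> frac_kernel a q / Gamma (1 + a) * B"
        unfolding norm_scaleR using approx_density_nonneg[of q "\<epsilon> n"] H_bound[of "\<epsilon> n * q"] B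
        by (intro mult_mono) auto
    qed
  qed measurable
  ultimately show ?thesis
    by (simp add: approx_const_def scaleR_conv_of_real)
qed

end

end

section \<open>Bessel measures, their Fourier transforms and the Bessel kernel\<close>

definition bessel_measure :: "real \<Rightarrow> 'e::euclidean_space measure" where
  "bessel_measure a = subord (gamma_measure a)"

lemma borel_finite_bessel: "a > 0 \<Longrightarrow> borel_finite (bessel_measure a)"
  unfolding bessel_measure_def by (intro borel_finite_subord borel_finite_gamma)

text \<open>The index counts powers of 1 + |w|^2, so the Bessel kernel of order \<open>r\<close>
  corresponds to the index \<open>r / 2\<close> throughout.\<close>

lemma fourier_bessel:
  assumes "a > 0"
  shows "(LINT x|bessel_measure a. iexp (w \<bullet> x)) = of_real ((1 + (norm w)\<^sup>2) powr (- a))"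
proof -
  have "AE s in gamma_measure a. s \<ge> 0"
    using AE_gamma[OF assms] by eventually_elim simp
  then show ?thesis
    unfolding bessel_measure_def using borel_finiteD[OF borel_finite_gamma[OF assms]]
    by (subst fourier_subord) (auto simp: laplace_gamma[OF assms, simplified])
qed

lemma borel_finite_convolution:
  fixes \<mu> \<nu> :: "'e::ordered_euclidean_space measure"
  assumes "borel_finite \<mu>" "borel_finite \<nu>"
  shows "borel_finite (\<mu> \<star> \<nu>)"
  using convolution_finite[of \<mu> \<nu>] borel_finiteD[OF assms(1)] borel_finiteD[OF assms(2)]
  by (simp add: borel_finite_def)

lemma integral_convolution:
  fixes f :: "'e::ordered_euclidean_space \<Rightarrow> complex"
  assumes \<mu>: "borel_finite \<mu>" and \<nu>: "borel_finite \<nu>"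
    and f [measurable]: "f \<in> borel_measurable borel" and bdd: "\<And>x. norm (f x) \<le> B"
  shows "(LINT x|(\<mu> \<star> \<nu>). f x) = (LINT s|\<mu>. LINT t|\<nu>. f (s + t))"
proof -
  note [measurable_cong] = borel_finiteD(2)[OF \<mu>] borel_finiteD(2)[OF \<nu>]
  interpret \<mu>: finite_measure \<mu> by (rule borel_finiteD[OF \<mu>])
  interpret \<nu>: finite_measure \<nu> by (rule borel_finiteD[OF \<nu>])
  interpret P: pair_sigma_finite \<mu> \<nu> ..
  have fin: "finite_measure (\<mu> \<Otimes>\<^sub>M \<nu>)"
    by (rule finite_measure_pair_measure) unfold_locales
  have i: "integrable (\<mu> \<Otimes>\<^sub>M \<nu>) (\<lambda>(s, t). f (s + t))"
    by (rule finite_measure.integrable_const_bound[OF fin, where B=B]) (auto simp: bdd)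
  have "(LINT x|(\<mu> \<star> \<nu>). f x) = (LINT p|(\<mu> \<Otimes>\<^sub>M \<nu>). (case p of (s, t) \<Rightarrow> f (s + t)))"
    unfolding convolution_def by (subst integral_distr) (auto simp: case_prod_unfold)
  also have "\<dots> = (LINT s|\<mu>. LINT t|\<nu>. f (s + t))"
    using P.integral_fst[OF i] by simp
  finally show ?thesis .
qed

definition fourier :: "'e::euclidean_space measure \<Rightarrow> 'e \<Rightarrow> complex" where
  "fourier \<mu> w = (LINT x|\<mu>. iexp (w \<bullet> x))"

lemma fourier_convolution:
  fixes \<mu> \<nu> :: "'e::ordered_euclidean_space measure"
  assumes "borel_finite \<mu>" "borel_finite \<nu>"
  shows "fourier (\<mu> \<star> \<nu>) w = fourier \<mu> w * fourier \<nu> w"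
proof -
  have "fourier (\<mu> \<star> \<nu>) w = (LINT s|\<mu>. LINT t|\<nu>. iexp (w \<bullet> (s + t)))"
    unfolding fourier_def by (rule integral_convolution[OF assms, where B=1]) auto
  also have "\<dots> = (LINT s|\<mu>. LINT t|\<nu>. iexp (w \<bullet> s) * iexp (w \<bullet> t))"
    by (simp add: inner_add_right exp_add[symmetric] distrib_left)
  also have "\<dots> = fourier \<mu> w * fourier \<nu> w"
    by (simp only: integral_mult_right_zero integral_mult_left_zero fourier_def)
  finally show ?thesis .
qed

text \<open>The translation is moved from \<open>H\<close> onto the Gaussian density, so a uniform
  bound on the measurable function \<open>H\<close> yields Hoelder dependence on the shift.\<close>

lemma gauss_shift_bound:
  fixes H :: "'e::euclidean_space \<Rightarrow> complex"
  assumes [measurable]: "H \<in> borel_measurable borel" and bdd: "\<And>z. norm (H z) \<le> B"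
    and \<theta>: "0 < \<theta>" "\<theta> \<le> 1"
  shows "norm ((LINT z|gauss. H (z + v)) - (LINT z|gauss. H z)) \<le> B * (2 * norm v powr \<theta>)"
proof -
  have B: "B \<ge> 0" using order_trans[OF norm_ge_zero bdd[of 0]] .
  have dom: "integrable lborel (\<lambda>z. g z *\<^sub>R H z)" if "integrable lborel g" for g :: "'e \<Rightarrow> real"
  proof (rule Bochner_Integration.integrable_bound[OF integrable_mult_left[OF that, of B]])
    have [measurable]: "g \<in> borel_measurable borel" using that by auto
    show "(\<lambda>z. g z *\<^sub>R H z) \<in> borel_measurable lborel" by measurable
    show "AE z in lborel. norm (g z *\<^sub>R H z) \<le> norm (g z * B)"
      using bdd B by (auto simp: abs_mult intro!: mult_left_mono)
  qed
  have "(LINT z|gauss. H (z + v)) = (LINT z|lborel. gauss_density z *\<^sub>R H (z + v))"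
    by (rule integral_gauss) measurable
  also have "\<dots> = (LINT z|lborel. gauss_density (z - v) *\<^sub>R H z)"
    by (subst (2) lborel_affine[of 1 v]) (simp_all add: density_1 integral_distr add.commute)
  finally have "(LINT z|gauss. H (z + v)) - (LINT z|gauss. H z) =
      (LINT z|lborel. gauss_density (z + - v) *\<^sub>R H z) - (LINT z|lborel. gauss_density z *\<^sub>R H z)"
    by (simp add: integral_gauss)
  also have "\<dots> = (LINT z|lborel. (gauss_density (z + - v) - gauss_density z) *\<^sub>R H z)"
    unfolding scaleR_diff_left
    by (rule Bochner_Integration.integral_diff[symmetric])
      (rule dom integrable_gauss_density_shift integrable_gauss_density)+
  also have "norm \<dots> \<le> (LINT z|lborel. B * \<bar>gauss_density (z + - v) - gauss_density z\<bar>)"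
  proof (rule order_trans[OF integral_norm_bound integral_mono])
    show "norm ((gauss_density (z + - v) - gauss_density z) *\<^sub>R H z) \<le> B * \<bar>gauss_density (z + - v) - gauss_density z\<bar>" for z
      using mult_right_mono[OF bdd[of z], of "\<bar>gauss_density (z + - v) - gauss_density z\<bar>"] by (simp add: mult.commute)
  qed (intro integrable_norm dom integrable_mult_right integrable_abs Bochner_Integration.integrable_diff
      integrable_gauss_density_shift integrable_gauss_density)+
  also have "\<dots> \<le> B * (2 * norm (- v) powr \<theta>)"
    unfolding integral_mult_right_zero
    by (intro mult_left_mono gauss_density_shift_diff_powr \<theta> B)
  finally show ?thesis by simp
qed

text \<open>A Gamma law has negative moments below its shape parameter. With p = \<theta>/2 this is
  where the restriction \<theta> < 2\<alpha> comes from.\<close>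

lemma integrable_gamma_powr:
  assumes "p < a" "a > 0"
  shows "integrable (gamma_measure a) (\<lambda>s. (2 * s) powr (- p))"
proof -
  have 1: "integrable lborel (\<lambda>s. (2 powr (- p) / Gamma a) * (indicator {0..} s * s powr ((a - p) - 1) * exp (- (1 * s))))"
    using has_bochner_integral_Gamma[of "a - p" 1] assms by (auto simp: has_bochner_integral_iff)
  have *: "(2 powr (- p) / Gamma a) * (indicator {0..} s * s powr ((a - p) - 1) * exp (- (1 * s))) =
      (indicator {0..} s * s powr (a - 1) * exp (- s) / Gamma a) *\<^sub>R (2 * s) powr (- p)" for s
  proof (cases "s \<ge> 0")
    case True
    have "s powr (a - p - 1) = s powr (a - 1) * s powr (- p)"
      by (simp add: powr_add[symmetric] algebra_simps)
    then show ?thesis using True by (simp add: powr_mult)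
  qed simp
  have "integrable lborel (\<lambda>s. (indicator {0..} s * s powr (a - 1) * exp (- s) / Gamma a) *\<^sub>R (2 * s) powr (- p))"
    using 1 by (simp only: *)
  then show ?thesis
    unfolding gamma_measure_def using gamma_density_nonneg[OF assms(2)]
    by (subst integrable_density) auto
qed

lemma tendsto_norm_powr_zero:
  assumes "X \<longlonglongrightarrow> (0::'e::real_normed_vector)" "\<theta> > 0"
  shows "(\<lambda>n. norm (X n) powr \<theta>) \<longlonglongrightarrow> 0"
proof -
  have "(\<lambda>n. norm (X n) powr \<theta>) \<longlonglongrightarrow> 0 powr \<theta>"
    by (rule tendsto_powr') (use assms in \<open>auto intro: tendsto_norm_zero\<close>)
  then show ?thesis by simp
qed

lemma inverse_seq_pos: "1 / real (Suc n) > 0" and inverse_seq_tendsto: "(\<lambda>n. 1 / real (Suc n)) \<longlonglongrightarrow> 0"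
  by simp (rule LIMSEQ_Suc[OF lim_1_over_n])

text \<open>The random time is almost surely positive, and at each positive time the scaled Gaussian
  charges no Lebesgue null set. The Bessel kernel has to be a function, so its existence depends on
  this.\<close>

lemma bessel_absolutely_continuous:
  assumes a: "a > 0"
  shows "absolutely_continuous lborel (bessel_measure a :: 'e::euclidean_space measure)"
  unfolding absolutely_continuous_def
proof
  fix N :: "'e set" assume N: "N \<in> null_sets lborel"
  then have [measurable]: "N \<in> sets borel" by auto
  have null: "emeasure gauss ((\<lambda>z. c *\<^sub>R z) -` N) = 0" if "c > 0" for c :: real
  proof -
    have "AE x in density (distr lborel borel (\<lambda>z. 0 + c *\<^sub>R z)) (\<lambda>_. ennreal (\<bar>c\<bar> ^ DIM('e))). x \<notin> N"
      using AE_not_in[OF N] that by (subst lborel_affine[symmetric]) auto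
    then have "AE z in lborel. c *\<^sub>R z \<notin> N"
      using that by (subst (asm) AE_density; (subst (asm) AE_distr_iff)?; simp)
    then have "AE z in gauss. c *\<^sub>R z \<notin> N"
      unfolding gauss_def by (subst AE_density) (auto elim!: eventually_mono)
    then show ?thesis
      by (subst (asm) AE_iff_measurable[OF _ refl]) (auto simp: vimage_def)
  qed
  note fin = borel_finite_gamma[OF a]
  note [measurable_cong] = borel_finiteD(2)[OF fin]
  have "emeasure (bessel_measure a) N = emeasure (gamma_measure a \<Otimes>\<^sub>M gauss) ((\<lambda>(s, z). sqrt (2 * s) *\<^sub>R z) -` N)"
    unfolding bessel_measure_def subord_def
    by (subst emeasure_distr) (auto simp: space_pair_measure borel_finiteD(3)[OF fin])
  also have "\<dots> = (\<integral>\<^sup>+s. emeasure gauss (Pair s -` ((\<lambda>(s, z). sqrt (2 * s) *\<^sub>R z) -` N)) \<partial>gamma_measure a)"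
  proof (rule gauss.emeasure_pair_measure_alt)
    have "(\<lambda>(s, z). sqrt (2 * s) *\<^sub>R z) -` N \<inter> space (gamma_measure a \<Otimes>\<^sub>M gauss) \<in> sets (gamma_measure a \<Otimes>\<^sub>M gauss)"
      by (rule measurable_sets[where A=borel]) measurable
    then show "(\<lambda>(s, z). sqrt (2 * s) *\<^sub>R z) -` N \<in> sets (gamma_measure a \<Otimes>\<^sub>M gauss)"
      by (simp add: space_pair_measure borel_finiteD(3)[OF fin])
  qed
  also have "\<dots> = (\<integral>\<^sup>+s. 0 \<partial>gamma_measure a)"
  proof (rule nn_integral_cong_AE)
    show "AE s in gamma_measure a. emeasure gauss (Pair s -` ((\<lambda>(s, z). sqrt (2 * s) *\<^sub>R z) -` N)) = 0"
      using AE_gamma[OF a]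
    proof eventually_elim
      case (elim s)
      then show ?case using null[of "sqrt (2 * s)"] by (simp add: vimage_def)
    qed
  qed
  finally show "N \<in> null_sets (bessel_measure a)"
    by (simp add: null_sets_def borel_finiteD(2)[OF borel_finite_bessel[OF a]])
qed

lemma bessel_density:
  assumes a: "a > 0"
  shows "\<exists>k :: 'e::euclidean_space \<Rightarrow> real. k \<in> borel_measurable borel \<and> (\<forall>x. k x \<ge> 0) \<and>
    bessel_measure a = density lborel (\<lambda>x. ennreal (k x))"
proof -
  let ?b = "bessel_measure a :: 'e measure"
  note ac = bessel_absolutely_continuous[OF a]
  have "borel_finite ?b"
    by (rule borel_finite_bessel[OF a])
  note D = borel_finiteD[OF this]
  have fin: "sigma_finite_measure ?b"
    using D(1) by (simp add: finite_measure_def)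
  let ?k = "\<lambda>x. enn2real (RN_deriv lborel ?b x)"
  have "?b = density lborel (RN_deriv lborel ?b)"
    using ac D(2) by (intro sigma_finite_measure.density_RN_deriv[OF sigma_finite_lborel, symmetric]) simp_all
  also have "\<dots> = density lborel (\<lambda>x. ennreal (?k x))"
  proof (rule density_cong)
    have "AE x in lborel. RN_deriv lborel ?b x \<noteq> \<infinity>"
      using ac D(2) by (intro sigma_finite_measure.RN_deriv_finite[OF sigma_finite_lborel] fin) simp_all
    then show "AE x in lborel. RN_deriv lborel ?b x = ennreal (?k x)"
      by eventually_elim (auto simp: less_top)
  qed auto
  finally show ?thesis
    by (intro exI[of _ ?k]) auto
qed

text \<open>The \<open>SOME\<close> in \<open>bessel_kernel\<close> says nothing until a witness is
  exhibited; a Radon-Nikodym density of \<open>bessel_measure (r / 2)\<close> is one. The frequency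
  is rescaled by -1/(2 pi) to pass between the two Fourier conventions.\<close>

lemma bessel_kernel_spec:
  assumes "r > 0"
  shows "integrable lborel (bessel_kernel r :: real^'d \<Rightarrow> complex)"
    and "(LINT x|lborel. bessel_kernel r x * iexp (w \<bullet> x)) = fourier (bessel_measure (r / 2)) (w :: real^'d)"
proof -
  let ?P = "\<lambda>G :: real^'d \<Rightarrow> complex. integrable lborel G \<and>
     (\<forall>\<omega>. (LINT x|lborel. G x * exp (- 2 * of_real pi * \<i> * of_real (\<omega> \<bullet> x))) =
           of_real ((1 + (norm ((2 * pi) *\<^sub>R \<omega>))\<^sup>2) powr (- r / 2)))"
  have fb: "fourier (bessel_measure (r / 2)) v = of_real ((1 + (norm v)\<^sup>2) powr (- r / 2))" for v :: "real^'d"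
    using fourier_bessel[of "r / 2" v] assms by (simp add: fourier_def)
  obtain k :: "real^'d \<Rightarrow> real" where k [measurable]: "k \<in> borel_measurable borel" and k0: "\<And>x. k x \<ge> 0"
    and bk: "bessel_measure (r / 2) = density lborel (\<lambda>x. ennreal (k x))"
    using bessel_density[of "r / 2"] assms by auto
  have "finite_measure (density lborel (\<lambda>x. ennreal (k x)))"
    unfolding bk[symmetric] using assms by (intro borel_finiteD borel_finite_bessel) simp
  then have "integrable (density lborel (\<lambda>x. ennreal (k x))) (\<lambda>_. 1 :: real)"
    by (rule finite_measure.integrable_const)
  then have int_k: "integrable lborel k"
    using k0 by (subst (asm) integrable_density) auto
  have "?P (\<lambda>x. of_real (k x))"
  proof (intro conjI allI)
    show "integrable lborel (\<lambda>x. complex_of_real (k x))"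
      using int_k by simp
    fix \<omega> :: "real^'d"
    have "(LINT x|lborel. of_real (k x) * exp (- 2 * of_real pi * \<i> * of_real (\<omega> \<bullet> x))) =
        (LINT x|lborel. k x *\<^sub>R iexp ((- (2 * pi) *\<^sub>R \<omega>) \<bullet> x))"
      by (simp add: scaleR_conv_of_real[of _ "_ :: complex"] ac_simps)
    also have "\<dots> = fourier (bessel_measure (r / 2)) (- (2 * pi) *\<^sub>R \<omega>)"
      unfolding fourier_def bk using k0 by (subst integral_density) auto
    finally show "(LINT x|lborel. of_real (k x) * exp (- 2 * of_real pi * \<i> * of_real (\<omega> \<bullet> x))) =
           of_real ((1 + (norm ((2 * pi) *\<^sub>R \<omega>))\<^sup>2) powr (- r / 2))"
      unfolding fb by simp
  qed
  then have P: "?P (bessel_kernel r)"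
    unfolding bessel_kernel_def by (rule someI[where P = ?P])
  then show "integrable lborel (bessel_kernel r :: real^'d \<Rightarrow> complex)" by blast
  have "exp (- 2 * of_real pi * \<i> * of_real ((- (1 / (2 * pi)) *\<^sub>R w) \<bullet> x)) = iexp (w \<bullet> x)" for x
    by simp
  then show "(LINT x|lborel. bessel_kernel r x * iexp (w \<bullet> x)) = fourier (bessel_measure (r / 2)) w"
    using P[THEN conjunct2, rule_format, of "- (1 / (2 * pi)) *\<^sub>R w"] by (simp add: fb)
qed

section \<open>Weak integrals over orbits\<close>

locale cw_action =
  fixes \<psi> :: "real^'d \<Rightarrow> 'a::complex_banach_algebra \<Rightarrow> 'a"
  assumes cw_group: "cw_group \<psi>"
begin

definition M :: real where "M = (SUP t. onorm (\<psi> t))"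

lemma automorphism: "banach_algebra_automorphism (\<psi> t)"
  using cw_group by (simp add: cw_group_def automorphism_group_def)

lemma bounded_linear_psi: "bounded_linear (\<psi> t)"
  and psi_scaleC: "\<psi> t (c *\<^sub>C x) = c *\<^sub>C \<psi> t x"
  and psi_mult: "\<psi> t (x * y) = \<psi> t x * \<psi> t y"
  and psi_one: "\<psi> t 1 = 1"
  and bij_psi: "bij (\<psi> t)"
  using automorphism[of t] by (simp_all add: banach_algebra_automorphism_def)

lemma psi_psi: "\<psi> s (\<psi> t a) = \<psi> (s + t) a"
  using cw_group by (metis automorphism_group_def comp_apply cw_group_def)

text \<open>The group law makes \<open>\<psi> 0\<close> idempotent, and an injective idempotent map
  is the identity.\<close>

lemma psi_0 [simp]: "\<psi> 0 a = a"
  using psi_psi[of 0 0 a] bij_psi[of 0] by (simp add: bij_def inj_eq)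

lemma psi_add: "\<psi> t (x + y) = \<psi> t x + \<psi> t y"
  and psi_diff: "\<psi> t (x - y) = \<psi> t x - \<psi> t y"
  by (simp_all add: linear_add linear_diff bounded_linear.linear[OF bounded_linear_psi])

lemma norm_psi: "norm (\<psi> t a) \<le> M * norm a"
proof -
  have "onorm (\<psi> t) \<le> M"
    using cw_group unfolding M_def
    by (intro cSUP_upper) (auto simp: cw_group_def automorphism_group_def)
  then show ?thesis
    using onorm[OF bounded_linear_psi, of t a] by (meson mult_right_mono norm_ge_zero order_trans)
qed

lemma M_nonneg: "M \<ge> 0"
proof -
  have "0 \<le> onorm (\<psi> 0)"
    by (rule onorm_pos_le[OF bounded_linear_psi])
  also have "\<dots> \<le> M"
    using cw_group unfolding M_def
    by (intro cSUP_upper) (auto simp: cw_group_def automorphism_group_def)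
  finally show ?thesis .
qed

abbreviation F :: "('a \<Rightarrow> complex) set" where "F \<equiv> group_dual \<psi>"

lemma bounded_linear_F: "f \<in> F \<Longrightarrow> bounded_linear f"
  and F_scaleC: "f \<in> F \<Longrightarrow> f (c *\<^sub>C x) = c * f x"
  and F_cont: "f \<in> F \<Longrightarrow> continuous_on UNIV (\<lambda>t. f (\<psi> t a))"
  by (simp_all add: group_dual_def banach_dual_def)

lemma F_add: "f \<in> F \<Longrightarrow> f (x + y) = f x + f y"
  and F_diff: "f \<in> F \<Longrightarrow> f (x - y) = f x - f y"
  and F_scaleR: "f \<in> F \<Longrightarrow> f (s *\<^sub>R x) = s *\<^sub>R f x"
  and F_zero: "f \<in> F \<Longrightarrow> f 0 = 0"
  by (simp_all add: linear_add linear_diff linear_scale linear_0 bounded_linear.linear[OF bounded_linear_F])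

lemma F_onorm_nonneg: "f \<in> F \<Longrightarrow> onorm f \<ge> 0"
  by (rule onorm_pos_le[OF bounded_linear_F])

lemma F_bound: "f \<in> F \<Longrightarrow> norm (f x) \<le> onorm f * norm x"
  by (rule onorm[OF bounded_linear_F])

lemma F_psi_bound: "f \<in> F \<Longrightarrow> norm (f (\<psi> t a)) \<le> onorm f * (M * norm a)"
  using F_bound[of f "\<psi> t a"] mult_left_mono[OF norm_psi F_onorm_nonneg] by (blast intro: order_trans)

lemma F_measurable: "f \<in> F \<Longrightarrow> (\<lambda>t. f (\<psi> t a)) \<in> borel_measurable borel"
  by (rule borel_measurable_continuous_onI[OF F_cont])

lemma zero_in_F: "(\<lambda>_. 0) \<in> F"
  by (simp add: group_dual_def banach_dual_def)

text \<open>The route from functionals back to norms: weak integrals are known only through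
  \<open>F\<close>, so their norms are estimated by one bound proportional to
  \<open>onorm f\<close>.\<close>

lemma norm_leI_F:
  assumes "\<And>f. f \<in> F \<Longrightarrow> norm (f a) \<le> onorm f * C" "C \<ge> 0"
  shows "norm a \<le> C"
proof -
  have "norm a = (SUP f\<in>{f \<in> F. onorm f \<le> 1}. cmod (f a))"
    using cw_group by (simp add: cw_group_def norm_fundamental_def)
  also have "\<dots> \<le> C"
  proof (rule cSUP_least)
    have "(\<lambda>_. 0) \<in> {f \<in> F. onorm f \<le> 1}"
      using zero_in_F by (simp add: onorm_zero)
    then show "{f \<in> F. onorm f \<le> 1} \<noteq> {}"
      by blast
  next
    fix f assume "f \<in> {f \<in> F. onorm f \<le> 1}"
    then show "cmod (f a) \<le> C"
      using assms(1)[of f] mult_right_mono[of "onorm f" 1 C] assms(2) by auto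
  qed
  finally show ?thesis .
qed

lemma F_separates:
  assumes "\<And>f. f \<in> F \<Longrightarrow> f a = f b"
  shows "a = b"
  using norm_leI_F[of "a - b" 0] assms by (simp add: F_diff)

abbreviation \<sigma> :: "'a topology" where "\<sigma> \<equiv> weak_topology_of F"

lemma topspace_weak [simp]: "topspace \<sigma> = UNIV"
proof -
  have "(\<lambda>_. 0) -` UNIV \<in> {f -` U |f U. f \<in> F \<and> open U}"
    using zero_in_F open_UNIV by blast
  then have "UNIV \<in> {f -` U |f U. f \<in> F \<and> open U}"
    by (simp only: vimage_UNIV)
  then show ?thesis
    unfolding weak_topology_of_def topology_generated_by_topspace by blast
qed

lemma openin_weak: "f \<in> F \<Longrightarrow> open U \<Longrightarrow> openin \<sigma> (f -` U)"
  unfolding weak_topology_of_def by (rule topology_generated_by_Basis) auto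

lemma continuous_map_orbit: "continuous_map euclidean \<sigma> (\<lambda>t. \<psi> t a)"
proof -
  have "open ((\<lambda>t. f (\<psi> t a)) -` U)" if "f \<in> F" "open U" for f and U :: "complex set"
    using continuous_on_open_vimage[OF open_UNIV, THEN iffD1, OF F_cont[OF that(1), of a]] that(2) by simp
  then have "open ((\<lambda>t. \<psi> t a) -` V)" if "V \<in> {f -` U |f U. f \<in> F \<and> open U}" for V
    using that by (auto simp: vimage_def)
  moreover have "\<Union> {f -` U |f U. f \<in> F \<and> open U} = UNIV"
    using topspace_weak unfolding weak_topology_of_def topology_generated_by_topspace .
  ultimately show ?thesis
    unfolding weak_topology_of_def continuous_on_generated_topo_iff by simp
qed

text \<open>
  Riemann sums over simple approximations of the identity of \<open>\<real>\<^sup>d\<close> lie in a multiple of the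
  convex hull of a piece of the orbit; the integral is a cluster point by compactness of its closure.
\<close>

lemma weak_integral_cball_exists:
  assumes fin: "finite_measure \<mu>" and sets [measurable_cong]: "sets \<mu> = sets borel"
  shows "\<exists>b. \<forall>f\<in>F. f b = (LINT t|\<mu>. indicator (cball 0 R) t *\<^sub>R f (\<psi> t a))"
proof -
  interpret finite_measure \<mu> by fact
  have space: "space \<mu> = UNIV" using sets_eq_imp_space_eq[OF sets] by simp
  define B :: "(real^'d) set" where "B = cball 0 R"
  have B [measurable]: "B \<in> sets \<mu>" by (simp add: B_def sets)
  define m where "m = measure \<mu> B"
  define I where "I f = (LINT t|\<mu>. indicator B t *\<^sub>R f (\<psi> t a))" for f :: "'a \<Rightarrow> complex"
  show ?thesis
  proof (cases "m = 0")
    case True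
    have "I f = 0" if "f \<in> F" for f
    proof -
      have "AE t in \<mu>. t \<notin> B"
        using True B by (intro AE_not_in) (simp add: null_sets_def m_def emeasure_eq_measure)
      then show ?thesis unfolding I_def
        by (intro integral_eq_zero_AE) (auto elim!: eventually_mono)
    qed
    then show ?thesis
      by (intro exI[of _ 0]) (simp add: I_def B_def F_zero)
  next
    case False
    then have m: "m > 0" by (simp add: m_def order_less_le)
    obtain S where S: "\<And>i. simple_function \<mu> (S i)"
      and S_lim: "\<And>t. (\<lambda>i. S i t) \<longlonglongrightarrow> t"
      and S_bound: "\<And>i t. norm (S i t) \<le> 2 * norm t"
      using borel_measurable_implies_sequence_metric[of "\<lambda>t. t" \<mu> "0 :: real^'d"] by (auto simp: space)
    \<comment> \<open>The simple approximations satisfy |S i t| \<le> 2 |t|, so on the ball of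
      radius \<open>R\<close> their values stay within radius \<open>2 * R\<close>.\<close>
    define K where "K = (\<lambda>t. \<psi> t a) ` cball 0 (2 * R)"
    have "compactin \<sigma> K"
      unfolding K_def by (rule image_compactin[OF _ continuous_map_orbit]) simp
    then have cpt: "compactin \<sigma> (\<sigma> closure_of (convex hull K))"
      using cw_group by (simp add: cw_group_def Let_def)
    have sub: "convex hull K \<subseteq> \<sigma> closure_of (convex hull K)"
      by (rule closure_of_subset) simp
    \<comment> \<open>Dividing by the mass \<open>m\<close> makes the weights sum to 1, so the
      Riemann sum is a convex combination; this is why \<open>m = 0\<close> was split off.\<close>
    define p where "p i = (\<Sum>y\<in>S i ` B. (measure \<mu> (S i -` {y} \<inter> B) / m) *\<^sub>R \<psi> y a)" for i
    have fin_S: "finite (S i ` B)" for i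
      using simple_functionD(1)[OF S[of i]] by (rule finite_subset[rotated]) (auto simp: space)
    have meas: "S i -` {y} \<inter> B \<in> sets \<mu>" for i y
      using simple_functionD(2)[OF S[of i], of "{y}"] B by (auto simp: space)
    have sum_ind: "(\<Sum>y\<in>S i ` B. indicator (S i -` {y} \<inter> B) t *\<^sub>R g y) = indicator B t *\<^sub>R g (S i t)"
      for i t and g :: "real^'d \<Rightarrow> 'c::real_vector"
    proof (cases "t \<in> B")
      case True
      have "(\<Sum>y\<in>S i ` B. indicator (S i -` {y} \<inter> B) t *\<^sub>R g y) = (\<Sum>y\<in>{S i t}. indicator (S i -` {y} \<inter> B) t *\<^sub>R g y)"
        by (rule sum.mono_neutral_right[OF fin_S]) (use True in \<open>auto simp: indicator_def\<close>)
      then show ?thesis using True by simp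
    qed simp
    have int_ind: "(\<Sum>y\<in>S i ` B. measure \<mu> (S i -` {y} \<inter> B) *\<^sub>R g y) = (LINT t|\<mu>. indicator B t *\<^sub>R g (S i t))"
      for i and g :: "real^'d \<Rightarrow> 'c::{banach,second_countable_topology}"
    proof -
      have "integrable \<mu> (indicator (S i -` {y} \<inter> B) :: _ \<Rightarrow> real)" for y
        using meas by (simp add: integrable_indicator_iff emeasure_eq_measure)
      then show ?thesis
        unfolding sum_ind[symmetric]
        by (subst Bochner_Integration.integral_sum) (auto simp: space intro!: sum.cong)
    qed
    have p_hull: "p i \<in> convex hull K" for i
      unfolding p_def
    proof (rule convex_sum[OF fin_S convex_convex_hull,
        where a="\<lambda>y. measure \<mu> (S i -` {y} \<inter> B) / m" and y="\<lambda>y. \<psi> y a"])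
      have "(\<Sum>y\<in>S i ` B. measure \<mu> (S i -` {y} \<inter> B)) = m"
        using int_ind[of i "\<lambda>_. 1::real"] B by (simp add: m_def space)
      then show "(\<Sum>y\<in>S i ` B. measure \<mu> (S i -` {y} \<inter> B) / m) = 1"
        using m by (simp add: sum_divide_distrib[symmetric])
      show "\<psi> y a \<in> convex hull K" if "y \<in> S i ` B" for y
      proof (rule hull_inc)
        obtain t where "y = S i t" "norm t \<le> R"
          using \<open>y \<in> S i ` B\<close> by (auto simp: B_def)
        then have "norm y \<le> 2 * R"
          using S_bound[of i t] by simp
        then show "\<psi> y a \<in> K" by (auto simp: K_def)
      qed
    qed (use m in auto)
    have p_lim: "(\<lambda>i. f (p i)) \<longlonglongrightarrow> I f /\<^sub>R m" if f: "f \<in> F" for f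
    proof -
      have "f (p i) = (LINT t|\<mu>. indicator B t *\<^sub>R f (\<psi> (S i t) a)) /\<^sub>R m" for i
        using int_ind[of i "\<lambda>y. f (\<psi> y a)"]
        by (simp add: p_def linear_sum[OF bounded_linear.linear[OF bounded_linear_F[OF f]]] F_scaleR[OF f]
            scaleR_scaleR[symmetric] divide_inverse_commute del: scaleR_scaleR flip: scaleR_sum_right)
      moreover have "(\<lambda>i. LINT t|\<mu>. indicator B t *\<^sub>R f (\<psi> (S i t) a)) \<longlonglongrightarrow> I f"
        unfolding I_def
      proof (rule integral_dominated_convergence[where w="\<lambda>_. onorm f * (M * norm a)"])
        note [measurable] = F_measurable[OF f] borel_measurable_simple_function[OF S]
        show "(\<lambda>t. indicator B t *\<^sub>R f (\<psi> t a)) \<in> borel_measurable \<mu>" by measurable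
        have "(\<lambda>t. f (\<psi> (S i t) a)) \<in> borel_measurable \<mu>" for i
          using measurable_compose[OF borel_measurable_simple_function[OF S] F_measurable[OF f]] .
        then show "(\<lambda>t. indicator B t *\<^sub>R f (\<psi> (S i t) a)) \<in> borel_measurable \<mu>" for i by measurable
        show "AE t in \<mu>. (\<lambda>i. indicator B t *\<^sub>R f (\<psi> (S i t) a)) \<longlonglongrightarrow> indicator B t *\<^sub>R f (\<psi> t a)"
          using F_cont[OF f, of a] S_lim
          by (intro AE_I2 tendsto_scaleR tendsto_const isCont_tendsto_compose[where g="\<lambda>t. f (\<psi> t a)"])
             (auto simp: continuous_on_eq_continuous_at)
        show "AE t in \<mu>. norm (indicator B t *\<^sub>R f (\<psi> (S i t) a)) \<le> onorm f * (M * norm a)" for i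
          using F_psi_bound[OF f] F_onorm_nonneg[OF f] M_nonneg by (intro AE_I2) (auto simp: indicator_def)
      qed simp
      ultimately show ?thesis
        by (simp only: tendsto_scaleR tendsto_const)
    qed
    \<comment> \<open>Each pair (f, n) gives a weakly closed condition. Finitely many of them hold
      at \<open>p i\<close> for large \<open>i\<close>, so the finite intersection property yields
      one \<open>b\<close> satisfying all; letting n grow then makes the equation exact.\<close>
    define T where "T = (\<lambda>(f, n). {b. norm (f b - I f /\<^sub>R m) \<le> 1 / real (Suc n)})"
    have "\<sigma> closure_of (convex hull K) \<inter> \<Inter> (T ` (F \<times> UNIV)) \<noteq> {}"
    proof (rule compactin_fip[THEN iffD1, OF cpt, THEN conjunct2, rule_format], safe)
      fix f n assume f: "f \<in> F"
      have "UNIV - T (f, n) = f -` (- cball (I f /\<^sub>R m) (1 / real (Suc n)))"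
        by (auto simp: T_def dist_norm norm_minus_commute)
      then show "closedin \<sigma> (T (f, n))"
        using openin_weak[OF f, of "- cball (I f /\<^sub>R m) (1 / real (Suc n))"]
        by (simp add: closedin_def open_Compl)
    next
      fix \<F> assume \<F>: "finite \<F>" "\<F> \<subseteq> T ` (F \<times> UNIV)"
        and empty: "\<sigma> closure_of (convex hull K) \<inter> \<Inter> \<F> = {}"
      obtain C where C: "C \<subseteq> F \<times> UNIV" "finite C" "\<F> = T ` C"
        using finite_subset_image[OF \<F>] by blast
      have "\<forall>\<^sub>F i in sequentially. \<forall>c\<in>C. p i \<in> T c"
      proof (rule eventually_ball_finite[OF C(2)], safe)
        fix f n assume "(f, n) \<in> C"
        then have "f \<in> F" using C by auto
        from tendstoD[OF p_lim[OF this], of "1 / real (Suc n)"]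
        show "\<forall>\<^sub>F i in sequentially. p i \<in> T (f, n)"
          by (auto simp: T_def dist_norm elim!: eventually_mono)
      qed
      then obtain i where "\<forall>c\<in>C. p i \<in> T c"
        using eventually_happens'[OF sequentially_bot] by blast
      then have "p i \<in> \<sigma> closure_of (convex hull K) \<inter> \<Inter> \<F>"
        using p_hull sub C(3) by auto
      then show False using empty by auto
    qed
    then obtain b where b: "\<And>f n. f \<in> F \<Longrightarrow> norm (f b - I f /\<^sub>R m) \<le> 1 / real (Suc n)"
      by (auto simp: T_def)
    have fb: "f b = I f /\<^sub>R m" if "f \<in> F" for f
    proof -
      have "norm (f b - I f /\<^sub>R m) \<le> 0"
        by (rule LIMSEQ_le_const[OF LIMSEQ_Suc[OF lim_1_over_n]]) (use b[OF that] in auto)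
      then show ?thesis by simp
    qed
    have "f (m *\<^sub>R b) = I f" if "f \<in> F" for f
      using m by (simp add: F_scaleR[OF that] fb[OF that])
    then show ?thesis
      unfolding I_def B_def by blast
  qed
qed

text \<open>The integrals over growing balls are Cauchy in norm, since their differences are
  controlled by the mass of the annulus between the balls, which is small for a finite
  measure.\<close>

lemma weak_integral_exists:
  assumes fin: "finite_measure \<mu>" and sets [measurable_cong]: "sets \<mu> = sets borel"
  shows "\<exists>b. \<forall>f\<in>F. f b = (LINT t|\<mu>. f (\<psi> t a))"
proof -
  interpret finite_measure \<mu> by fact
  have space: "space \<mu> = UNIV" using sets_eq_imp_space_eq[OF sets] by simp
  let ?B = "\<lambda>n. cball (0 :: real^'d) (real n)"
  have [measurable]: "?B n \<in> sets \<mu>" for n by (simp add: sets)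
  obtain b where b: "\<And>n f. f \<in> F \<Longrightarrow> f (b n) = (LINT t|\<mu>. indicator (?B n) t *\<^sub>R f (\<psi> t a))"
    using choice[of "\<lambda>n c. \<forall>f\<in>F. f c = (LINT t|\<mu>. indicator (?B n) t *\<^sub>R f (\<psi> t a))"]
      weak_integral_cball_exists[OF assms] by blast
  have int: "integrable \<mu> (\<lambda>t. f (\<psi> t a))" if "f \<in> F" for f
    using F_measurable[OF that] F_psi_bound[OF that]
    by (intro integrable_const_bound[where B="onorm f * (M * norm a)"]) auto
  define w where "w n = measure \<mu> (?B n)" for n
  have diff: "norm (b n - b k) \<le> M * norm a * (w n - w k)" if "k \<le> n" for k n
  proof (rule norm_leI_F)
    have w: "w n - w k = (LINT t|\<mu>. indicator (?B n - ?B k) t)"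
    proof -
      have "measure \<mu> (?B n - ?B k) = w n - w k"
        unfolding w_def by (rule finite_measure_Diff) (use that in \<open>simp_all add: subset_cball sets\<close>)
      then show ?thesis by (simp add: space)
    qed
    then show "0 \<le> M * norm a * (w n - w k)"
      using M_nonneg by (auto intro!: mult_nonneg_nonneg)
    fix f assume f: "f \<in> F"
    note [measurable] = F_measurable[OF f]
    have ii: "integrable \<mu> (\<lambda>t. indicator (?B n) t *\<^sub>R f (\<psi> t a))" for n
      by (rule integrable_mult_indicator[OF _ int[OF f]]) measurable
    have "f (b n - b k) = (LINT t|\<mu>. indicator (?B n) t *\<^sub>R f (\<psi> t a) - indicator (?B k) t *\<^sub>R f (\<psi> t a))"
      using ii by (simp add: F_diff[OF f] b[OF f])
    also have "norm \<dots> \<le> (LINT t|\<mu>. onorm f * (M * norm a) * indicator (?B n - ?B k) t)"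
    proof (rule order_trans[OF integral_norm_bound integral_mono])
      show "integrable \<mu> (\<lambda>t. onorm f * (M * norm a) * indicator (?B n - ?B k) t)"
        by (intro integrable_mult_right) (simp add: integrable_indicator_iff emeasure_eq_measure)
      have "?B k \<subseteq> ?B n" using that by (simp add: subset_cball)
      then show "norm (indicator (?B n) t *\<^sub>R f (\<psi> t a) - indicator (?B k) t *\<^sub>R f (\<psi> t a)) \<le> onorm f * (M * norm a) * indicator (?B n - ?B k) t" for t
        using F_psi_bound[OF f] by (auto simp: indicator_def)
    qed (intro integrable_norm Bochner_Integration.integrable_diff ii)
    also have "\<dots> = onorm f * (M * norm a * (w n - w k))"
      by (simp add: w)
    finally show "norm (f (b n - b k)) \<le> onorm f * (M * norm a * (w n - w k))" .
  qed
  have "w \<longlonglongrightarrow> measure \<mu> (\<Union>n. ?B n)"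
    unfolding w_def by (rule finite_Lim_measure_incseq) (auto simp: incseq_def subset_cball)
  then have "Cauchy w" by (rule LIMSEQ_imp_Cauchy)
  have "Cauchy b"
  proof (rule CauchyI)
    fix e :: real assume "e > 0"
    moreover have c_pos: "M * norm a + 1 > 0"
      using M_nonneg by (simp add: add_nonneg_pos)
    ultimately have "e / (M * norm a + 1) > 0" by simp
    from CauchyD[OF \<open>Cauchy w\<close> this] obtain N
      where N: "\<And>m n. m \<ge> N \<Longrightarrow> n \<ge> N \<Longrightarrow> norm (w m - w n) < e / (M * norm a + 1)" by blast
    have *: "norm (b n - b k) < e" if "k \<le> n" "k \<ge> N" "n \<ge> N" for k n
    proof -
      have "norm (b n - b k) \<le> M * norm a * \<bar>w n - w k\<bar>"
        using diff[OF that(1)] M_nonneg by (meson abs_ge_self mult_left_mono mult_nonneg_nonneg norm_ge_zero order_trans)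
      also have "\<dots> \<le> (M * norm a + 1) * \<bar>w n - w k\<bar>"
        by (intro mult_right_mono) auto
      also have "\<dots> < e"
        using N[of n k] that c_pos by (simp only: real_norm_def pos_less_divide_eq mult.commute)
      finally show ?thesis .
    qed
    show "\<exists>N. \<forall>m\<ge>N. \<forall>n\<ge>N. norm (b m - b n) < e"
      using * by (metis linear norm_minus_commute)
  qed
  then obtain c where c: "b \<longlonglongrightarrow> c"
    by (auto simp: Cauchy_convergent_iff convergent_def)
  have "f c = (LINT t|\<mu>. f (\<psi> t a))" if f: "f \<in> F" for f
  proof (rule LIMSEQ_unique)
    show "(\<lambda>n. f (b n)) \<longlonglongrightarrow> f c"
      by (rule bounded_linear.tendsto[OF bounded_linear_F[OF f] c])
    show "(\<lambda>n. f (b n)) \<longlonglongrightarrow> (LINT t|\<mu>. f (\<psi> t a))"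
      unfolding b[OF f]
    proof (rule integral_dominated_convergence[where w="\<lambda>_. onorm f * (M * norm a)"])
      note [measurable] = F_measurable[OF f]
      show "(\<lambda>t. f (\<psi> t a)) \<in> borel_measurable \<mu>" by measurable
      show "(\<lambda>t. indicator (?B n) t *\<^sub>R f (\<psi> t a)) \<in> borel_measurable \<mu>" for n by measurable
      show "AE t in \<mu>. (\<lambda>n. indicator (?B n) t *\<^sub>R f (\<psi> t a)) \<longlonglongrightarrow> f (\<psi> t a)"
      proof (rule AE_I2, rule tendsto_eventually)
        fix t :: "real^'d"
        show "\<forall>\<^sub>F n in sequentially. indicator (?B n) t *\<^sub>R f (\<psi> t a) = f (\<psi> t a)"
          using eventually_ge_at_top[of "nat \<lceil>norm t\<rceil>"] by eventually_elim (simp add: nat_le_iff ceiling_le_iff)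
      qed
      show "AE t in \<mu>. norm (indicator (?B n) t *\<^sub>R f (\<psi> t a)) \<le> onorm f * (M * norm a)" for n
        using F_psi_bound[OF f] F_onorm_nonneg[OF f] M_nonneg by (intro AE_I2) (auto simp: indicator_def)
    qed simp
  qed
  then show ?thesis by blast
qed

text \<open>The paper's \<open>\<mu> * a\<close> for the reflected measure: the sign in \<open>\<psi> (- t)\<close> is dropped.\<close>

definition W :: "(real^'d) measure \<Rightarrow> 'a \<Rightarrow> 'a" where
  "W \<mu> a = (THE b. \<forall>f\<in>F. f b = (LINT t|\<mu>. f (\<psi> t a)))"

lemma W_char:
  assumes "borel_finite \<mu>" "f \<in> F"
  shows "f (W \<mu> a) = (LINT t|\<mu>. f (\<psi> t a))"
proof -
  obtain b where b: "\<forall>f\<in>F. f b = (LINT t|\<mu>. f (\<psi> t a))"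
    using weak_integral_exists[OF borel_finiteD(1,2)[OF assms(1)]] by blast
  have "W \<mu> a = b"
    unfolding W_def
  proof (rule the_equality[where P="\<lambda>b. \<forall>f\<in>F. f b = (LINT t|\<mu>. f (\<psi> t a))", OF b])
    fix c assume "\<forall>f\<in>F. f c = (LINT t|\<mu>. f (\<psi> t a))"
    with b have "f c = f b" if "f \<in> F" for f
      using that by metis
    then show "c = b" by (rule F_separates)
  qed
  then show ?thesis
    using assms(2) b by simp
qed

lemma W_eqI:
  assumes "borel_finite \<mu>" "\<And>f. f \<in> F \<Longrightarrow> f b = (LINT t|\<mu>. f (\<psi> t a))"
  shows "W \<mu> a = b"
  by (rule F_separates) (simp add: assms W_char)

lemma orbit_measurable:
  assumes "borel_finite \<mu>" "f \<in> F"
  shows "(\<lambda>t. f (\<psi> t a)) \<in> borel_measurable \<mu>"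
  using F_measurable[OF assms(2)] by (subst measurable_cong_sets[OF borel_finiteD(2)[OF assms(1)] refl])

lemma integrable_orbit:
  assumes "borel_finite \<mu>" "f \<in> F"
  shows "integrable \<mu> (\<lambda>t. f (\<psi> t a))"
  using orbit_measurable[OF assms] F_psi_bound[OF assms(2)] borel_finiteD(1)[OF assms(1)]
  by (intro finite_measure.integrable_const_bound[where B="onorm f * (M * norm a)"] AE_I2)

lemma W_bound:
  assumes "borel_finite \<mu>"
  shows "norm (W \<mu> a) \<le> M * measure \<mu> UNIV * norm a"
proof (rule norm_leI_F)
  fix f assume f: "f \<in> F"
  have "norm (LINT t|\<mu>. f (\<psi> t a)) \<le> measure \<mu> (space \<mu>) * (onorm f * (M * norm a))"
    using orbit_measurable[OF assms f] F_psi_bound[OF f] borel_finiteD(1)[OF assms]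
    by (intro finite_measure.norm_integral_le_const)
  then show "norm (f (W \<mu> a)) \<le> onorm f * (M * measure \<mu> UNIV * norm a)"
    using borel_finiteD(3)[OF assms] by (simp add: W_char[OF assms f] ac_simps)
qed (use M_nonneg in simp)

lemma W_add:
  assumes "borel_finite \<mu>"
  shows "W \<mu> (a + b) = W \<mu> a + W \<mu> b"
  by (rule W_eqI[OF assms])
    (simp add: psi_add F_add W_char[OF assms] Bochner_Integration.integral_add[OF integrable_orbit[OF assms] integrable_orbit[OF assms]])

lemma W_scaleC:
  assumes "borel_finite \<mu>"
  shows "W \<mu> (c *\<^sub>C a) = c *\<^sub>C W \<mu> a"
  by (rule W_eqI[OF assms]) (simp add: psi_scaleC F_scaleC W_char[OF assms])

lemma bounded_linear_W:
  assumes "borel_finite \<mu>"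
  shows "bounded_linear (W \<mu>)"
  by (rule bounded_linear_intro[where K="M * measure \<mu> UNIV"])
    (simp_all add: W_add[OF assms] W_scaleC[OF assms] scaleR_scaleC mult.commute[of "norm _"] W_bound[OF assms])

lemma W_one:
  assumes "borel_finite \<mu>"
  shows "W \<mu> 1 = measure \<mu> UNIV *\<^sub>R 1"
  by (rule W_eqI[OF assms]) (simp add: psi_one F_scaleR borel_finiteD[OF assms])

lemma F_comp:
  assumes f: "f \<in> F" and "bounded_linear A" "\<And>c x. A (c *\<^sub>C x) = c *\<^sub>C A x"
    and "\<And>a. continuous_on UNIV (\<lambda>t. f (A (\<psi> t a)))"
  shows "(\<lambda>x. f (A x)) \<in> F"
  using assms F_scaleC[OF f] bounded_linear_compose[OF bounded_linear_F[OF f] assms(2)]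
  by (simp add: group_dual_def banach_dual_def)

lemma F_psi:
  assumes f: "f \<in> F"
  shows "(\<lambda>x. f (\<psi> s x)) \<in> F"
proof (rule F_comp[OF f bounded_linear_psi psi_scaleC])
  fix a
  have "(\<lambda>t. f (\<psi> s (\<psi> t a))) = (\<lambda>t. f (\<psi> t (\<psi> s a)))"
    by (simp add: psi_psi add.commute)
  then show "continuous_on UNIV (\<lambda>t. f (\<psi> s (\<psi> t a)))"
    using F_cont[OF f, of "\<psi> s a"] by (simp only:)
qed

lemma psi_W:
  assumes "borel_finite \<mu>"
  shows "\<psi> s (W \<mu> a) = W \<mu> (\<psi> s a)"
proof (rule W_eqI[OF assms, symmetric])
  fix f assume f: "f \<in> F"
  show "f (\<psi> s (W \<mu> a)) = (LINT t|\<mu>. f (\<psi> t (\<psi> s a)))"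
    using W_char[OF assms F_psi[OF f], of s a] by (simp add: psi_psi add.commute)
qed

text \<open>Dominated convergence in the averaging variable preserves weak continuity of orbits. It
  allows weak limits to be taken underneath an application of \<open>J\<close>.\<close>

lemma F_W:
  assumes \<mu>: "borel_finite \<mu>" and f: "f \<in> F"
  shows "(\<lambda>x. f (W \<mu> x)) \<in> F"
proof (rule F_comp[OF f bounded_linear_W[OF \<mu>] W_scaleC[OF \<mu>]])
  fix a
  interpret finite_measure \<mu> by (rule borel_finiteD[OF \<mu>])
  show "continuous_on UNIV (\<lambda>t. f (W \<mu> (\<psi> t a)))"
    unfolding continuous_on_sequentially comp_def
  proof safe
    fix x and t :: "real^'d"
    assume x: "x \<longlonglongrightarrow> t"
    have "(\<lambda>n. LINT s|\<mu>. f (\<psi> s (\<psi> (x n) a))) \<longlonglongrightarrow> (LINT s|\<mu>. f (\<psi> s (\<psi> t a)))"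
    proof (rule integral_dominated_convergence[where w="\<lambda>_. onorm f * (M * (M * norm a))"])
      have "(\<lambda>n. f (\<psi> (x n) (\<psi> s a))) \<longlonglongrightarrow> f (\<psi> t (\<psi> s a))" for s
        using F_cont[OF f, of "\<psi> s a"] x
        by (auto simp: continuous_on_sequentially comp_def)
      then show "AE s in \<mu>. (\<lambda>n. f (\<psi> s (\<psi> (x n) a))) \<longlonglongrightarrow> f (\<psi> s (\<psi> t a))"
        by (simp add: psi_psi add.commute)
      show "AE s in \<mu>. norm (f (\<psi> s (\<psi> (x n) a))) \<le> onorm f * (M * (M * norm a))" for n
        using F_onorm_nonneg[OF f] M_nonneg
        by (intro AE_I2 order_trans[OF F_psi_bound[OF f]] mult_left_mono norm_psi)
    qed (simp_all add: orbit_measurable[OF \<mu> f])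
    then show "(\<lambda>n. f (W \<mu> (\<psi> (x n) a))) \<longlonglongrightarrow> f (W \<mu> (\<psi> t a))"
      by (simp add: W_char[OF \<mu> f])
  qed
qed

lemma W_convolution:
  assumes \<mu>: "borel_finite \<mu>" and \<nu>: "borel_finite \<nu>"
  shows "W (\<mu> \<star> \<nu>) a = W \<mu> (W \<nu> a)"
proof (rule W_eqI[OF borel_finite_convolution[OF \<mu> \<nu>]])
  fix f assume f: "f \<in> F"
  have "f (W \<mu> (W \<nu> a)) = (LINT s|\<mu>. LINT t|\<nu>. f (\<psi> (s + t) a))"
    by (simp add: W_char[OF \<mu> f] W_char[OF \<nu> f] psi_W[OF \<nu>] psi_psi add.commute)
  also have "\<dots> = (LINT t|(\<mu> \<star> \<nu>). f (\<psi> t a))"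
    using F_measurable[OF f] F_psi_bound[OF f]
    by (intro integral_convolution[OF \<mu> \<nu>, symmetric])
  finally show "f (W \<mu> (W \<nu> a)) = (LINT t|(\<mu> \<star> \<nu>). f (\<psi> t a))" .
qed

text \<open>Orbits tested by \<open>f\<close> are bounded continuous functions, so
  \<open>fourier_unique\<close> turns a linear relation between transforms into the same relation
  between operators. This justifies the symbol calculus for \<open>J\<close>, \<open>L\<close> and
  \<open>R\<close>.\<close>

lemma W_fourier:
  assumes "finite I" and \<mu>: "\<And>i. i \<in> I \<Longrightarrow> borel_finite (\<mu> i)"
    and "\<And>w. (\<Sum>i\<in>I. c i * fourier (\<mu> i) w) = 0" and f: "f \<in> F"
  shows "(\<Sum>i\<in>I. c i * f (W (\<mu> i) a)) = 0"
proof -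
  have "(\<Sum>i\<in>I. LINT t|\<mu> i. c i * f (\<psi> t a)) = 0"
  proof (rule fourier_unique[where B="onorm f * (M * norm a)"])
    show "sigma_finite_measure (\<mu> i)" if "i \<in> I" for i
      using borel_finiteD(1)[OF \<mu>[OF that]] by (simp add: finite_measure_def)
    show "integrable (\<mu> i) (\<lambda>_. c i)" if "i \<in> I" for i
      using borel_finiteD(1)[OF \<mu>[OF that]] by (simp add: finite_measure.integrable_const)
    show "sets (\<mu> i) = sets borel" if "i \<in> I" for i
      using borel_finiteD(2)[OF \<mu>[OF that]] .
    show "(\<Sum>i\<in>I. LINT x|\<mu> i. c i * iexp (w \<bullet> x)) = 0" for w
      using assms(3)[of w] by (simp add: fourier_def)
  qed (use assms(1) F_cont[OF f] F_psi_bound[OF f] in auto)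
  then show ?thesis
    using \<mu> f by (simp add: W_char)
qed

lemma W_fourier_eq:
  assumes "borel_finite \<mu>" "borel_finite \<nu>" "\<And>w. fourier \<mu> w = fourier \<nu> w"
  shows "W \<mu> a = W \<nu> a"
proof (rule F_separates)
  fix f assume "f \<in> F"
  from W_fourier[of "UNIV :: bool set" "\<lambda>b. if b then \<mu> else \<nu>" "\<lambda>b. if b then 1 else - 1", OF _ _ _ this, of a]
  show "f (W \<mu> a) = f (W \<nu> a)"
    using assms by (simp add: UNIV_bool)
qed

lemma W_commute:
  assumes "borel_finite \<mu>" "borel_finite \<nu>"
  shows "W \<mu> (W \<nu> a) = W \<nu> (W \<mu> a)"
  using W_fourier_eq[of "\<mu> \<star> \<nu>" "\<nu> \<star> \<mu>" a] assms
  by (simp add: W_convolution borel_finite_convolution fourier_convolution mult.commute)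

section \<open>Hoelder elements and the product rule\<close>

text \<open>
  Multiplications on the Banach space \<open>'a\<close> with the unit \<open>1\<close> for which \<open>\<psi>\<close> still acts by
  automorphisms; the theorem for small orders is applied to them iteratively.
\<close>

definition algebra_mult :: "('a \<Rightarrow> 'a \<Rightarrow> 'a) \<Rightarrow> bool" where
  "algebra_mult m \<longleftrightarrow> bounded_bilinear m \<and>
     (\<forall>c x y. m (c *\<^sub>C x) y = c *\<^sub>C m x y \<and> m x (c *\<^sub>C y) = c *\<^sub>C m x y) \<and>
     (\<forall>x y z. m (m x y) z = m x (m y z)) \<and> (\<forall>x. m 1 x = x \<and> m x 1 = x) \<and>
     (\<forall>t x y. \<psi> t (m x y) = m (\<psi> t x) (\<psi> t y))"

lemma algebra_multD:
  assumes "algebra_mult m"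
  shows "bounded_bilinear m" "m (c *\<^sub>C x) y = c *\<^sub>C m x y" "m x (c *\<^sub>C y) = c *\<^sub>C m x y"
    "m (m x y) z = m x (m y z)" "m 1 x = x" "m x 1 = x" "\<psi> t (m x y) = m (\<psi> t x) (\<psi> t y)"
  using assms by (auto simp: algebra_mult_def)

lemma algebra_mult_times: "algebra_mult (*)"
proof -
  obtain K where "\<And>x y :: 'a. norm (x * y) \<le> K * norm x * norm y"
    using norm_mult_bounded by blast
  then have "bounded_bilinear ((*) :: 'a \<Rightarrow> 'a \<Rightarrow> 'a)"
    by (intro bounded_bilinear.intro exI[of _ K])
      (simp_all add: distrib_left distrib_right scaleR_scaleC mult_scaleC_left mult_scaleC_right ac_simps)
  then show ?thesis
    by (simp add: algebra_mult_def mult_scaleC_left mult_scaleC_right mult.assoc psi_mult)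
qed

text \<open>The estimate refers to the starting point of the orbit only; the group law and the
  uniform bound \<open>M\<close> carry it to every other point.\<close>

definition holder :: "real \<Rightarrow> real \<Rightarrow> 'a \<Rightarrow> bool" where
  "holder \<theta> C x \<longleftrightarrow> (\<forall>t. norm (\<psi> t x - x) \<le> C * norm t powr \<theta>)"

lemma continuous_on_orbit:
  assumes "holder \<theta> C x" "\<theta> > 0"
  shows "continuous_on UNIV (\<lambda>t. \<psi> t x)"
  unfolding continuous_on_sequentially comp_def
proof safe
  fix X and t :: "real^'d"
  assume X: "X \<longlonglongrightarrow> t"
  have bound: "norm (\<psi> (X n) x - \<psi> t x) \<le> M * (C * norm (X n - t) powr \<theta>)" for n
  proof -
    have "\<psi> (X n) x - \<psi> t x = \<psi> t (\<psi> (X n - t) x - x)"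
      by (simp add: psi_diff psi_psi)
    also have "norm \<dots> \<le> M * norm (\<psi> (X n - t) x - x)"
      by (rule norm_psi)
    also have "\<dots> \<le> M * (C * norm (X n - t) powr \<theta>)"
      using assms(1) M_nonneg by (intro mult_left_mono) (auto simp: holder_def)
    finally show ?thesis .
  qed
  have "(\<lambda>n. norm (X n - t) powr \<theta>) \<longlonglongrightarrow> 0"
    by (rule tendsto_norm_powr_zero[OF LIM_zero[OF X] assms(2)])
  then have "(\<lambda>n. M * (C * norm (X n - t) powr \<theta>)) \<longlonglongrightarrow> 0"
    by (intro tendsto_mult_right_zero)
  then have "(\<lambda>n. \<psi> (X n) x - \<psi> t x) \<longlonglongrightarrow> 0"
    by (rule Lim_null_comparison[rotated]) (simp add: bound)
  then show "(\<lambda>n. \<psi> (X n) x) \<longlonglongrightarrow> \<psi> t x"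
    by (rule LIM_zero_cancel)
qed

text \<open>The change of \<open>h\<close> is estimated in norm, uniformly in \<open>t\<close> by
  \<open>F_psi_bound\<close>; what remains is an orbit of a fixed element, which \<open>f\<close>
  sees continuously.\<close>

lemma continuous_on_F_orbit:
  assumes f: "f \<in> F" and h: "continuous_on UNIV h"
  shows "continuous_on UNIV (\<lambda>t. f (\<psi> t (h t)))"
  unfolding continuous_on_sequentially comp_def
proof safe
  fix X and t :: "real^'d"
  assume X: "X \<longlonglongrightarrow> t"
  have "(\<lambda>n. h (X n)) \<longlonglongrightarrow> h t"
    using h X by (auto simp: continuous_on_sequentially comp_def)
  then have "(\<lambda>n. onorm f * (M * norm (h (X n) - h t))) \<longlonglongrightarrow> 0"
    by (intro tendsto_mult_right_zero tendsto_norm_zero) (simp add: LIM_zero)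
  then have "(\<lambda>n. f (\<psi> (X n) (h (X n) - h t))) \<longlonglongrightarrow> 0"
    by (rule Lim_null_comparison[rotated]) (simp add: F_psi_bound[OF f])
  moreover have "(\<lambda>n. f (\<psi> (X n) (h t))) \<longlonglongrightarrow> f (\<psi> t (h t))"
    using F_cont[OF f, of "h t"] X by (auto simp: continuous_on_sequentially comp_def)
  ultimately have "(\<lambda>n. f (\<psi> (X n) (h (X n) - h t)) + f (\<psi> (X n) (h t))) \<longlonglongrightarrow> 0 + f (\<psi> t (h t))"
    by (rule tendsto_add)
  then show "(\<lambda>n. f (\<psi> (X n) (h (X n)))) \<longlonglongrightarrow> f (\<psi> t (h t))"
    by (simp add: psi_diff F_diff[OF f])
qed

text \<open>The fixed factor is moved inside the action: \<psi>_t(a) y = \<psi>_t(a \<psi>_(-t)(y)).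
  The argument now moves continuously in norm, so \<open>continuous_on_F_orbit\<close>
  applies.\<close>

lemma F_mult:
  assumes m: "algebra_mult m" and y: "continuous_on UNIV (\<lambda>t. \<psi> t y)" and f: "f \<in> F"
  shows "(\<lambda>x. f (m x y)) \<in> F" "(\<lambda>x. f (m y x)) \<in> F"
proof -
  interpret bounded_bilinear m by (rule algebra_multD[OF m])
  have y': "continuous_on UNIV (\<lambda>t. \<psi> (- t) y)"
    by (rule continuous_on_compose2[OF y]) (auto intro: continuous_intros)
  show "(\<lambda>x. f (m x y)) \<in> F"
  proof (rule F_comp[OF f bounded_linear_left algebra_multD(2)[OF m]])
    fix a
    have "(\<lambda>t. f (m (\<psi> t a) y)) = (\<lambda>t. f (\<psi> t (m a (\<psi> (- t) y))))"
      by (simp add: algebra_multD(7)[OF m] psi_psi)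
    moreover have "continuous_on UNIV (\<lambda>t. f (\<psi> t (m a (\<psi> (- t) y))))"
      by (intro continuous_on_F_orbit[OF f] continuous_on y' continuous_on_const)
    ultimately show "continuous_on UNIV (\<lambda>t. f (m (\<psi> t a) y))"
      by (simp only:)
  qed
  show "(\<lambda>x. f (m y x)) \<in> F"
  proof (rule F_comp[OF f bounded_linear_right algebra_multD(3)[OF m]])
    fix a
    have "(\<lambda>t. f (m y (\<psi> t a))) = (\<lambda>t. f (\<psi> t (m (\<psi> (- t) y) a)))"
      by (simp add: algebra_multD(7)[OF m] psi_psi)
    moreover have "continuous_on UNIV (\<lambda>t. f (\<psi> t (m (\<psi> (- t) y) a)))"
      by (intro continuous_on_F_orbit[OF f] continuous_on y' continuous_on_const)
    ultimately show "continuous_on UNIV (\<lambda>t. f (m y (\<psi> t a)))"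
      by (simp only:)
  qed
qed

lemma W_subord:
  assumes N: "borel_finite N" and f: "f \<in> F"
  shows "f (W (subord N) a) = (LINT s|N. LINT z|gauss. f (\<psi> (sqrt (2 * s) *\<^sub>R z) a))"
  using borel_finiteD[OF N] F_measurable[OF f] F_psi_bound[OF f]
  by (subst W_char[OF borel_finite_subord[OF N] f]) (intro integral_subord(1))

text \<open>At time \<open>s\<close> a translation by \<tau> is a shift of the standard Gaussian by
  \<tau> / sqrt(2s), costing |\<tau>|^\<theta> (2s)^(-\<theta>/2); averaging over the Gamma law is
  finite because \<theta>/2 < \<alpha>.\<close>

lemma holder_bessel:
  assumes \<theta>: "0 < \<theta>" "\<theta> \<le> 1" "\<theta> < 2 * \<alpha>"
  shows "\<exists>C\<ge>0. \<forall>u. holder \<theta> (C * norm u) (W (bessel_measure \<alpha>) u)"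
proof -
  have \<alpha>: "\<alpha> > 0" using \<theta> by simp
  define I where "I = (LINT s|gamma_measure \<alpha>. (2 * s) powr (- (\<theta> / 2)))"
  have int_I: "integrable (gamma_measure \<alpha>) (\<lambda>s. (2 * s) powr (- (\<theta> / 2)))"
    using \<theta> by (intro integrable_gamma_powr) auto
  have I: "I \<ge> 0" unfolding I_def by (intro integral_nonneg_AE) auto
  note fin = borel_finite_gamma[OF \<alpha>]
  note fin_b = borel_finite_bessel[OF \<alpha>]
  have "holder \<theta> (2 * M * I * norm u) (W (bessel_measure \<alpha>) u)" for u
    unfolding holder_def
  proof (intro allI norm_leI_F)
    fix \<tau> :: "real^'d" and f assume f: "f \<in> F"
    define h where "h x = f (\<psi> x u)" for x
    define B where "B = onorm f * (M * norm u)"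
    have B: "B \<ge> 0" unfolding B_def using F_onorm_nonneg[OF f] M_nonneg by simp
    have h_meas [measurable]: "h \<in> borel_measurable borel"
      unfolding h_def using F_measurable[OF f] .
    have h_bdd: "norm (h x) \<le> B" for x
      unfolding h_def B_def using F_psi_bound[OF f] .
    let ?D = "\<lambda>s. (LINT z|gauss. h (sqrt (2 * s) *\<^sub>R z + \<tau>)) - (LINT z|gauss. h (sqrt (2 * s) *\<^sub>R z))"
    have i1: "integrable (gamma_measure \<alpha>) (\<lambda>s. LINT z|gauss. h (sqrt (2 * s) *\<^sub>R z + \<tau>))"
      using integral_subord(2)[OF borel_finiteD(1,2)[OF fin], of "\<lambda>x. h (x + \<tau>)" B] h_bdd by simp
    have i2: "integrable (gamma_measure \<alpha>) (\<lambda>s. LINT z|gauss. h (sqrt (2 * s) *\<^sub>R z))"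
      using integral_subord(2)[OF borel_finiteD(1,2)[OF fin], of h B] h_bdd by simp
    have "f (\<psi> \<tau> (W (bessel_measure \<alpha>) u) - W (bessel_measure \<alpha>) u) = (LINT s|gamma_measure \<alpha>. ?D s)"
      using i1 i2 unfolding bessel_measure_def
      by (simp add: F_diff[OF f] psi_W[OF borel_finite_subord[OF fin]] W_subord[OF fin f] psi_psi h_def)
    also have "norm \<dots> \<le> (LINT s|gamma_measure \<alpha>. B * (2 * (norm \<tau> powr \<theta> * (2 * s) powr (- (\<theta> / 2)))))"
    proof (rule order_trans[OF integral_norm_bound integral_mono_AE])
      show "AE s in gamma_measure \<alpha>. norm (?D s) \<le> B * (2 * (norm \<tau> powr \<theta> * (2 * s) powr (- (\<theta> / 2))))"
        using AE_gamma[OF \<alpha>]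
      proof eventually_elim
        case (elim s)
        define v where "v = (1 / sqrt (2 * s)) *\<^sub>R \<tau>"
        have "norm ((LINT z|gauss. h (sqrt (2 * s) *\<^sub>R (z + v))) - (LINT z|gauss. h (sqrt (2 * s) *\<^sub>R z))) \<le> B * (2 * norm v powr \<theta>)"
          by (rule gauss_shift_bound) (use h_bdd \<theta> in auto)
        moreover have "sqrt (2 * s) *\<^sub>R (z + v) = sqrt (2 * s) *\<^sub>R z + \<tau>" for z
          using elim by (simp add: v_def scaleR_add_right)
        moreover have "norm v powr \<theta> = norm \<tau> powr \<theta> * (2 * s) powr (- (\<theta> / 2))"
        proof -
          have "norm v = norm \<tau> * (2 * s) powr (- (1 / 2))"
          proof -
            have "(2 * s) powr (- (1 / 2)) = 1 / sqrt (2 * s)"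
              using elim by (subst powr_minus, subst powr_half_sqrt) (simp, rule inverse_eq_divide)
            then show ?thesis
              using elim by (simp add: v_def)
          qed
          then show ?thesis
            using elim by (simp add: powr_mult powr_powr)
        qed
        ultimately show ?case by simp
      qed
    qed (intro integrable_norm Bochner_Integration.integrable_diff i1 i2 integrable_mult_right int_I)+
    also have "\<dots> = B * (2 * (norm \<tau> powr \<theta> * I))"
      by (simp only: integral_mult_right_zero I_def)
    also have "\<dots> = onorm f * (2 * M * I * norm u * norm \<tau> powr \<theta>)"
      by (simp add: B_def)
    finally show "norm (f (\<psi> \<tau> (W (bessel_measure \<alpha>) u) - W (bessel_measure \<alpha>) u)) \<le> onorm f * (2 * M * I * norm u * norm \<tau> powr \<theta>)" .
  qed (use M_nonneg I in simp)
  then show ?thesis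
    using M_nonneg I by (intro exI[of _ "2 * M * I"]) simp
qed

text \<open>The integrand \<open>G\<close> depends on the functional, but its majorant is
  \<open>onorm f\<close> times one common \<open>g\<close>. Hence the scalar estimates combine to
  convergence in norm, although no vector-valued integrand is available.\<close>

lemma tail_limit:
  fixes X :: "real \<Rightarrow> 'a" and g :: "real \<Rightarrow> real"
  assumes g: "integrable lborel g" "\<And>s. g s \<ge> 0"
    and X: "\<And>f. f \<in> F \<Longrightarrow> \<exists>G. G \<in> borel_measurable borel \<and> (\<forall>s\<ge>0. norm (G s) \<le> onorm f * g s) \<and>
        (\<forall>\<epsilon>>0. f (X \<epsilon>) = (LINT s|lborel. indicator {\<epsilon>..} s *\<^sub>R G s))"
    and \<epsilon>: "\<And>n. \<epsilon> n > 0" "\<epsilon> \<longlonglongrightarrow> 0"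
  shows "\<exists>I. (\<lambda>n. X (\<epsilon> n)) \<longlonglongrightarrow> I \<and> norm I \<le> (LINT s|lborel. g s)"
proof -
  have [measurable]: "g \<in> borel_measurable borel" using g(1) by auto
  \<comment> \<open>The increments of this scalar tail integral dominate those of \<open>X\<close>
    in norm, and it converges along the sequence of truncations.\<close>
  define b where "b e = (LINT s|lborel. indicator {e..} s * g s)" for e :: real
  have int_g: "integrable lborel (\<lambda>s. indicator A s * g s)" if "A \<in> sets borel" for A
    using integrable_mult_indicator[OF _ g(1), of A] that by simp
  have int_G: "integrable lborel (\<lambda>s. indicator {e..} s *\<^sub>R G s)"
    if "G \<in> borel_measurable borel" "\<forall>s\<ge>0. norm (G s) \<le> c * g s" "e > 0"
    for e c and G :: "real \<Rightarrow> complex"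
  proof (rule Bochner_Integration.integrable_bound[OF integrable_mult_right[OF g(1), of c]])
    have [measurable]: "G \<in> borel_measurable borel" by fact
    show "(\<lambda>s. indicator {e..} s *\<^sub>R G s) \<in> borel_measurable lborel" by measurable
    show "AE s in lborel. norm (indicator {e..} s *\<^sub>R G s) \<le> norm (c * g s)"
    proof (rule AE_I2)
      fix s
      show "norm (indicator {e..} s *\<^sub>R G s) \<le> norm (c * g s)"
      proof (cases "s \<ge> e")
        case True
        then have "norm (G s) \<le> c * g s" using that(2,3) by auto
        then show ?thesis using True abs_ge_self[of "c * g s"] by simp
      qed simp
    qed
  qed
  have diff: "norm (X e' - X e) \<le> b e' - b e" if e: "0 < e'" "e' \<le> e" for e e'
  proof (rule norm_leI_F)
    have b: "b e' - b e = (LINT s|lborel. indicator {e'..<e} s * g s)"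
    proof -
      have "b e' - b e = (LINT s|lborel. indicator {e'..} s * g s - indicator {e..} s * g s)"
        unfolding b_def by (rule Bochner_Integration.integral_diff[symmetric]) (rule int_g, simp)+
      also have "\<dots> = (LINT s|lborel. indicator {e'..<e} s * g s)"
        using e by (intro Bochner_Integration.integral_cong) (auto simp: indicator_def)
      finally show ?thesis .
    qed
    then show "0 \<le> b e' - b e"
      using g(2) by (auto intro!: integral_nonneg_AE)
    fix f assume f: "f \<in> F"
    obtain G where G [measurable]: "G \<in> borel_measurable borel" and Gb: "\<forall>s\<ge>0. norm (G s) \<le> onorm f * g s"
      and fX: "\<And>\<epsilon>. \<epsilon> > 0 \<Longrightarrow> f (X \<epsilon>) = (LINT s|lborel. indicator {\<epsilon>..} s *\<^sub>R G s)"
      using X[OF f] by blast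
    have ii: "integrable lborel (\<lambda>s. indicator {e'..} s *\<^sub>R G s)" "integrable lborel (\<lambda>s. indicator {e..} s *\<^sub>R G s)"
      using e by (auto intro!: int_G[OF G Gb])
    have "f (X e' - X e) = (LINT s|lborel. indicator {e'..} s *\<^sub>R G s - indicator {e..} s *\<^sub>R G s)"
      using e ii by (simp add: F_diff[OF f] fX)
    also have "norm \<dots> \<le> (LINT s|lborel. onorm f * (indicator {e'..<e} s * g s))"
    proof (rule order_trans[OF integral_norm_bound integral_mono])
      show "norm (indicator {e'..} s *\<^sub>R G s - indicator {e..} s *\<^sub>R G s) \<le> onorm f * (indicator {e'..<e} s * g s)" for s
        using Gb e by (auto simp: indicator_def)
    qed (intro integrable_norm Bochner_Integration.integrable_diff ii, intro integrable_mult_right int_g, simp)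
    also have "\<dots> = onorm f * (b e' - b e)"
      by (simp only: integral_mult_right_zero b)
    finally show "norm (f (X e' - X e)) \<le> onorm f * (b e' - b e)" .
  qed
  have bound: "norm (X e) \<le> (LINT s|lborel. g s)" if e: "e > 0" for e
  proof (rule norm_leI_F)
    fix f assume f: "f \<in> F"
    obtain G where G [measurable]: "G \<in> borel_measurable borel" and Gb: "\<forall>s\<ge>0. norm (G s) \<le> onorm f * g s"
      and fX: "\<And>\<epsilon>. \<epsilon> > 0 \<Longrightarrow> f (X \<epsilon>) = (LINT s|lborel. indicator {\<epsilon>..} s *\<^sub>R G s)"
      using X[OF f] by blast
    have "norm (f (X e)) \<le> (LINT s|lborel. onorm f * g s)"
      unfolding fX[OF e]
    proof (rule order_trans[OF integral_norm_bound integral_mono])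
      show "norm (indicator {e..} s *\<^sub>R G s) \<le> onorm f * g s" for s
        using Gb e F_onorm_nonneg[OF f] g(2)[of s] by (auto simp: indicator_def)
    qed (intro integrable_norm int_G[OF G Gb e], intro integrable_mult_right g)
    then show "norm (f (X e)) \<le> onorm f * (LINT s|lborel. g s)"
      by simp
  qed (use g in \<open>auto intro!: integral_nonneg_AE\<close>)
  have "(\<lambda>n. b (\<epsilon> n)) \<longlonglongrightarrow> (LINT s|lborel. indicator {0<..} s * g s)"
    unfolding b_def
  proof (rule integral_dominated_convergence[where w=g])
    show "AE s in lborel. (\<lambda>n. indicator {\<epsilon> n..} s * g s) \<longlonglongrightarrow> indicator {0<..} s * g s"
    proof (rule AE_I2, rule tendsto_eventually)
      fix s :: real
      show "\<forall>\<^sub>F n in sequentially. indicator {\<epsilon> n..} s * g s = indicator {0<..} s * g s"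
      proof (cases "s > 0")
        case True
        then have "\<forall>\<^sub>F n in sequentially. \<epsilon> n < s"
          using order_tendstoD(2)[OF \<epsilon>(2)] by blast
        then show ?thesis by eventually_elim (use True in simp)
      next
        case False
        then have "\<not> \<epsilon> n \<le> s" for n using \<epsilon>(1)[of n] by linarith
        then show ?thesis using False by simp
      qed
    qed
    show "AE s in lborel. norm (indicator {\<epsilon> n..} s * g s) \<le> g s" for n
      using g(2) by (intro AE_I2) (simp add: indicator_def)
  qed (use g in auto)
  then have "Cauchy (\<lambda>n. b (\<epsilon> n))"
    by (rule LIMSEQ_imp_Cauchy)
  have *: "norm (X (\<epsilon> k) - X (\<epsilon> n)) \<le> norm (b (\<epsilon> k) - b (\<epsilon> n))" for k n
  proof (cases "\<epsilon> k \<le> \<epsilon> n")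
    case True
    show ?thesis
      unfolding real_norm_def by (rule order_trans[OF diff[OF \<epsilon>(1) True] abs_ge_self])
  next
    case False
    then have "norm (X (\<epsilon> n) - X (\<epsilon> k)) \<le> b (\<epsilon> n) - b (\<epsilon> k)"
      using diff[OF \<epsilon>(1)] by simp
    then show ?thesis by (simp add: norm_minus_commute)
  qed
  have "Cauchy (\<lambda>n. X (\<epsilon> n))"
  proof (rule CauchyI)
    fix e :: real assume "e > 0"
    from CauchyD[OF \<open>Cauchy (\<lambda>n. b (\<epsilon> n))\<close> this]
    obtain N where "\<And>k n. k \<ge> N \<Longrightarrow> n \<ge> N \<Longrightarrow> norm (b (\<epsilon> k) - b (\<epsilon> n)) < e"
      by blast
    then show "\<exists>N. \<forall>k\<ge>N. \<forall>n\<ge>N. norm (X (\<epsilon> k) - X (\<epsilon> n)) < e"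
      by (intro exI[of _ N] allI impI le_less_trans[OF *])
  qed
  then obtain I where I: "(\<lambda>n. X (\<epsilon> n)) \<longlonglongrightarrow> I"
    by (auto simp: Cauchy_convergent_iff convergent_def)
  moreover have "norm I \<le> (LINT s|lborel. g s)"
    by (rule LIMSEQ_le_const2[OF tendsto_norm[OF I]]) (use bound \<epsilon> in auto)
  ultimately show ?thesis by blast
qed

definition V :: "real \<Rightarrow> real \<Rightarrow> 'a \<Rightarrow> 'a" where
  "V \<alpha> \<epsilon> = W (subord (tail_measure \<alpha> \<epsilon>))"

text \<open>Expanded form of L(x) y + x L(y) - L(x y): the defect of the truncated fractional power
  from being a derivation, in analogy with a carre du champ.\<close>

definition remainder :: "('a \<Rightarrow> 'a \<Rightarrow> 'a) \<Rightarrow> real \<Rightarrow> 'a \<Rightarrow> 'a \<Rightarrow> real \<Rightarrow> 'a" where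
  "remainder m \<alpha> x y \<epsilon> = V \<alpha> \<epsilon> (m x y) - m (V \<alpha> \<epsilon> x) y - m x (V \<alpha> \<epsilon> y) + (\<epsilon> powr (- \<alpha>) / \<alpha>) *\<^sub>R m x y"

text \<open>
  The product rule \<open>\<psi> (xy) - \<psi> x y - x \<psi> y + x y = (\<psi> x - x) (\<psi> y - y)\<close> turns the remainder
  into an integral that converges absolutely at \<open>s = 0\<close>.
\<close>

lemma F_remainder:
  assumes m: "algebra_mult m" and \<alpha>: "0 < \<alpha>" "\<alpha> < 1" and \<theta>: "0 < \<theta>"
    and x: "holder \<theta> Cx x" and y: "holder \<theta> Cy y" and f: "f \<in> F" and \<epsilon>: "\<epsilon> > 0"
  shows "f (remainder m \<alpha> x y \<epsilon>) = (LINT s|lborel. indicator {\<epsilon>..} s *\<^sub>R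
      ((s powr (- 1 - \<alpha>) * exp (- s)) *\<^sub>R (LINT z|gauss. f (m (\<psi> (sqrt (2 * s) *\<^sub>R z) x - x) (\<psi> (sqrt (2 * s) *\<^sub>R z) y - y)))
      + (s powr (- 1 - \<alpha>) * (1 - exp (- s))) *\<^sub>R f (m x y)))"
proof -
  interpret bounded_bilinear m by (rule algebra_multD[OF m])
  obtain K where K: "K \<ge> 0" "\<And>a b. norm (m a b) \<le> norm a * norm b * K"
    using nonneg_bounded by blast
  note tail = borel_finite_tail[OF \<alpha>(1) \<epsilon>]
  let ?N = "tail_measure \<alpha> \<epsilon>"
  define cont where "cont h \<longleftrightarrow> continuous_on UNIV h \<and> (\<exists>B. \<forall>t. norm (h t) \<le> B)" for h :: "real^'d \<Rightarrow> complex"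
  have cx: "continuous_on UNIV (\<lambda>t. \<psi> t x)" and cy: "continuous_on UNIV (\<lambda>t. \<psi> t y)"
    using continuous_on_orbit[OF x \<theta>] continuous_on_orbit[OF y \<theta>] .
  define k where "k t = f (m (\<psi> t x - x) (\<psi> t y - y))" for t
  have k: "k t = f (\<psi> t (m x y)) - f (m (\<psi> t x) y) - f (m x (\<psi> t y)) + f (m x y)" for t
    by (simp add: k_def diff_left diff_right F_diff[OF f] algebra_multD(7)[OF m])
  note F1 = F_mult(1)[OF m cy f] and F2 = F_mult(2)[OF m cx f]
  have meas_k: "k \<in> borel_measurable borel"
    using F_measurable[OF f] F_measurable[OF F1] F_measurable[OF F2] unfolding k[abs_def]
    by (intro borel_measurable_diff borel_measurable_add borel_measurable_const)
  define S :: "(real^'d) measure" where "S = subord ?N"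
  have S: "borel_finite S"
    unfolding S_def by (rule borel_finite_subord[OF tail])
  interpret S: finite_measure S
    by (rule borel_finiteD[OF S])
  have i1: "integrable S (\<lambda>t. f (\<psi> t (m x y)))" and i2: "integrable S (\<lambda>t. f (m (\<psi> t x) y))"
    and i3: "integrable S (\<lambda>t. f (m x (\<psi> t y)))"
    by (rule integrable_orbit[OF S f] integrable_orbit[OF S F1] integrable_orbit[OF S F2])+
  have "(LINT t|S. k t) = (LINT t|S. f (\<psi> t (m x y))) - (LINT t|S. f (m (\<psi> t x) y)) - (LINT t|S. f (m x (\<psi> t y))) + measure S UNIV * f (m x y)"
    unfolding k using i1 i2 i3 by (simp add: borel_finiteD(3)[OF S] scaleR_conv_of_real)
  also have "measure S UNIV = (LINT s|lborel. indicator {\<epsilon>..} s * s powr (- 1 - \<alpha>) * exp (- s))"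
  proof -
    have "complex_of_real (measure S UNIV) = fourier S 0"
      by (simp add: fourier_def borel_finiteD(3)[OF S] scaleR_conv_of_real)
    also have "\<dots> = of_real (LINT s|?N. exp (- s * (norm (0::real^'d))\<^sup>2))"
      unfolding fourier_def S_def using borel_finiteD(1,2)[OF tail] AE_tail[OF \<alpha>(1) \<epsilon>] by (rule fourier_subord)
    also have "\<dots> = of_real (LINT s|lborel. indicator {\<epsilon>..} s * s powr (- 1 - \<alpha>) * exp (- s))"
      unfolding laplace_tail[OF \<alpha>(1) \<epsilon>] by simp
    finally show ?thesis by (simp only: of_real_eq_iff)
  qed
  \<comment> \<open>The coefficient of \<open>f (m x y)\<close> is a difference of two terms that
    both blow up as \<epsilon> tends to 0; \<open>I2\<close> recombines them into the integral of
    s^(-1-\<alpha>) (1 - exp(-s)), which converges at 0.\<close>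
  finally have fI: "f (remainder m \<alpha> x y \<epsilon>) = (LINT t|S. k t) +
      (\<epsilon> powr (- \<alpha>) / \<alpha> - (LINT s|lborel. indicator {\<epsilon>..} s * s powr (- 1 - \<alpha>) * exp (- s))) *\<^sub>R f (m x y)"
    using W_char[OF S f, of "m x y"] W_char[OF S F1, of x] W_char[OF S F2, of y]
    by (simp add: remainder_def V_def S_def[symmetric] F_add[OF f] F_diff[OF f] F_scaleR[OF f] scaleR_conv_of_real algebra_simps)
  define E where "E s = (LINT z|gauss. k (sqrt (2 * s) *\<^sub>R z))" for s
  have k_bdd: "norm (k t) \<le> onorm f * (((M + 1) * norm x) * ((M + 1) * norm y) * K)" for t
  proof -
    have d: "norm (\<psi> t a - a) \<le> (M + 1) * norm a" for a
      using norm_triangle_ineq4[of "\<psi> t a" a] norm_psi[of t a] by (simp add: algebra_simps)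
    have "norm (k t) \<le> onorm f * norm (m (\<psi> t x - x) (\<psi> t y - y))"
      unfolding k_def by (rule F_bound[OF f])
    also have "\<dots> \<le> onorm f * (norm (\<psi> t x - x) * norm (\<psi> t y - y) * K)"
      by (intro mult_left_mono K F_onorm_nonneg[OF f])
    also have "\<dots> \<le> onorm f * (((M + 1) * norm x) * ((M + 1) * norm y) * K)"
      using M_nonneg by (intro mult_left_mono mult_right_mono mult_mono d K F_onorm_nonneg[OF f] mult_nonneg_nonneg) auto
    finally show ?thesis .
  qed
  have E_meas [measurable]: "E \<in> borel_measurable borel"
    unfolding E_def using meas_k by measurable
  have E_int: "integrable ?N E" and kE: "(LINT t|S. k t) = (LINT s|?N. E s)"
    unfolding S_def E_def
    using integral_subord[OF borel_finiteD(1,2)[OF tail] meas_k k_bdd] by simp_all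
  have I1: "integrable lborel (\<lambda>s. (indicator {\<epsilon>..} s * s powr (- 1 - \<alpha>) * exp (- s)) *\<^sub>R E s)"
    using E_int unfolding tail_measure_def by (subst (asm) integrable_density) auto
  have "(LINT s|?N. E s) = (LINT s|lborel. (indicator {\<epsilon>..} s * s powr (- 1 - \<alpha>) * exp (- s)) *\<^sub>R E s)"
    unfolding tail_measure_def by (rule integral_density_real[OF tail_density_integrable[OF \<alpha>(1) \<epsilon>]]) auto
  moreover have I2: "has_bochner_integral lborel (\<lambda>s. indicator {\<epsilon>..} s * s powr (- 1 - \<alpha>) - indicator {\<epsilon>..} s * s powr (- 1 - \<alpha>) * exp (- s))
     (\<epsilon> powr (- \<alpha>) / \<alpha> - (LINT s|lborel. indicator {\<epsilon>..} s * s powr (- 1 - \<alpha>) * exp (- s)))"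
    by (intro has_bochner_integral_diff has_bochner_integral_powr_tail \<alpha> \<epsilon> has_bochner_integral_integrable tail_density_integrable)
  ultimately have "f (remainder m \<alpha> x y \<epsilon>) = (LINT s|lborel. (indicator {\<epsilon>..} s * s powr (- 1 - \<alpha>) * exp (- s)) *\<^sub>R E s)
     + (LINT s|lborel. (indicator {\<epsilon>..} s * s powr (- 1 - \<alpha>) - indicator {\<epsilon>..} s * s powr (- 1 - \<alpha>) * exp (- s)) *\<^sub>R f (m x y))"
    unfolding fI kE using integrable.intros[OF I2]
    by (subst integral_scaleR_left) (simp_all only: has_bochner_integral_integral_eq[OF I2])
  also have "\<dots> = (LINT s|lborel. (indicator {\<epsilon>..} s * s powr (- 1 - \<alpha>) * exp (- s)) *\<^sub>R E s
     + (indicator {\<epsilon>..} s * s powr (- 1 - \<alpha>) - indicator {\<epsilon>..} s * s powr (- 1 - \<alpha>) * exp (- s)) *\<^sub>R f (m x y))"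
    using integrable.intros[OF I2] by (intro Bochner_Integration.integral_add[symmetric] I1 integrable_scaleR_left)
  also have "\<dots> = (LINT s|lborel. indicator {\<epsilon>..} s *\<^sub>R ((s powr (- 1 - \<alpha>) * exp (- s)) *\<^sub>R E s
      + (s powr (- 1 - \<alpha>) * (1 - exp (- s))) *\<^sub>R f (m x y)))"
    by (intro Bochner_Integration.integral_cong refl) (simp add: algebra_simps)
  finally show ?thesis
    unfolding E_def k_def .
qed

text \<open>The two increments together contribute |sqrt(2s) z|^(2\<theta>), a power s^\<theta>
  against the weight s^(-1-\<alpha>), which is integrable at 0 since \<theta> > \<alpha>. The
  constant \<open>A\<close> does not depend on \<open>x\<close> and \<open>y\<close>, so it can
  later bound a multiplication.\<close>

lemma remainder_converges:
  assumes m: "algebra_mult m" and \<alpha>: "0 < \<alpha>" "\<alpha> < 1" and \<theta>: "\<alpha> < \<theta>" "\<theta> \<le> 1"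
    and \<epsilon>: "\<And>n. \<epsilon> n > 0" "\<epsilon> \<longlonglongrightarrow> 0"
  shows "\<exists>A\<ge>0. \<forall>x y Cx Cy. holder \<theta> Cx x \<longrightarrow> holder \<theta> Cy y \<longrightarrow> Cx \<ge> 0 \<longrightarrow> Cy \<ge> 0 \<longrightarrow>
    (\<exists>I. (\<lambda>n. remainder m \<alpha> x y (\<epsilon> n)) \<longlonglongrightarrow> I \<and> norm I \<le> A * (Cx * Cy + norm x * norm y))"
proof -
  interpret bounded_bilinear m by (rule algebra_multD[OF m])
  obtain K where K: "K \<ge> 0" "\<And>a b. norm (m a b) \<le> norm a * norm b * K"
    using nonneg_bounded by blast
  define \<mu> where "\<mu> = (LINT z|gauss. norm (z :: real^'d) powr (2 * \<theta>))"
  have \<mu>_int: "integrable gauss (\<lambda>z :: real^'d. norm z powr (2 * \<theta>))"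
    using \<theta> \<alpha> by (intro integrable_gauss_norm_powr) auto
  have \<mu>: "\<mu> \<ge> 0" unfolding \<mu>_def by (intro integral_nonneg_AE) auto
  let ?g1 = "\<lambda>s. indicator {0..} s * s powr ((\<theta> - \<alpha>) - 1) * exp (- (1 * s)) :: real"
  let ?g2 = "\<lambda>s. indicator {0..} s * s powr (- 1 - \<alpha>) * (1 - exp (- s)) :: real"
  have g1: "integrable lborel ?g1"
    using has_bochner_integral_Gamma[of "\<theta> - \<alpha>" 1] \<theta> by (auto simp: has_bochner_integral_iff)
  have g2: "integrable lborel ?g2"
    by (rule integrable_powr_one_minus_exp[OF \<alpha>])
  have g1_nn: "?g1 s \<ge> 0" and g2_nn: "?g2 s \<ge> 0" for s
    by (auto simp: indicator_def)
  define A where "A = K * (\<mu> * 2 powr \<theta>) * (LINT s|lborel. ?g1 s) + K * (LINT s|lborel. ?g2 s)"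
  have A1: "K * (\<mu> * 2 powr \<theta>) * (LINT s|lborel. ?g1 s) \<ge> 0" and A2: "K * (LINT s|lborel. ?g2 s) \<ge> 0"
    using K \<mu> g1_nn g2_nn by (auto intro!: mult_nonneg_nonneg integral_nonneg_AE)
  have "\<exists>I. (\<lambda>n. remainder m \<alpha> x y (\<epsilon> n)) \<longlonglongrightarrow> I \<and> norm I \<le> A * (Cx * Cy + norm x * norm y)"
    if x: "holder \<theta> Cx x" and y: "holder \<theta> Cy y" and C: "Cx \<ge> 0" "Cy \<ge> 0" for x y Cx Cy
  proof -
    have \<theta>0: "\<theta> > 0" using \<theta> \<alpha> by simp
    define P where "P = Cx * Cy * K * (\<mu> * 2 powr \<theta>)"
    define Q where "Q = K * norm x * norm y"
    have PQ: "P \<ge> 0" "Q \<ge> 0" using C K \<mu> by (auto simp: P_def Q_def)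
    let ?g = "\<lambda>s. P * ?g1 s + Q * ?g2 s"
    have "\<exists>I. (\<lambda>n. remainder m \<alpha> x y (\<epsilon> n)) \<longlonglongrightarrow> I \<and> norm I \<le> (LINT s|lborel. ?g s)"
    proof (rule tail_limit[OF _ _ _ \<epsilon>])
      show "integrable lborel ?g"
        by (intro Bochner_Integration.integrable_add integrable_mult_right g1 g2)
      show "?g s \<ge> 0" for s
        by (intro add_nonneg_nonneg mult_nonneg_nonneg PQ g1_nn g2_nn)
      fix f assume f: "f \<in> F"
      define k where "k t = f (m (\<psi> t x - x) (\<psi> t y - y))" for t
      have "continuous_on UNIV k"
        unfolding k_def
        by (intro bounded_linear.continuous_on[OF bounded_linear_F[OF f]] continuous_on continuous_on_diff
            continuous_on_const continuous_on_orbit[OF x \<theta>0] continuous_on_orbit[OF y \<theta>0])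
      then have k_meas [measurable]: "k \<in> borel_measurable borel"
        by (rule borel_measurable_continuous_onI)
      define E where "E s = (LINT z|gauss. k (sqrt (2 * s) *\<^sub>R z))" for s
      have E_meas [measurable]: "E \<in> borel_measurable borel"
        unfolding E_def by measurable
      define G where "G s = (s powr (- 1 - \<alpha>) * exp (- s)) *\<^sub>R E s + (s powr (- 1 - \<alpha>) * (1 - exp (- s))) *\<^sub>R f (m x y)" for s
      have E_bound: "norm (E s) \<le> onorm f * (Cx * Cy * K * (\<mu> * (2 * s) powr \<theta>))" if s: "s \<ge> 0" for s
      proof -
        have "norm (k (sqrt (2 * s) *\<^sub>R z)) \<le> (onorm f * (Cx * Cy * K) * (2 * s) powr \<theta>) * norm z powr (2 * \<theta>)" for z
        proof -
          let ?\<xi> = "sqrt (2 * s) *\<^sub>R z"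
          have "norm (k ?\<xi>) \<le> onorm f * norm (m (\<psi> ?\<xi> x - x) (\<psi> ?\<xi> y - y))"
            unfolding k_def by (rule F_bound[OF f])
          also have "\<dots> \<le> onorm f * (norm (\<psi> ?\<xi> x - x) * norm (\<psi> ?\<xi> y - y) * K)"
            by (intro mult_left_mono K F_onorm_nonneg[OF f])
          also have "\<dots> \<le> onorm f * ((Cx * norm ?\<xi> powr \<theta>) * (Cy * norm ?\<xi> powr \<theta>) * K)"
            by (intro mult_left_mono mult_right_mono mult_mono K F_onorm_nonneg[OF f] mult_nonneg_nonneg
                x[unfolded holder_def, rule_format] y[unfolded holder_def, rule_format] C powr_ge_zero norm_ge_zero)
          also have "norm ?\<xi> powr \<theta> = (2 * s) powr (\<theta> / 2) * norm z powr \<theta>"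
            using s by (simp add: powr_mult powr_half_sqrt[symmetric] powr_powr)
          also have "onorm f * ((Cx * ((2 * s) powr (\<theta> / 2) * norm z powr \<theta>)) * (Cy * ((2 * s) powr (\<theta> / 2) * norm z powr \<theta>)) * K)
              = (onorm f * (Cx * Cy * K) * ((2 * s) powr (\<theta> / 2) * (2 * s) powr (\<theta> / 2))) * (norm z powr \<theta> * norm z powr \<theta>)"
            by (simp only: ac_simps)
          also have "\<dots> = (onorm f * (Cx * Cy * K) * (2 * s) powr \<theta>) * norm z powr (2 * \<theta>)"
            by (simp add: powr_add[symmetric])
          finally show ?thesis .
        qed
        then have "norm (E s) \<le> (LINT z::real^'d|gauss. (onorm f * (Cx * Cy * K) * (2 * s) powr \<theta>) * norm z powr (2 * \<theta>))"
          unfolding E_def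
          by (intro order_trans[OF integral_norm_bound integral_mono'] integrable_mult_right \<mu>_int)
            (auto intro!: mult_nonneg_nonneg F_onorm_nonneg[OF f] C K)
        then show ?thesis by (simp add: \<mu>_def ac_simps)
      qed
      have "norm (G s) \<le> onorm f * ?g s" if s: "s \<ge> 0" for s
      proof -
        have "norm ((s powr (- 1 - \<alpha>) * exp (- s)) *\<^sub>R E s) \<le> (s powr (- 1 - \<alpha>) * exp (- s)) * (onorm f * (Cx * Cy * K * (\<mu> * (2 * s) powr \<theta>)))"
          unfolding norm_scaleR using E_bound[OF s] by (intro mult_mono) auto
        also have "\<dots> = onorm f * (P * ?g1 s)"
        proof -
          have "s powr (- 1 - \<alpha>) * (2 * s) powr \<theta> = 2 powr \<theta> * s powr ((\<theta> - \<alpha>) - 1)"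
            using s by (simp add: powr_mult powr_add[symmetric] algebra_simps)
          then show ?thesis using s by (simp add: P_def ac_simps)
        qed
        finally have 1: "norm ((s powr (- 1 - \<alpha>) * exp (- s)) *\<^sub>R E s) \<le> onorm f * (P * ?g1 s)" .
        have "norm ((s powr (- 1 - \<alpha>) * (1 - exp (- s))) *\<^sub>R f (m x y)) \<le> (s powr (- 1 - \<alpha>) * (1 - exp (- s))) * (onorm f * (norm x * norm y * K))"
          unfolding norm_scaleR using s
          by (intro mult_mono order_trans[OF F_bound[OF f] mult_left_mono[OF K(2) F_onorm_nonneg[OF f]]]) auto
        also have "\<dots> = onorm f * (Q * ?g2 s)"
          using s by (simp add: Q_def ac_simps)
        finally have "norm ((s powr (- 1 - \<alpha>) * (1 - exp (- s))) *\<^sub>R f (m x y)) \<le> onorm f * (Q * ?g2 s)" .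
        with 1 show ?thesis
          unfolding G_def distrib_left by (intro norm_triangle_le add_mono)
      qed
      moreover have "G \<in> borel_measurable borel"
        unfolding G_def by measurable
      moreover have "f (remainder m \<alpha> x y e) = (LINT s|lborel. indicator {e..} s *\<^sub>R G s)" if "e > 0" for e
        unfolding G_def E_def k_def by (rule F_remainder[OF m \<alpha> \<theta>0 x y f that])
      ultimately show "\<exists>G. G \<in> borel_measurable borel \<and> (\<forall>s\<ge>0. norm (G s) \<le> onorm f * ?g s) \<and>
         (\<forall>\<epsilon>>0. f (remainder m \<alpha> x y \<epsilon>) = (LINT s|lborel. indicator {\<epsilon>..} s *\<^sub>R G s))"
        by blast
    qed
    moreover have "(LINT s|lborel. ?g s) = P * (LINT s|lborel. ?g1 s) + Q * (LINT s|lborel. ?g2 s)"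
      using g1 g2 by (subst Bochner_Integration.integral_add) (simp_all only: integral_mult_right_zero integrable_mult_right)
    moreover have "P * (LINT s|lborel. ?g1 s) + Q * (LINT s|lborel. ?g2 s) \<le> A * (Cx * Cy + norm x * norm y)"
    proof -
      have "P * (LINT s|lborel. ?g1 s) = (K * (\<mu> * 2 powr \<theta>) * (LINT s|lborel. ?g1 s)) * (Cx * Cy)"
        by (simp only: P_def ac_simps)
      also have "\<dots> \<le> A * (Cx * Cy)"
        unfolding A_def using A2 C by (intro mult_right_mono) auto
      finally have 1: "P * (LINT s|lborel. ?g1 s) \<le> A * (Cx * Cy)" .
      have "Q * (LINT s|lborel. ?g2 s) = (K * (LINT s|lborel. ?g2 s)) * (norm x * norm y)"
        by (simp only: Q_def ac_simps)
      also have "\<dots> \<le> A * (norm x * norm y)"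
        unfolding A_def using A1 by (intro mult_right_mono) auto
      finally show ?thesis using 1 by (simp add: distrib_left)
    qed
    ultimately show ?thesis by (auto intro: order_trans)
  qed
  moreover have "A \<ge> 0" unfolding A_def using A1 A2 by simp
  ultimately show ?thesis by blast
qed

section \<open>Bessel potentials and their truncated inverses\<close>

definition R :: "real \<Rightarrow> real \<Rightarrow> 'a \<Rightarrow> 'a" where
  "R \<alpha> \<epsilon> = W (subord (approx_measure \<alpha> \<epsilon>))"

definition L :: "real \<Rightarrow> real \<Rightarrow> 'a \<Rightarrow> 'a" where
  "L \<alpha> \<epsilon> x = (\<epsilon> powr (- \<alpha>) / \<alpha>) *\<^sub>R x - V \<alpha> \<epsilon> x"

definition J :: "real \<Rightarrow> 'a \<Rightarrow> 'a" where
  "J \<alpha> = W (bessel_measure \<alpha>)"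

lemma bounded_linear_J: "\<alpha> > 0 \<Longrightarrow> bounded_linear (J \<alpha>)"
  and J_scaleC: "\<alpha> > 0 \<Longrightarrow> J \<alpha> (c *\<^sub>C x) = c *\<^sub>C J \<alpha> x"
  and F_J: "\<alpha> > 0 \<Longrightarrow> f \<in> F \<Longrightarrow> (\<lambda>x. f (J \<alpha> x)) \<in> F"
  and psi_J: "\<alpha> > 0 \<Longrightarrow> \<psi> t (J \<alpha> x) = J \<alpha> (\<psi> t x)"
  unfolding J_def by (simp_all add: bounded_linear_W W_scaleC F_W psi_W borel_finite_bessel)

lemma measure_bessel:
  assumes "\<alpha> > 0"
  shows "measure (bessel_measure \<alpha> :: (real^'d) measure) UNIV = 1"
proof -
  have "complex_of_real (measure (bessel_measure \<alpha> :: (real^'d) measure) UNIV) = (LINT x|bessel_measure \<alpha>. iexp ((0::real^'d) \<bullet> x))"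
    by (simp add: borel_finiteD(3)[OF borel_finite_bessel[OF assms]] scaleR_conv_of_real)
  also have "\<dots> = 1"
    by (subst fourier_bessel[OF assms]) simp
  finally show ?thesis by simp
qed

lemma J_bound: "\<alpha> > 0 \<Longrightarrow> norm (J \<alpha> x) \<le> M * norm x"
  using W_bound[OF borel_finite_bessel, of \<alpha> x] by (simp add: J_def measure_bessel)

lemma J_one: "\<alpha> > 0 \<Longrightarrow> J \<alpha> 1 = 1"
  by (simp add: J_def W_one borel_finite_bessel measure_bessel)

context
  fixes \<alpha> :: real
  assumes \<alpha>: "0 < \<alpha>" "\<alpha> < 1"
begin

text \<open>\<open>laplace_approx\<close> at |w|^2, lifted to operators by Fourier uniqueness; the
  second order of composition follows because averages commute.\<close>

lemma L_J: "\<epsilon> > 0 \<Longrightarrow> L \<alpha> \<epsilon> (J \<alpha> x) = R \<alpha> \<epsilon> x"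
  and J_L: "\<epsilon> > 0 \<Longrightarrow> J \<alpha> (L \<alpha> \<epsilon> x) = R \<alpha> \<epsilon> x"
proof -
  assume \<epsilon>: "\<epsilon> > 0"
  let ?b = "bessel_measure \<alpha> :: (real^'d) measure"
  let ?t = "subord (tail_measure \<alpha> \<epsilon>) :: (real^'d) measure"
  let ?a = "subord (approx_measure \<alpha> \<epsilon>) :: (real^'d) measure"
  have b: "borel_finite ?b" and t: "borel_finite ?t" and a: "borel_finite ?a"
    by (rule borel_finite_bessel[OF \<alpha>(1)] borel_finite_subord[OF borel_finite_tail[OF \<alpha>(1) \<epsilon>]]
        borel_finite_subord[OF borel_finite_approx[OF \<alpha> \<epsilon>]])+
  note bt = borel_finite_convolution[OF b t]
  have f_t: "fourier ?t w = of_real (LINT s|tail_measure \<alpha> \<epsilon>. exp (- s * (norm w)\<^sup>2))" for w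
    unfolding fourier_def
    using borel_finiteD(1,2)[OF borel_finite_tail[OF \<alpha>(1) \<epsilon>]] AE_tail[OF \<alpha>(1) \<epsilon>] by (rule fourier_subord)
  have f_a: "fourier ?a w = of_real (LINT s|approx_measure \<alpha> \<epsilon>. exp (- s * (norm w)\<^sup>2))" for w
    unfolding fourier_def
    using borel_finiteD(1,2)[OF borel_finite_approx[OF \<alpha> \<epsilon>]] AE_approx[OF \<alpha> \<epsilon>] by (rule fourier_subord)
  have f_b: "fourier ?b w = of_real ((1 + (norm w)\<^sup>2) powr (- \<alpha>))" for w
    unfolding fourier_def by (rule fourier_bessel[OF \<alpha>(1)])
  \<comment> \<open>The relation involves three measures, indexed by 0, 1, 2 to fit the finite
    family of \<open>W_fourier\<close>: the Bessel measure, its convolution with the tail, and the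
    approximate identity.\<close>
  define \<mu> where "\<mu> i = (if i = (0::nat) then ?b else if i = 1 then ?b \<star> ?t else ?a)" for i
  define c where "c i = (if i = (0::nat) then of_real (\<epsilon> powr (- \<alpha>) / \<alpha>) else - 1 :: complex)" for i
  have sum: "(\<Sum>i<3. c i * h (\<mu> i)) = of_real (\<epsilon> powr (- \<alpha>) / \<alpha>) * h ?b - h (?b \<star> ?t) - h ?a"
    for h :: "(real^'d) measure \<Rightarrow> complex"
    by (simp add: \<mu>_def c_def eval_nat_numeral)
  show JL: "J \<alpha> (L \<alpha> \<epsilon> x) = R \<alpha> \<epsilon> x"
  proof (rule F_separates)
    fix f assume f: "f \<in> F"
    have "(\<Sum>i<3. c i * f (W (\<mu> i) x)) = 0"
    proof (rule W_fourier[OF _ _ _ f])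
      show "borel_finite (\<mu> i)" for i
        using a b bt by (simp add: \<mu>_def)
      show "(\<Sum>i<3. c i * fourier (\<mu> i) w) = 0" for w
        unfolding sum[of "\<lambda>\<mu>. fourier \<mu> w"] fourier_convolution[OF b t] f_a f_b f_t laplace_approx[OF \<alpha> \<epsilon> zero_le_power2]
        by (simp add: algebra_simps)
    qed simp
    then have "of_real (\<epsilon> powr (- \<alpha>) / \<alpha>) * f (W ?b x) - f (W (?b \<star> ?t) x) - f (W ?a x) = 0"
      unfolding sum[of "\<lambda>\<mu>. f (W \<mu> x)"] .
    moreover have "W ?b (c *\<^sub>R x) = c *\<^sub>R W ?b x" "W ?b (x - y) = W ?b x - W ?b y" for c x y
      using bounded_linear.linear[OF bounded_linear_W[OF b]] by (auto simp: linear_scale linear_diff)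
    ultimately show "f (J \<alpha> (L \<alpha> \<epsilon> x)) = f (R \<alpha> \<epsilon> x)"
      by (simp add: J_def L_def R_def V_def F_diff[OF f] F_scaleR[OF f] W_convolution[OF b t] scaleR_conv_of_real)
  qed
  show "L \<alpha> \<epsilon> (J \<alpha> x) = R \<alpha> \<epsilon> x"
    using JL bounded_linear.linear[OF bounded_linear_J[OF \<alpha>(1)]] W_commute[OF b t, of x]
    by (simp add: L_def V_def J_def linear_diff linear_scale)
qed

text \<open>Convergence against each functional in \<open>F\<close> only: for a general element the
  orbit need not be norm continuous at 0.\<close>

lemma R_tendsto:
  assumes f: "f \<in> F" and \<epsilon>: "\<And>n. \<epsilon> n > 0" "\<epsilon> \<longlonglongrightarrow> 0"
  shows "(\<lambda>n. f (R \<alpha> (\<epsilon> n) x)) \<longlonglongrightarrow> of_real (approx_const \<alpha>) * f x"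
  unfolding R_def W_char[OF borel_finite_subord[OF borel_finite_approx[OF \<alpha> \<epsilon>(1)]] f]
  using approx_measure_limit[OF \<alpha> F_cont[OF f, of x] F_psi_bound[OF f] \<epsilon>] by simp

text \<open>\<open>L_J\<close> recovers \<open>R \<alpha> \<epsilon> x\<close> from
  \<open>J \<alpha> x\<close>, and its weak limit is a nonzero multiple of \<open>x\<close>.\<close>

lemma inj_J: "J \<alpha> x = J \<alpha> y \<Longrightarrow> x = y"
proof (rule F_separates)
  fix f assume f: "f \<in> F" and eq: "J \<alpha> x = J \<alpha> y"
  have R_eq: "R \<alpha> (1 / real (Suc n)) x = R \<alpha> (1 / real (Suc n)) y" for n
    using L_J[OF inverse_seq_pos, of n x] L_J[OF inverse_seq_pos, of n y] eq by simp
  have "of_real (approx_const \<alpha>) * f x = of_real (approx_const \<alpha>) * f y"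
    by (rule LIMSEQ_unique[OF R_tendsto[OF f inverse_seq_pos inverse_seq_tendsto, of x]])
      (unfold R_eq, rule R_tendsto[OF f inverse_seq_pos inverse_seq_tendsto])
  then show "f x = f y"
    using approx_const_pos[OF \<alpha>] by simp
qed

end

section \<open>Small orders and iteration\<close>

context
  fixes m :: "'a \<Rightarrow> 'a \<Rightarrow> 'a" and \<alpha> :: real
  assumes m: "algebra_mult m" and \<alpha>: "0 < \<alpha>" "\<alpha> < 1 / 2"
begin

interpretation bounded_bilinear m
  by (rule algebra_multD[OF m])

abbreviation (input) eps :: "nat \<Rightarrow> real" where "eps n \<equiv> 1 / real (Suc n)"

lemma alpha_less_1: "\<alpha> < 1" using \<alpha> by simp

lemma linear_J: "linear (J \<alpha>)"
  by (rule bounded_linear.linear[OF bounded_linear_J[OF \<alpha>(1)]])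

lemma L_mult: "L \<alpha> \<epsilon> (m x y) = m (L \<alpha> \<epsilon> x) y + m x (L \<alpha> \<epsilon> y) - remainder m \<alpha> x y \<epsilon>"
  by (simp add: L_def remainder_def diff_left diff_right scaleR_left scaleR_right)

text \<open>The exponent is the midpoint of the interval from \<alpha> to 2\<alpha>: above \<alpha>
  for the remainder, below 2\<alpha> for the regularity of potentials, and at most 1 as \<alpha> <
  1/2.\<close>

lemma holder_J: "\<exists>C\<ge>0. \<forall>u. holder (3 * \<alpha> / 2) (C * norm u) (J \<alpha> u)"
  unfolding J_def by (rule holder_bessel) (use \<alpha> in auto)

lemma F_mult_J:
  assumes "f \<in> F"
  shows "(\<lambda>x. f (m x (J \<alpha> u))) \<in> F" "(\<lambda>x. f (m (J \<alpha> u) x)) \<in> F"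
proof -
  obtain C where h: "holder (3 * \<alpha> / 2) (C * norm u) (J \<alpha> u)"
    using holder_J by blast
  have "continuous_on UNIV (\<lambda>t. \<psi> t (J \<alpha> u))"
    by (rule continuous_on_orbit[OF h]) (use \<alpha> in simp)
  then show "(\<lambda>x. f (m x (J \<alpha> u))) \<in> F" "(\<lambda>x. f (m (J \<alpha> u) x)) \<in> F"
    by (rule F_mult[OF m _ assms])+
qed

lemma remainder_limit:
  "\<exists>A\<ge>0. \<forall>x y Cx Cy. holder (3 * \<alpha> / 2) Cx x \<longrightarrow> holder (3 * \<alpha> / 2) Cy y \<longrightarrow> Cx \<ge> 0 \<longrightarrow> Cy \<ge> 0 \<longrightarrow>
    (\<exists>I. (\<lambda>n. remainder m \<alpha> x y (eps n)) \<longlonglongrightarrow> I \<and> norm I \<le> A * (Cx * Cy + norm x * norm y))"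
  by (rule remainder_converges[OF m \<alpha>(1) alpha_less_1 _ _ inverse_seq_pos inverse_seq_tendsto]) (use \<alpha> in auto)

text \<open>Apply \<open>J\<close> to the product rule for \<open>L\<close>: the left side becomes
  \<open>R\<close> of the product, which tends weakly to \<open>k\<close> times the product, while
  on the right L(x) = R(u) and L(y) = R(v) tend weakly to k u and k v. Testing with f composed with
  J is legitimate since it lies in \<open>F\<close>.\<close>

lemma J_mult:
  "\<exists>C\<ge>0. \<forall>u v. \<exists>w. m (J \<alpha> u) (J \<alpha> v) = J \<alpha> w \<and> norm w \<le> C * norm u * norm v"
proof -
  obtain C0 where C0: "C0 \<ge> 0" "\<And>u. holder (3 * \<alpha> / 2) (C0 * norm u) (J \<alpha> u)"
    using holder_J by blast
  obtain A where A: "A \<ge> 0" "\<And>x y Cx Cy. holder (3 * \<alpha> / 2) Cx x \<Longrightarrow> holder (3 * \<alpha> / 2) Cy y \<Longrightarrow> Cx \<ge> 0 \<Longrightarrow> Cy \<ge> 0 \<Longrightarrow>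
      \<exists>I. (\<lambda>n. remainder m \<alpha> x y (eps n)) \<longlonglongrightarrow> I \<and> norm I \<le> A * (Cx * Cy + norm x * norm y)"
    using remainder_limit by blast
  obtain K where K: "K \<ge> 0" "\<And>a b. norm (m a b) \<le> norm a * norm b * K"
    using nonneg_bounded by blast
  define k where "k = approx_const \<alpha>"
  have k: "k > 0" unfolding k_def by (rule approx_const_pos[OF \<alpha>(1) alpha_less_1])
  define C where "C = K * M + K * M + A * (C0 * C0 + M * M) / k"
  have "\<exists>w. m (J \<alpha> u) (J \<alpha> v) = J \<alpha> w \<and> norm w \<le> C * norm u * norm v" for u v
  proof -
    define x y where "x = J \<alpha> u" and "y = J \<alpha> v"
    obtain I where I: "(\<lambda>n. remainder m \<alpha> x y (eps n)) \<longlonglongrightarrow> I"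
      "norm I \<le> A * ((C0 * norm u) * (C0 * norm v) + norm x * norm y)"
      using A(2)[OF C0(2) C0(2), of u v] C0(1) unfolding x_def y_def by auto
    \<comment> \<open>The limit of L(x y) divided by \<open>k\<close>, with \<open>I\<close> the
      norm limit of the remainder.\<close>
    define w where "w = m u y + m x v - (1 / k) *\<^sub>R I"
    have "f (m x y) = f (J \<alpha> w)" if f: "f \<in> F" for f
    proof -
      have g: "(\<lambda>z. f (J \<alpha> z)) \<in> F" by (rule F_J[OF \<alpha>(1) f])
      have "f (R \<alpha> (eps n) (m x y)) =
          f (J \<alpha> (m (R \<alpha> (eps n) u) y)) + f (J \<alpha> (m x (R \<alpha> (eps n) v))) - f (J \<alpha> (remainder m \<alpha> x y (eps n)))" for n
        unfolding J_L[OF \<alpha>(1) alpha_less_1 inverse_seq_pos, symmetric] L_mult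
        by (simp add: linear_add[OF linear_J] linear_diff[OF linear_J] F_add[OF f] F_diff[OF f]
            x_def y_def L_J[OF \<alpha>(1) alpha_less_1] J_L[OF \<alpha>(1) alpha_less_1])
      moreover have "(\<lambda>n. f (J \<alpha> (m (R \<alpha> (eps n) u) y)) + f (J \<alpha> (m x (R \<alpha> (eps n) v))) - f (J \<alpha> (remainder m \<alpha> x y (eps n))))
        \<longlonglongrightarrow> of_real k * f (J \<alpha> (m u y)) + of_real k * f (J \<alpha> (m x v)) - f (J \<alpha> I)"
        unfolding k_def
        by (intro tendsto_diff tendsto_add bounded_linear.tendsto[OF bounded_linear_F[OF g] I(1)]
            R_tendsto[OF \<alpha>(1) alpha_less_1 F_mult_J(1)[OF g, of v, folded y_def] inverse_seq_pos inverse_seq_tendsto]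
            R_tendsto[OF \<alpha>(1) alpha_less_1 F_mult_J(2)[OF g, of u, folded x_def] inverse_seq_pos inverse_seq_tendsto])
      moreover have "(\<lambda>n. f (R \<alpha> (eps n) (m x y))) \<longlonglongrightarrow> of_real k * f (m x y)"
        unfolding k_def by (rule R_tendsto[OF \<alpha>(1) alpha_less_1 f inverse_seq_pos inverse_seq_tendsto])
      ultimately have "of_real k * f (m x y) = of_real k * f (J \<alpha> (m u y)) + of_real k * f (J \<alpha> (m x v)) - f (J \<alpha> I)"
        using LIMSEQ_unique by simp
      also have "\<dots> = of_real k * f (J \<alpha> w)"
        using k by (simp add: w_def linear_add[OF linear_J] linear_diff[OF linear_J] linear_scale[OF linear_J]
            F_add[OF f] F_diff[OF f] F_scaleR[OF f] scaleR_conv_of_real algebra_simps)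
      finally show ?thesis using k by simp
    qed
    then have "m x y = J \<alpha> w" by (rule F_separates)
    moreover have "norm w \<le> C * norm u * norm v"
    proof -
      have Jb: "norm x \<le> M * norm u" "norm y \<le> M * norm v"
        unfolding x_def y_def by (rule J_bound[OF \<alpha>(1)])+
      have "norm w \<le> norm (m u y) + norm (m x v) + norm ((1 / k) *\<^sub>R I)"
        unfolding w_def by (intro order_trans[OF norm_triangle_ineq4] add_mono norm_triangle_ineq order_refl)
      also have "norm (m u y) \<le> norm u * (M * norm v) * K"
        by (intro order_trans[OF K(2)] mult_right_mono mult_left_mono Jb K) auto
      also have "norm (m x v) \<le> (M * norm u) * norm v * K"
        by (intro order_trans[OF K(2)] mult_right_mono mult_left_mono Jb K) auto
      also have "norm ((1 / k) *\<^sub>R I) \<le> (1 / k) * (A * ((C0 * norm u) * (C0 * norm v) + (M * norm u) * (M * norm v)))"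
      proof -
        have "norm x * norm y \<le> (M * norm u) * (M * norm v)"
          using M_nonneg by (intro mult_mono Jb) auto
        then have "A * ((C0 * norm u) * (C0 * norm v) + norm x * norm y) \<le> A * ((C0 * norm u) * (C0 * norm v) + (M * norm u) * (M * norm v))"
          using A(1) by (intro mult_left_mono) auto
        with I(2) have "norm I \<le> A * ((C0 * norm u) * (C0 * norm v) + (M * norm u) * (M * norm v))"
          by linarith
        then have "(1 / k) * norm I \<le> (1 / k) * (A * ((C0 * norm u) * (C0 * norm v) + (M * norm u) * (M * norm v)))"
          using k by (intro mult_left_mono) auto
        then show ?thesis using k by simp
      qed
      also have "norm u * (M * norm v) * K + (M * norm u) * norm v * K
          + (1 / k) * (A * ((C0 * norm u) * (C0 * norm v) + (M * norm u) * (M * norm v))) = C * norm u * norm v"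
        using k by (simp add: C_def field_simps)
      finally show ?thesis by simp
    qed
    ultimately show ?thesis unfolding x_def y_def by blast
  qed
  moreover have "C \<ge> 0"
    unfolding C_def using K A M_nonneg k C0 by simp
  ultimately show ?thesis by blast
qed

text \<open>Since J 1 = 1, the product rule for x c = 1 has R(1) on the left. It is solved for L(c)
  by multiplying with \<open>c\<close> from the left; applying \<open>J\<close> and passing to the
  limit exhibits \<open>c\<close> as a potential.\<close>

lemma J_inverse:
  assumes inv: "m (J \<alpha> u) c = 1" "m c (J \<alpha> u) = 1"
  shows "\<exists>w. c = J \<alpha> w"
proof -
  note assoc = algebra_multD(4)[OF m] and one = algebra_multD(5,6)[OF m]
  define x where "x = J \<alpha> u"
  obtain C0 where C0: "C0 \<ge> 0" and hx: "holder (3 * \<alpha> / 2) (C0 * norm u) x"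
    using holder_J unfolding x_def by blast
  obtain K where K: "K \<ge> 0" "\<And>a b. norm (m a b) \<le> norm a * norm b * K"
    using nonneg_bounded by blast
  define C1 where "C1 = M * norm c * (C0 * norm u * norm c * K) * K"
  have C1: "C1 \<ge> 0" using M_nonneg C0 K by (simp add: C1_def)
  have hc: "holder (3 * \<alpha> / 2) C1 c"
    unfolding holder_def
  proof
    fix t :: "real^'d"
    let ?p = "norm t powr (3 * \<alpha> / 2)"
    have p1: "m (\<psi> t c) (\<psi> t x) = 1"
      using inv(2) psi_one[of t] by (simp add: x_def algebra_multD(7)[OF m, symmetric])
    \<comment> \<open>As in the resolvent identity, \<psi>_t(c) (\<psi>_t(x) - x) c = c -
      \<psi>_t(c). With the uniform bound on \<psi>_t(c) the increment of \<open>c\<close> is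
      controlled by that of \<open>x\<close>, which gives the constant \<open>C1\<close>.\<close>
    have "m (\<psi> t c) (m (\<psi> t x - x) c) = m (m (\<psi> t c) (\<psi> t x)) c - m (\<psi> t c) (m x c)"
      by (simp add: diff_left diff_right assoc)
    also have "\<dots> = c - \<psi> t c"
      using inv(1)[folded x_def] by (simp add: p1 one)
    finally have "norm (\<psi> t c - c) = norm (m (\<psi> t c) (m (\<psi> t x - x) c))"
      by (simp add: norm_minus_commute)
    also have "\<dots> \<le> norm (\<psi> t c) * norm (m (\<psi> t x - x) c) * K"
      by (rule K(2))
    also have "\<dots> \<le> (M * norm c) * ((C0 * norm u * ?p) * norm c * K) * K"
      using hx M_nonneg
      by (intro mult_right_mono mult_mono norm_psi K order_trans[OF K(2)] mult_nonneg_nonneg) (auto simp: holder_def)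
    also have "\<dots> = C1 * ?p" by (simp add: C1_def)
    finally show "norm (\<psi> t c - c) \<le> C1 * ?p" .
  qed
  then have cc: "continuous_on UNIV (\<lambda>t. \<psi> t c)"
    by (rule continuous_on_orbit) (use \<alpha> in simp)
  obtain A where A: "A \<ge> 0" "\<And>x y Cx Cy. holder (3 * \<alpha> / 2) Cx x \<Longrightarrow> holder (3 * \<alpha> / 2) Cy y \<Longrightarrow> Cx \<ge> 0 \<Longrightarrow> Cy \<ge> 0 \<Longrightarrow>
      \<exists>I. (\<lambda>n. remainder m \<alpha> x y (eps n)) \<longlonglongrightarrow> I \<and> norm I \<le> A * (Cx * Cy + norm x * norm y)"
    using remainder_limit by blast
  obtain I where I: "(\<lambda>n. remainder m \<alpha> x c (eps n)) \<longlonglongrightarrow> I"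
    using A(2)[OF hx hc] C0 C1 by auto
  define k where "k = approx_const \<alpha>"
  have k: "k > 0" unfolding k_def by (rule approx_const_pos[OF \<alpha>(1) alpha_less_1])
  \<comment> \<open>The weak limit of L(c) = c R(1) + c rem - c (R(u) c), divided by
    \<open>k\<close>.\<close>
  define w where "w = c + (1 / k) *\<^sub>R m c I - m c (m u c)"
  have "f c = f (J \<alpha> w)" if f: "f \<in> F" for f
  proof -
    have g: "(\<lambda>z. f (J \<alpha> z)) \<in> F" by (rule F_J[OF \<alpha>(1) f])
    \<comment> \<open>The functionals z -> f(J(c z)) and z -> f(J(c (z c))) stay in \<open>F\<close>
      because the orbit of \<open>c\<close> is norm continuous.\<close>
    note g1 = F_mult(2)[OF m cc g]
    note g2 = F_mult(1)[OF m cc g1]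
    have Lc: "L \<alpha> (eps n) c = m c (R \<alpha> (eps n) 1) + m c (remainder m \<alpha> x c (eps n)) - m c (m (R \<alpha> (eps n) u) c)" for n
    proof -
      have "R \<alpha> (eps n) 1 = L \<alpha> (eps n) (m x c)"
        using L_J[OF \<alpha>(1) alpha_less_1 inverse_seq_pos, of n 1] inv by (simp add: J_one[OF \<alpha>(1)] x_def)
      also have "\<dots> = m (R \<alpha> (eps n) u) c + m x (L \<alpha> (eps n) c) - remainder m \<alpha> x c (eps n)"
        unfolding L_mult x_def L_J[OF \<alpha>(1) alpha_less_1 inverse_seq_pos] ..
      finally have "m x (L \<alpha> (eps n) c) = R \<alpha> (eps n) 1 + remainder m \<alpha> x c (eps n) - m (R \<alpha> (eps n) u) c"
        by (simp add: algebra_simps)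
      then have "m c (m x (L \<alpha> (eps n) c)) = m c (R \<alpha> (eps n) 1) + m c (remainder m \<alpha> x c (eps n)) - m c (m (R \<alpha> (eps n) u) c)"
        by (simp only: add_right diff_right)
      then show ?thesis
        using inv(2) by (simp add: assoc[symmetric] one x_def)
    qed
    have "f (R \<alpha> (eps n) c) = f (J \<alpha> (m c (R \<alpha> (eps n) 1))) + f (J \<alpha> (m c (remainder m \<alpha> x c (eps n)))) - f (J \<alpha> (m c (m (R \<alpha> (eps n) u) c)))" for n
      unfolding J_L[OF \<alpha>(1) alpha_less_1 inverse_seq_pos, of n c, symmetric] Lc
      by (simp only: linear_add[OF linear_J] linear_diff[OF linear_J] F_add[OF f] F_diff[OF f])
    moreover have "(\<lambda>n. f (J \<alpha> (m c (R \<alpha> (eps n) 1))) + f (J \<alpha> (m c (remainder m \<alpha> x c (eps n)))) - f (J \<alpha> (m c (m (R \<alpha> (eps n) u) c))))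
      \<longlonglongrightarrow> of_real k * f (J \<alpha> (m c 1)) + f (J \<alpha> (m c I)) - of_real k * f (J \<alpha> (m c (m u c)))"
      unfolding k_def
      by (intro tendsto_diff tendsto_add bounded_linear.tendsto[OF bounded_linear_F[OF g1] I]
          R_tendsto[OF \<alpha>(1) alpha_less_1 g1 inverse_seq_pos inverse_seq_tendsto]
          R_tendsto[OF \<alpha>(1) alpha_less_1 g2 inverse_seq_pos inverse_seq_tendsto])
    moreover have "(\<lambda>n. f (R \<alpha> (eps n) c)) \<longlonglongrightarrow> of_real k * f c"
      unfolding k_def by (rule R_tendsto[OF \<alpha>(1) alpha_less_1 f inverse_seq_pos inverse_seq_tendsto])
    ultimately have "of_real k * f c = of_real k * f (J \<alpha> (m c 1)) + f (J \<alpha> (m c I)) - of_real k * f (J \<alpha> (m c (m u c)))"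
      using LIMSEQ_unique by simp
    also have "\<dots> = of_real k * f (J \<alpha> w)"
      using k by (simp add: w_def one linear_add[OF linear_J] linear_diff[OF linear_J] linear_scale[OF linear_J]
          F_add[OF f] F_diff[OF f] F_scaleR[OF f] scaleR_conv_of_real algebra_simps)
    finally show ?thesis using k by simp
  qed
  then have "c = J \<alpha> w" by (rule F_separates)
  then show ?thesis by blast
qed

text \<open>Transport of structure along the injective map \<open>J\<close>, which fixes 1 and
  commutes with \<psi>. Each algebraic law for \<open>m'\<close> holds after applying
  \<open>J\<close>; continuity comes from choosing the preimage together with the bound of
  \<open>J_mult\<close>.\<close>

lemma algebra_mult_step:
  "\<exists>m'. algebra_mult m' \<and> (\<forall>u v. m (J \<alpha> u) (J \<alpha> v) = J \<alpha> (m' u v))"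
proof -
  obtain C where C: "\<And>u v. \<exists>w. m (J \<alpha> u) (J \<alpha> v) = J \<alpha> w \<and> norm w \<le> C * norm u * norm v"
    using J_mult by blast
  define m' where "m' u v = (SOME w. m (J \<alpha> u) (J \<alpha> v) = J \<alpha> w \<and> norm w \<le> C * norm u * norm v)" for u v
  have m': "m (J \<alpha> u) (J \<alpha> v) = J \<alpha> (m' u v)" "norm (m' u v) \<le> C * norm u * norm v" for u v
    using someI_ex[OF C[of u v]] unfolding m'_def by blast+
  have inj: "u = v" if "J \<alpha> u = J \<alpha> v" for u v
    by (rule inj_J[OF \<alpha>(1) alpha_less_1 that])
  note lin = linear_add[OF linear_J] linear_scale[OF linear_J] J_scaleC[OF \<alpha>(1)] J_one[OF \<alpha>(1)] psi_J[OF \<alpha>(1), symmetric]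
  note mult = algebra_multD[OF m]
  have "bounded_bilinear m'"
  proof (rule bounded_bilinear.intro)
    show "m' (a + b) c = m' a c + m' b c" for a b c
      by (rule inj) (simp add: m'(1)[symmetric] lin add_left)
    show "m' a (b + c) = m' a b + m' a c" for a b c
      by (rule inj) (simp add: m'(1)[symmetric] lin add_right)
    show "m' (r *\<^sub>R a) b = r *\<^sub>R m' a b" for r a b
      by (rule inj) (simp add: m'(1)[symmetric] lin scaleR_left)
    show "m' a (r *\<^sub>R b) = r *\<^sub>R m' a b" for r a b
      by (rule inj) (simp add: m'(1)[symmetric] lin scaleR_right)
    show "\<exists>K. \<forall>a b. norm (m' a b) \<le> norm a * norm b * K"
      using m'(2) by (intro exI[of _ C]) (simp add: ac_simps)
  qed
  moreover have "m' (c *\<^sub>C x) y = c *\<^sub>C m' x y" "m' x (c *\<^sub>C y) = c *\<^sub>C m' x y" for c x y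
    by (rule inj, simp add: m'(1)[symmetric] lin mult(2,3))+
  moreover have "m' (m' x y) z = m' x (m' y z)" for x y z
    by (rule inj) (simp add: m'(1)[symmetric] mult(4))
  moreover have "m' 1 x = x" "m' x 1 = x" for x
    by (rule inj, simp add: m'(1)[symmetric] lin mult(5,6))+
  moreover have "\<psi> t (m' x y) = m' (\<psi> t x) (\<psi> t y)" for t x y
    by (rule inj) (simp add: m'(1)[symmetric] lin mult(7))
  ultimately have "algebra_mult m'"
    by (simp add: algebra_mult_def)
  then show ?thesis using m'(1) by blast
qed

end

text \<open>Each step replaces the multiplication by the one transported through another factor
  \<open>J \<alpha>\<close>, so the results for a single small order apply again on the same
  space.\<close>

lemma algebra_mult_iterate:
  assumes \<alpha>: "0 < \<alpha>" "\<alpha> < 1 / 2"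
  shows "\<exists>m. algebra_mult m \<and> (\<forall>u v. (J \<alpha> ^^ n) u * (J \<alpha> ^^ n) v = (J \<alpha> ^^ n) (m u v)) \<and>
    (\<forall>u c. (J \<alpha> ^^ n) u * c = 1 \<longrightarrow> c * (J \<alpha> ^^ n) u = 1 \<longrightarrow> (\<exists>v. c = (J \<alpha> ^^ n) v))"
proof (induction n)
  case 0
  show ?case
    by (intro exI[of _ "(*)"]) (simp add: algebra_mult_times)
next
  case (Suc n)
  have one: "(J \<alpha> ^^ n) 1 = 1"
    by (induction n) (simp_all add: J_one[OF \<alpha>(1)])
  have inj: "u = v" if "(J \<alpha> ^^ n) u = (J \<alpha> ^^ n) v" for u v
    using that
  proof (induction n)
    case (Suc n)
    then show ?case using inj_J[OF \<alpha>(1), of "(J \<alpha> ^^ n) u" "(J \<alpha> ^^ n) v"] \<alpha> by simp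
  qed simp
  obtain m where m: "algebra_mult m" "\<And>u v. (J \<alpha> ^^ n) u * (J \<alpha> ^^ n) v = (J \<alpha> ^^ n) (m u v)"
    "\<And>u c. (J \<alpha> ^^ n) u * c = 1 \<Longrightarrow> c * (J \<alpha> ^^ n) u = 1 \<Longrightarrow> \<exists>v. c = (J \<alpha> ^^ n) v"
    using Suc.IH by blast
  obtain m' where m': "algebra_mult m'" "\<And>u v. m (J \<alpha> u) (J \<alpha> v) = J \<alpha> (m' u v)"
    using algebra_mult_step[OF m(1) \<alpha>] by blast
  have "\<exists>v. c = (J \<alpha> ^^ Suc n) v" if c: "(J \<alpha> ^^ Suc n) u * c = 1" "c * (J \<alpha> ^^ Suc n) u = 1" for u c
  proof -
    have c': "(J \<alpha> ^^ n) (J \<alpha> u) * c = 1" "c * (J \<alpha> ^^ n) (J \<alpha> u) = 1"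
      using c by (simp_all add: funpow_Suc_right del: funpow.simps)
    then obtain v where v: "c = (J \<alpha> ^^ n) v"
      using m(3) by blast
    \<comment> \<open>Cancelling the injective power of \<open>J\<close>, which fixes 1, shows that
      \<open>v\<close> is the inverse of \<open>J \<alpha> u\<close> for the multiplication
      \<open>m\<close>, not for the original one; \<open>J_inverse\<close> for \<open>m\<close> then
      gains one more factor.\<close>
    have mv: "(J \<alpha> ^^ n) (m (J \<alpha> u) v) = (J \<alpha> ^^ n) 1" "(J \<alpha> ^^ n) (m v (J \<alpha> u)) = (J \<alpha> ^^ n) 1"
      using c' unfolding m(2)[symmetric] one v by simp_all
    have "m (J \<alpha> u) v = 1" "m v (J \<alpha> u) = 1"
      by (rule inj[OF mv(1)], rule inj[OF mv(2)])
    then obtain w where "v = J \<alpha> w"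
      using J_inverse[OF m(1) \<alpha>] by blast
    then show ?thesis using v by (auto simp: funpow_Suc_right simp del: funpow.simps)
  qed
  moreover have "(J \<alpha> ^^ Suc n) u * (J \<alpha> ^^ Suc n) v = (J \<alpha> ^^ Suc n) (m' u v)" for u v
    using m(2)[of "J \<alpha> u" "J \<alpha> v"] m'(2)[of u v] by (simp add: funpow_Suc_right del: funpow.simps)
  ultimately show ?case
    using m'(1) by blast
qed

section \<open>From powers of small order to the Bessel potential space\<close>

lemma J_J:
  assumes "a > 0" "b > 0"
  shows "J a (J b x) = J (a + b) x"
proof -
  let ?m = "\<lambda>a. bessel_measure a :: (real^'d) measure"
  have fin: "borel_finite (?m a)" "borel_finite (?m b)" "borel_finite (?m (a + b))"
    using assms by (auto intro: borel_finite_bessel)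
  have "fourier (?m a \<star> ?m b) w = fourier (?m (a + b)) w" for w
    unfolding fourier_convolution[OF fin(1,2)] using assms
    by (simp add: fourier_def fourier_bessel powr_add[symmetric] add_increasing flip: of_real_mult)
  then show ?thesis
    using W_fourier_eq[OF borel_finite_convolution[OF fin(1,2)] fin(3)] by (simp add: J_def W_convolution fin)
qed

lemma J_funpow: "a > 0 \<Longrightarrow> (J a ^^ Suc n) x = J (real (Suc n) * a) x"
proof (induction n)
  case (Suc n)
  have "(J a ^^ Suc (Suc n)) x = J a (J (real (Suc n) * a) x)"
    using Suc by simp
  also have "\<dots> = J (a + real (Suc n) * a) x"
    using Suc.prems by (intro J_J) auto
  finally show ?case by (simp add: algebra_simps)
qed simp

text \<open>Two discrepancies are removed by Fourier uniqueness. The sign in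
  \<open>\<psi> (- t)\<close> is harmless because the transform of the Bessel measure is even, and
  the unspecified, possibly complex-valued kernel has the same transform as that measure, so both
  integrate bounded continuous functions alike.\<close>

lemma group_conv_bessel:
  assumes r: "r > 0"
  shows "group_conv \<psi> (bessel_kernel r) y = J (r / 2) y"
proof -
  let ?b = "bessel_measure (r / 2) :: (real^'d) measure"
  let ?b' = "distr ?b borel uminus"
  have b: "borel_finite ?b"
    using r by (intro borel_finite_bessel) simp
  note [measurable_cong] = borel_finiteD(2)[OF b]
  have b': "borel_finite ?b'"
    unfolding borel_finite_def using borel_finiteD[OF b]
    by (auto intro!: finite_measure.finite_measure_distr)
  have fb: "fourier ?b v = of_real ((1 + (norm v)\<^sup>2) powr (- (r / 2)))" for v :: "real^'d"
    unfolding fourier_def using r by (intro fourier_bessel) simp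
  have "fourier ?b' w = fourier ?b (- w)" for w
    unfolding fourier_def by (subst integral_distr) auto
  then have "fourier ?b' w = fourier ?b w" for w
    by (simp add: fb)
  then have W_b': "W ?b' y = J (r / 2) y"
    unfolding J_def by (intro W_fourier_eq[OF b' b])
  have J: "f (J (r / 2) y) = (LINT t|lborel. f (\<psi> (- t) y) * bessel_kernel r t)" if f: "f \<in> F" for f
  proof -
    note [measurable] = F_measurable[OF f]
    have 1: "f (J (r / 2) y) = (LINT t|?b. f (\<psi> (- t) y))"
      unfolding W_b'[symmetric] W_char[OF b' f] by (subst integral_distr) auto
    define \<mu> where "\<mu> i = (if i then ?b else lborel)" for i
    define v where "v i = (if i then (\<lambda>_. 1) else (\<lambda>t :: real^'d. - bessel_kernel r t))" for i
    have "(\<Sum>i\<in>UNIV. LINT t|\<mu> i. v i t * f (\<psi> (- t) y)) = 0"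
    proof (rule fourier_unique[where B="onorm f * (M * norm y)"])
      show "sigma_finite_measure (\<mu> i)" for i
        using borel_finiteD(1)[OF b] by (cases i) (simp_all add: \<mu>_def finite_measure_def sigma_finite_lborel)
      show "sets (\<mu> i) = sets borel" for i
        using borel_finiteD(2)[OF b] by (simp add: \<mu>_def)
      show "integrable (\<mu> i) (v i)" for i
        using bessel_kernel_spec(1)[OF r] finite_measure.integrable_const[OF borel_finiteD(1)[OF b]]
        by (cases i) (simp_all add: \<mu>_def v_def)
      show "(\<Sum>i\<in>UNIV. LINT x|\<mu> i. v i x * iexp (w \<bullet> x)) = 0" for w
        using bessel_kernel_spec(2)[OF r, of w] by (simp add: UNIV_bool \<mu>_def v_def fourier_def)
      show "continuous_on UNIV (\<lambda>t. f (\<psi> (- t) y))"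
        by (rule continuous_on_compose2[OF F_cont[OF f, of y]]) (auto intro: continuous_intros)
    qed (simp_all add: F_psi_bound[OF f])
    then show ?thesis
      by (simp add: 1 UNIV_bool \<mu>_def v_def mult.commute)
  qed
  show ?thesis
    unfolding group_conv_def
  proof (rule the_equality)
    fix b assume "\<forall>f\<in>F. f b = (LINT t|lborel. f (\<psi> (- t) y) * bessel_kernel r t)"
    then show "b = J (r / 2) y"
      by (intro F_separates) (simp add: J)
  qed (simp add: J)
qed

lemma bessel_space_algebra:
  assumes r: "r > 0"
  shows "\<exists>m. algebra_mult m \<and> (\<forall>u v. J (r / 2) u * J (r / 2) v = J (r / 2) (m u v)) \<and>
    (\<forall>u c. J (r / 2) u * c = 1 \<longrightarrow> c * J (r / 2) u = 1 \<longrightarrow> (\<exists>v. c = J (r / 2) v))"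
    and "inj (J (r / 2))"
proof -
  \<comment> \<open>Rounding up gives r < n + 1, so that splitting r/2 into n + 1 equal parts leaves
    each below 1/2.\<close>
  define n where "n = nat \<lceil>r\<rceil>"
  define a where "a = r / 2 / real (Suc n)"
  have "r < real (Suc n)"
    unfolding n_def by linarith
  then have a: "0 < a" "a < 1 / 2"
    using r by (auto simp: a_def field_simps)
  have "real (Suc n) * a = r / 2"
    by (simp add: a_def del: of_nat_Suc)
  then have J: "J (r / 2) = J a ^^ Suc n"
    using J_funpow[OF a(1), of n] by (intro ext) (simp only:)
  show "\<exists>m. algebra_mult m \<and> (\<forall>u v. J (r / 2) u * J (r / 2) v = J (r / 2) (m u v)) \<and>
    (\<forall>u c. J (r / 2) u * c = 1 \<longrightarrow> c * J (r / 2) u = 1 \<longrightarrow> (\<exists>v. c = J (r / 2) v))"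
    unfolding J by (rule algebra_mult_iterate[OF a])
  have "inj (J a)"
    using inj_J[OF a(1)] a(2) by (intro injI) simp
  then show "inj (J (r / 2))"
    unfolding J by (rule inj_fn)
qed

lemma bessel_space_eq: "r > 0 \<Longrightarrow> bessel_space \<psi> r = range (J (r / 2))"
  by (auto simp: bessel_space_def group_conv_bessel)

lemma bessel_norm_J:
  assumes "r > 0"
  shows "bessel_norm \<psi> r (J (r / 2) y) = norm y"
proof -
  have "(THE z. J (r / 2) y = J (r / 2) z) = y"
    using bessel_space_algebra(2)[OF assms] by (auto simp: inj_eq)
  then show ?thesis
    using assms by (simp add: bessel_norm_def group_conv_bessel)
qed

lemma bessel_space_inverse_closed:
  assumes "r > 0"
  shows "inverse_closed (bessel_space \<psi> r)"
  unfolding inverse_closed_def bessel_space_eq[OF assms]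
  using bessel_space_algebra(1)[OF assms] by blast

text \<open>By \<open>bessel_norm_J\<close> the map \<open>J (r / 2)\<close> is an isometry of the
  whole algebra onto the Bessel space, so norm axioms and completeness are transported; the product
  constant is that of the transported multiplication \<open>m\<close>, and the embedding constant is
  \<open>M\<close>.\<close>

lemma bessel_space_banach_subalgebra:
  assumes r: "r > 0"
  shows "banach_subalgebra (bessel_space \<psi> r) (bessel_norm \<psi> r)"
proof -
  let ?J = "J (r / 2)"
  have r2: "r / 2 > 0" using r by simp
  note lin = bounded_linear.linear[OF bounded_linear_J[OF r2]]
  note J_simps = linear_0[OF lin] linear_add[OF lin, symmetric] linear_diff[OF lin, symmetric]
    J_scaleC[OF r2, symmetric] J_one[OF r2]
  obtain m where m: "algebra_mult m" "\<And>u v. ?J u * ?J v = ?J (m u v)"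
    using bessel_space_algebra(1)[OF r] by blast
  obtain K where K: "\<And>u v. norm (m u v) \<le> norm u * norm v * K"
    using bounded_bilinear.bounded[OF algebra_multD(1)[OF m(1)]] by blast
  have "subalgebra (range ?J)"
    unfolding subalgebra_def
  proof (intro conjI ballI allI)
    show "0 \<in> range ?J" "1 \<in> range ?J"
      using rangeI[of ?J 0] rangeI[of ?J 1] by (simp_all only: linear_0[OF lin] J_one[OF r2])
  next
    fix x y assume "x \<in> range ?J" "y \<in> range ?J"
    then obtain u v where "x = ?J u" "y = ?J v" by blast
    then show "x + y \<in> range ?J" "x * y \<in> range ?J"
      by (simp_all only: J_simps m(2) rangeI)
  next
    fix c x assume "x \<in> range ?J"
    then obtain u where "x = ?J u" by blast
    then show "c *\<^sub>C x \<in> range ?J"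
      by (simp only: J_simps rangeI)
  qed
  moreover have "\<forall>x\<in>range ?J. 0 \<le> bessel_norm \<psi> r x \<and> (bessel_norm \<psi> r x = 0 \<longleftrightarrow> x = 0)"
  proof
    fix x assume "x \<in> range ?J"
    then obtain u where u: "x = ?J u" by blast
    have "?J u = 0 \<longleftrightarrow> u = 0"
      using inj_eq[OF bessel_space_algebra(2)[OF r], of u 0] by (simp only: linear_0[OF lin])
    then show "0 \<le> bessel_norm \<psi> r x \<and> (bessel_norm \<psi> r x = 0 \<longleftrightarrow> x = 0)"
      by (simp add: u bessel_norm_J[OF r])
  qed
  moreover have "\<forall>c. \<forall>x\<in>range ?J. bessel_norm \<psi> r (c *\<^sub>C x) = cmod c * bessel_norm \<psi> r x"
  proof (intro allI ballI)
    fix c x assume "x \<in> range ?J"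
    then obtain u where "x = ?J u" by blast
    then show "bessel_norm \<psi> r (c *\<^sub>C x) = cmod c * bessel_norm \<psi> r x"
      by (simp only: J_simps bessel_norm_J[OF r] norm_scaleC)
  qed
  moreover have "\<forall>x\<in>range ?J. \<forall>y\<in>range ?J. bessel_norm \<psi> r (x + y) \<le> bessel_norm \<psi> r x + bessel_norm \<psi> r y"
  proof (intro ballI)
    fix x y assume "x \<in> range ?J" "y \<in> range ?J"
    then obtain u v where "x = ?J u" "y = ?J v" by blast
    then show "bessel_norm \<psi> r (x + y) \<le> bessel_norm \<psi> r x + bessel_norm \<psi> r y"
      by (simp only: J_simps bessel_norm_J[OF r] norm_triangle_ineq)
  qed
  moreover have "\<exists>x\<in>range ?J. (\<lambda>n. bessel_norm \<psi> r (X n - x)) \<longlonglongrightarrow> 0"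
    if X: "\<forall>n. X n \<in> range ?J" "\<forall>e>0. \<exists>n0. \<forall>m\<ge>n0. \<forall>n\<ge>n0. bessel_norm \<psi> r (X m - X n) < e" for X
  proof -
    obtain Y where Y: "\<And>n. X n = ?J (Y n)"
      using choice[of "\<lambda>n y. X n = ?J y"] X(1) by blast
    have "Cauchy Y"
      using X(2) by (intro CauchyI) (simp only: Y J_simps bessel_norm_J[OF r])
    then obtain z where "Y \<longlonglongrightarrow> z"
      by (auto simp: Cauchy_convergent_iff convergent_def)
    then have "(\<lambda>n. bessel_norm \<psi> r (X n - ?J z)) \<longlonglongrightarrow> 0"
      by (simp only: Y J_simps bessel_norm_J[OF r] tendsto_norm_zero_iff LIM_zero)
    then show ?thesis by blast
  qed
  moreover have "\<exists>K. \<forall>x\<in>range ?J. \<forall>y\<in>range ?J. bessel_norm \<psi> r (x * y) \<le> K * bessel_norm \<psi> r x * bessel_norm \<psi> r y"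
  proof (intro exI[of _ K] ballI)
    fix x y assume "x \<in> range ?J" "y \<in> range ?J"
    then obtain u v where "x = ?J u" "y = ?J v" by blast
    then show "bessel_norm \<psi> r (x * y) \<le> K * bessel_norm \<psi> r x * bessel_norm \<psi> r y"
      using K[of u v] by (simp add: m(2) bessel_norm_J[OF r] mult.commute mult.left_commute)
  qed
  moreover have "\<exists>K. \<forall>x\<in>range ?J. norm x \<le> K * bessel_norm \<psi> r x"
    by (intro exI[of _ M]) (auto simp: bessel_norm_J[OF r] J_bound[OF r2])
  ultimately show ?thesis
    unfolding banach_subalgebra_def bessel_space_eq[OF r] by blast
qed

end

theorem theorem3p29:
  fixes \<psi> :: "real^'d \<Rightarrow> 'a::complex_banach_algebra \<Rightarrow> 'a"
    and r :: real
  assumes "cw_group \<psi>"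
    and "r > 0"
  shows "banach_subalgebra (bessel_space \<psi> r) (bessel_norm \<psi> r) \<and>
         inverse_closed (bessel_space \<psi> r)"
proof -
  interpret cw_action \<psi>
    by standard (rule assms)
  show ?thesis
    using bessel_space_banach_subalgebra bessel_space_inverse_closed assms(2) by blast
qed

end
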